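(* Let $q\ge 1$ and $m$ be integers with $m\ge 2q$, and let $\delta\in(-m,\infty)$ be such that $x=x(\delta,m)>\frac{1}{2q+2}$. Let $\mathbb{F}$ be a field. Then the $q$-th Betti number $\dim_{\mathbb{F}}H_q(X(\infty,\delta,m);\mathbb{F})$ of the infinite preferential attachment clique complex, with coefficients in $\mathbb{F}$, is almost surely infinite if $x\le\frac{1}{2q}$; and it is almost surely finite if $x>\frac{1}{2q}$ and $q\ge2$.
   Context: Preferential attachment graph. Let $m$ be a positive integer, $\delta\in(-m,\infty)$, and $T\ge 2$ an integer. The random graph $G(T,\delta,m)$ has nodes $1,\dots,T$, no self-loops, possibly repeated edges, and is constructed inductively. $G(2,\delta,m)$ is the deterministic graph with nodes $1,2$ and $m$ edges from node $2$ to node $1$. For $T\ge 3$, $G(T,\delta,m)$ is obtained from $G(T-1,\delta,m)$ by adding node $T$ and then adding $m$ edges from $T$ to nodes of $G(T-1,\delta,m)$ one by one: for $1\le\alpha\le m$, if $G(T-1,\delta,m,\alpha-1)$ denotes the graph after the first $\alpha-1$ edges from $T$ have been added, then conditionally on $G(T-1,\delta,m,\alpha-1)$ the $\alpha$-th edge from $T$ points to node $v\in\{1,\dots,T-1\}$ with probability $\frac{d(v)+\delta}{2(T-2)m+\alpha-1+(T-1)\delta}$, where $d(v)$ is the (total) degree of $v$ in $G(T-1,\delta,m,\alpha-1)$, counted with multiplicity. The infinite graph is the increasing union $G(\infty,\delta,m)=\bigcup_{T\ge2}G(T,\delta,m)$. The clique complex $X(\infty,\delta,m)$ is the abstract simplicial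 complex with the same nodes as $G(\infty,\delta,m)$ in which a finite nonempty set $\{v_0,\dots,v_r\}$ is a simplex if and only if there is at least one edge of $G(\infty,\delta,m)$ between each pair of distinct nodes in it. Homology is simplicial homology. Put $x(\delta,m)=1-\frac{1}{2+\delta/m}$. *)

theory Defs
  imports
    "HOL-Probability.Probability"
    "HOL-Library.Extended_Nat"
    "HOL-Library.Poly_Mapping"
    "HOL-Algebra.QuotRing"
    "Jordan_Normal_Form.VS_Connect"
begin

section \<open>Simplicial homology with field coefficients\<close>

definition simplicial_complex :: "'v set set \<Rightarrow> bool" where
  "simplicial_complex K \<longleftrightarrow>
     (\<forall>\<sigma>\<in>K. finite \<sigma> \<and> \<sigma> \<noteq> {}) \<and> (\<forall>\<sigma>\<in>K. \<forall>\<tau>. \<tau> \<subseteq> \<sigma> \<and> \<tau> \<noteq> {} \<longrightarrow> \<tau> \<in> K)"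

text \<open>Simplices are oriented by the linear order of the vertices, so that a \<open>p\<close>-chain is a
  formal linear combination of \<open>p\<close>-simplices. The fields \<^const>\<open>mult\<close> and \<^const>\<open>one\<close> of a
  module record are not part of the module structure.\<close>

definition chain_module ::
    "'v set set \<Rightarrow> nat \<Rightarrow> ('f::field, 'v set \<Rightarrow>\<^sub>0 'f) module" where
  "chain_module K p =
     \<lparr>carrier = {c. Poly_Mapping.keys c \<subseteq> {\<sigma> \<in> K. card \<sigma> = p + 1}},
      mult = undefined, one = undefined, zero = 0, add = (+),
      smult = (\<lambda>a. Poly_Mapping.map ((*) a))\<rparr>"

text \<open>The number \<open>card {u \<in> \<sigma>. u < v}\<close> is the position of \<open>v\<close> in the increasing enumeration
  \<open>v\<^sub>0 < \<dots> < v\<^sub>p\<close> of \<open>\<sigma>\<close>. The homology is not reduced.\<close>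

definition boundary ::
    "nat \<Rightarrow> ('v::linorder set \<Rightarrow>\<^sub>0 'f::field) \<Rightarrow> 'v set \<Rightarrow>\<^sub>0 'f" where
  "boundary p c =
     (if p = 0 then 0
      else \<Sum>\<sigma>\<in>Poly_Mapping.keys c. \<Sum>v\<in>\<sigma>.
             Poly_Mapping.single (\<sigma> - {v})
               ((-1) ^ card {u \<in> \<sigma>. u < v} * Poly_Mapping.lookup c \<sigma>))"

definition cycles :: "'v::linorder set set \<Rightarrow> nat \<Rightarrow> ('v set \<Rightarrow>\<^sub>0 'f::field) set" where
  "cycles K p = {c \<in> carrier (chain_module K p). boundary p c = 0}"

definition boundaries :: "'v::linorder set set \<Rightarrow> nat \<Rightarrow> ('v set \<Rightarrow>\<^sub>0 'f::field) set" where
  "boundaries K p = boundary (p + 1) ` carrier (chain_module K (p + 1))"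

definition quotient_module ::
    "('r, 'a, 'm) module_scheme \<Rightarrow> 'a set \<Rightarrow> ('r, 'a set) module" where
  "quotient_module V W =
     \<lparr>carrier = a_rcosets\<^bsub>V\<^esub> W, mult = undefined, one = undefined,
      zero = W, add = set_add V,
      smult = (\<lambda>a C. \<Union>x\<in>C. W +>\<^bsub>V\<^esub> (a \<odot>\<^bsub>V\<^esub> x))\<rparr>"

definition homology ::
    "'v::linorder set set \<Rightarrow> nat \<Rightarrow> ('f::field, ('v set \<Rightarrow>\<^sub>0 'f) set) module" where
  "homology K p = quotient_module ((chain_module K p)\<lparr>carrier := cycles K p\<rparr>) (boundaries K p)"

definition betti_number :: "'f::field itself \<Rightarrow> 'v::linorder set set \<Rightarrow> nat \<Rightarrow> enat" where
  "betti_number F K p =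
     (let H = homology K p :: ('f, ('v set \<Rightarrow>\<^sub>0 'f) set) module
      in if vectorspace.fin_dim class_ring H then enat (vectorspace.dim class_ring H) else \<infinity>)"


section \<open>Preferential attachment\<close>

text \<open>Edges are triples \<open>(s, \<beta>, v)\<close>: the \<open>\<beta>\<close>-th edge that node \<open>s\<close> sends, pointing to the
  older node \<open>v\<close>. Thus repeated edges are told apart by \<open>\<beta>\<close>, and a set of triples is a multigraph.
  In \<open>t :: nat \<Rightarrow> nat \<Rightarrow> nat\<close>, the value \<open>t s \<beta>\<close> is the target of the \<open>\<beta>\<close>-th edge of \<open>s \<ge> 3\<close>.\<close>

type_synonym multigraph = "(nat \<times> nat \<times> nat) set"

definition degree :: "multigraph \<Rightarrow> nat \<Rightarrow> nat" where
  "degree G v = card {(s, \<beta>, u). (s, \<beta>, u) \<in> G \<and> (s = v \<or> u = v)}"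

definition adjacent :: "multigraph \<Rightarrow> nat \<Rightarrow> nat \<Rightarrow> bool" where
  "adjacent G u v \<longleftrightarrow> (\<exists>\<beta>. (u, \<beta>, v) \<in> G \<or> (v, \<beta>, u) \<in> G)"

definition add_edges :: "(nat \<Rightarrow> nat \<Rightarrow> nat) \<Rightarrow> nat \<Rightarrow> nat \<Rightarrow> multigraph \<Rightarrow> multigraph" where
  "add_edges t s k G = G \<union> (\<lambda>\<beta>. (s, \<beta>, t s \<beta>)) ` {1..k}"

fun pa_graph :: "nat \<Rightarrow> (nat \<Rightarrow> nat \<Rightarrow> nat) \<Rightarrow> nat \<Rightarrow> multigraph" where
  "pa_graph m t T =
     (if T < 2 then {}
      else if T = 2 then (\<lambda>\<beta>. (2, \<beta>, 1)) ` {1..m}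
      else add_edges t T m (pa_graph m t (T - 1)))"

declare pa_graph.simps [simp del]

text \<open>The graph \<open>G(T, \<delta>, m, k)\<close>, in which node \<open>T + 1\<close> has already sent \<open>k\<close> edges.\<close>

definition pa_graph_partial ::
    "nat \<Rightarrow> (nat \<Rightarrow> nat \<Rightarrow> nat) \<Rightarrow> nat \<Rightarrow> nat \<Rightarrow> multigraph" where
  "pa_graph_partial m t T k = add_edges t (T + 1) k (pa_graph m t T)"

definition pa_graph_infinite :: "nat \<Rightarrow> (nat \<Rightarrow> nat \<Rightarrow> nat) \<Rightarrow> multigraph" where
  "pa_graph_infinite m t = (\<Union>T\<in>{2..}. pa_graph m t T)"

definition clique_complex :: "nat set \<Rightarrow> multigraph \<Rightarrow> nat set set" where
  "clique_complex V G =
     {\<sigma>. finite \<sigma> \<and> \<sigma> \<noteq> {} \<and> \<sigma> \<subseteq> V \<and> (\<forall>u\<in>\<sigma>. \<forall>v\<in>\<sigma>. u \<noteq> v \<longrightarrow> adjacent G u v)}"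

definition pa_clique_complex :: "nat \<Rightarrow> (nat \<Rightarrow> nat \<Rightarrow> nat) \<Rightarrow> nat set set" where
  "pa_clique_complex m t = clique_complex {1..} (pa_graph_infinite m t)"

text \<open>The conditional law refers to \<^const>\<open>cond_prob\<close>, hence only to graphs \<open>G\<close> of positive
  probability.\<close>

locale preferential_attachment = prob_space M for M :: "'w measure" +
  fixes m :: nat and \<delta> :: real and E :: "nat \<Rightarrow> nat \<Rightarrow> 'w \<Rightarrow> nat"
  assumes m_pos: "m > 0"
    and delta_gt: "\<delta> > - real m"
    and target_random_variable:
      "\<And>T \<alpha>. T \<ge> 3 \<Longrightarrow> \<alpha> \<in> {1..m} \<Longrightarrow> random_variable (count_space {1..T - 1}) (E T \<alpha>)"
    and target_law:
      "\<And>T \<alpha> v G. T \<ge> 3 \<Longrightarrow> \<alpha> \<in> {1..m} \<Longrightarrow> v \<in> {1..T - 1} \<Longrightarrow>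
         \<P>(\<omega> in M. pa_graph_partial m (\<lambda>s \<beta>. E s \<beta> \<omega>) (T - 1) (\<alpha> - 1) = G) > 0 \<Longrightarrow>
         \<P>(\<omega> in M. E T \<alpha> \<omega> = v \<bar> pa_graph_partial m (\<lambda>s \<beta>. E s \<beta> \<omega>) (T - 1) (\<alpha> - 1) = G)
         = (real (degree G v) + \<delta>)
           / (2 * (real T - 2) * real m + real \<alpha> - 1 + (real T - 1) * \<delta>)"

definition pa_exponent :: "real \<Rightarrow> nat \<Rightarrow> real" where
  "pa_exponent \<delta> m = 1 - 1 / (2 + \<delta> / real m)"


section \<open>Homology is a vector space\<close>

text \<open>The constants \<^const>\<open>vectorspace.fin_dim\<close> and \<^const>\<open>vectorspace.dim\<close> are only
  meaningful for vector spaces. This section shows that \<^const>\<open>betti_number\<close> applies them to one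
  whenever \<open>K\<close> is a simplicial complex, such as a clique complex.\<close>

lemma simplicial_complex_clique_complex: "simplicial_complex (clique_complex V G)"
  by (auto simp: simplicial_complex_def clique_complex_def intro: finite_subset)

lemma lookup_scale [simp]:
  "Poly_Mapping.lookup (Poly_Mapping.map ((*) (a::'f::field)) c) x = a * Poly_Mapping.lookup c x"
  by (simp add: map.rep_eq when_def)

lemma keys_scale: "Poly_Mapping.keys (Poly_Mapping.map ((*) (a::'f::field)) c) \<subseteq> Poly_Mapping.keys c"
  by (auto simp: in_keys_iff)

definition simplex_boundary :: "'v::linorder set \<Rightarrow> 'f::field \<Rightarrow> 'v set \<Rightarrow>\<^sub>0 'f" where
  "simplex_boundary \<sigma> a =
     (\<Sum>v\<in>\<sigma>. Poly_Mapping.single (\<sigma> - {v}) ((-1) ^ card {u \<in> \<sigma>. u < v} * a))"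

lemma simplex_boundary_0 [simp]: "simplex_boundary \<sigma> 0 = 0"
  by (simp add: simplex_boundary_def)

lemma simplex_boundary_add:
  "simplex_boundary \<sigma> (a + b) = simplex_boundary \<sigma> a + simplex_boundary \<sigma> b"
  by (simp add: simplex_boundary_def distrib_left single_add sum.distrib)

lemma map_scale_add:
  "Poly_Mapping.map ((*) (a::'f::field)) (c + d) =
     Poly_Mapping.map ((*) a) c + Poly_Mapping.map ((*) a) d"
  by (rule poly_mapping_eqI) (simp add: lookup_add distrib_left)

lemma map_scale_sum:
  "Poly_Mapping.map ((*) (a::'f::field)) (sum g A) = (\<Sum>x\<in>A. Poly_Mapping.map ((*) a) (g x))"
proof (induction A rule: infinite_finite_induct)
  case (insert x F)
  then show ?case by (simp add: map_scale_add)
qed (auto intro!: poly_mapping_eqI)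

lemma simplex_boundary_scale:
  "simplex_boundary \<sigma> (a * b) = Poly_Mapping.map ((*) a) (simplex_boundary \<sigma> b)"
  unfolding simplex_boundary_def map_scale_sum
  by (intro sum.cong refl poly_mapping_eqI) (simp add: lookup_single when_def)

lemma boundary_superset:
  assumes "p \<noteq> 0" "finite A" "Poly_Mapping.keys c \<subseteq> A"
  shows "boundary p c = (\<Sum>\<sigma>\<in>A. simplex_boundary \<sigma> (Poly_Mapping.lookup c \<sigma>))"
proof -
  have "boundary p c = (\<Sum>\<sigma>\<in>Poly_Mapping.keys c. simplex_boundary \<sigma> (Poly_Mapping.lookup c \<sigma>))"
    using assms(1) by (simp add: boundary_def simplex_boundary_def)
  also have "\<dots> = (\<Sum>\<sigma>\<in>A. simplex_boundary \<sigma> (Poly_Mapping.lookup c \<sigma>))"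
    using assms by (intro sum.mono_neutral_left) (auto simp: in_keys_iff)
  finally show ?thesis .
qed

lemma boundary_0 [simp]: "boundary p 0 = 0"
  by (simp add: boundary_def)

lemma boundary_add: "boundary p (c + d) = boundary p c + boundary p d"
proof (cases "p = 0")
  case False
  let ?A = "Poly_Mapping.keys c \<union> Poly_Mapping.keys d"
  have "Poly_Mapping.keys (c + d) \<subseteq> ?A"
    by (rule Poly_Mapping.keys_add)
  then show ?thesis
    using False
    by (simp add: boundary_superset[where A = ?A] lookup_add simplex_boundary_add sum.distrib)
qed (simp add: boundary_def)

lemma boundary_scale:
  "boundary p (Poly_Mapping.map ((*) a) c) = Poly_Mapping.map ((*) a) (boundary p c)"
proof (cases "p = 0")
  case False
  show ?thesis
    using False keys_scale[of a c]
    by (simp add: boundary_superset[where A = "Poly_Mapping.keys c"] simplex_boundary_scale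
        map_scale_sum)
next
  case True
  then show ?thesis
    by (auto simp: boundary_def intro!: poly_mapping_eqI)
qed

lemma boundary_sum: "boundary p (sum g A) = (\<Sum>x\<in>A. boundary p (g x))"
  by (induction A rule: infinite_finite_induct) (simp_all add: boundary_add)

lemma boundary_single:
  "p \<noteq> 0 \<Longrightarrow> boundary p (Poly_Mapping.single \<sigma> a) = simplex_boundary \<sigma> a"
  by (subst boundary_superset[where A = "{\<sigma>}"]) (auto simp: lookup_single)

lemma boundary_simplex_boundary:
  fixes \<sigma> :: "'v::linorder set" and a :: "'f::field"
  assumes "finite \<sigma>" "p \<noteq> 0"
  shows "boundary p (simplex_boundary \<sigma> a) = 0"
proof -
  define n where "n \<sigma> v = card {u \<in> \<sigma>. u < v}" for \<sigma> and v :: 'v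
  define g where "g = (\<lambda>(v, w). Poly_Mapping.single (\<sigma> - {v} - {w})
      ((-1) ^ n (\<sigma> - {v}) w * ((-1) ^ n \<sigma> v * a)))"
  have g_swap: "g (v, w) + g (w, v) = 0" if "v \<in> \<sigma>" "w \<in> \<sigma>" "v < w" for v w
  proof -
    have "{u \<in> \<sigma> - {w}. u < v} = {u \<in> \<sigma>. u < v}"
      using that by auto
    then have 1: "n (\<sigma> - {w}) v = n \<sigma> v"
      by (simp add: n_def)
    have "{u \<in> \<sigma>. u < w} = insert v {u \<in> \<sigma> - {v}. u < w}"
      using that by auto
    moreover have "finite {u \<in> \<sigma> - {v}. u < w}"
      using assms(1) by simp
    ultimately have 2: "n \<sigma> w = Suc (n (\<sigma> - {v}) w)"
      by (simp add: n_def)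
    have 3: "\<sigma> - {v} - {w} = \<sigma> - {w} - {v}"
      by auto
    show ?thesis
      unfolding g_def prod.case 1 2 3
      by (simp add: single_add[symmetric] mult_ac)
  qed
  let ?L = "{(v, w) \<in> \<sigma> \<times> \<sigma>. v < w}" and ?R = "{(v, w) \<in> \<sigma> \<times> \<sigma>. w < v}"
  have fin: "finite ?L" "finite ?R"
    using assms(1) by (auto intro: finite_subset[of _ "\<sigma> \<times> \<sigma>"])
  have "boundary p (simplex_boundary \<sigma> a) = (\<Sum>v\<in>\<sigma>. \<Sum>w\<in>\<sigma> - {v}. g (v, w))"
    unfolding simplex_boundary_def[of \<sigma>] boundary_sum
    by (simp add: boundary_single[OF assms(2)] simplex_boundary_def g_def n_def)
  also have "\<dots> = sum g (Sigma \<sigma> (\<lambda>v. \<sigma> - {v}))"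
    using assms(1) by (simp add: sum.Sigma)
  also have "Sigma \<sigma> (\<lambda>v. \<sigma> - {v}) = ?L \<union> ?R"
    by auto
  also have "sum g (?L \<union> ?R) = sum g ?L + sum g ?R"
    using fin by (intro sum.union_disjoint) auto
  also have "sum g ?R = (\<Sum>(v, w)\<in>?L. g (w, v))"
    by (rule sum.reindex_bij_witness[of _ prod.swap prod.swap]) auto
  also have "sum g ?L + \<dots> = (\<Sum>(v, w)\<in>?L. g (v, w) + g (w, v))"
    by (simp add: sum.distrib[symmetric] case_prod_beta)
  also have "\<dots> = 0"
    using g_swap by (intro sum.neutral) auto
  finally show ?thesis .
qed

lemma boundary_boundary:
  assumes "\<And>\<sigma>. \<sigma> \<in> Poly_Mapping.keys c \<Longrightarrow> finite \<sigma>"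
  shows "boundary p (boundary (p + 1) c) = 0"
proof (cases "p = 0")
  case False
  have "boundary p (boundary (p + 1) c) =
      (\<Sum>\<sigma>\<in>Poly_Mapping.keys c. boundary p (simplex_boundary \<sigma> (Poly_Mapping.lookup c \<sigma>)))"
    by (subst boundary_superset[of "p + 1" "Poly_Mapping.keys c"]) (simp_all add: boundary_sum)
  then show ?thesis
    using assms False by (simp add: boundary_simplex_boundary)
qed (simp add: boundary_def)

lemma keys_sum_subset:
  "Poly_Mapping.keys (sum g A) \<subseteq> (\<Union>x\<in>A. Poly_Mapping.keys (g x))"
proof (induction A rule: infinite_finite_induct)
  case (insert x F)
  then show ?case
    using Poly_Mapping.keys_add[of "g x" "sum g F"] by auto
qed auto

lemma boundary_in_chain_module:
  assumes "simplicial_complex K" "c \<in> carrier (chain_module K (p + 1))"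
  shows "boundary (p + 1) c \<in> carrier (chain_module K p)"
proof -
  have "Poly_Mapping.keys (simplex_boundary \<sigma> a) \<subseteq> {\<sigma> \<in> K. card \<sigma> = p + 1}"
    if "\<sigma> \<in> Poly_Mapping.keys c" for \<sigma> and a :: 'b
  proof -
    have \<sigma>: "\<sigma> \<in> K" "card \<sigma> = p + 2"
      using that assms(2) by (auto simp: chain_module_def)
    then have "finite \<sigma>"
      using assms(1) by (auto simp: simplicial_complex_def)
    have "\<sigma> - {v} \<in> K \<and> card (\<sigma> - {v}) = p + 1" if "v \<in> \<sigma>" for v
    proof
      show c: "card (\<sigma> - {v}) = p + 1"
        using \<sigma> that \<open>finite \<sigma>\<close> by simp
      then have "\<sigma> - {v} \<noteq> {}"
        by (metis add_is_0 card.empty one_neq_zero)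
      then show "\<sigma> - {v} \<in> K"
        using assms(1) \<sigma>(1) unfolding simplicial_complex_def by (metis Diff_subset)
    qed
    then show ?thesis
      unfolding simplex_boundary_def
      by (intro order.trans[OF keys_sum_subset] UN_least) (simp add: keys_single)
  qed
  then have "(\<Union>\<sigma>\<in>Poly_Mapping.keys c.
      Poly_Mapping.keys (simplex_boundary \<sigma> (Poly_Mapping.lookup c \<sigma>))) \<subseteq> {\<sigma> \<in> K. card \<sigma> = p + 1}"
    by (rule UN_least)
  moreover have "boundary (p + 1) c =
      (\<Sum>\<sigma>\<in>Poly_Mapping.keys c. simplex_boundary \<sigma> (Poly_Mapping.lookup c \<sigma>))"
    by (rule boundary_superset) simp_all
  ultimately have "Poly_Mapping.keys (boundary (p + 1) c) \<subseteq> {\<sigma> \<in> K. card \<sigma> = p + 1}"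
    using order.trans[OF keys_sum_subset] by simp
  then show ?thesis
    by (simp add: chain_module_def)
qed

lemma quotient_module_vectorspace:
  assumes "vectorspace R V" "subspace R W V"
  shows "vectorspace R (quotient_module V W)"
proof -
  interpret V: vectorspace R V by fact
  interpret S: submodule R W V
    using assms(2) by (simp add: subspace_def)
  have "subgroup W (add_monoid V)"
  proof
    show "inv\<^bsub>add_monoid V\<^esub> x \<in> W" if "x \<in> W" for x
    proof -
      have "\<ominus>\<^bsub>V\<^esub> x = (\<ominus>\<^bsub>R\<^esub> \<one>\<^bsub>R\<^esub>) \<odot>\<^bsub>V\<^esub> x"
        using that S.subset by (auto simp: V.smult_minus_1)
      then show ?thesis
        using that S.smult_closed[of "\<ominus>\<^bsub>R\<^esub> \<one>\<^bsub>R\<^esub>" x] by (simp add: a_inv_def)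
    qed
  qed (use S.subset S.m_closed S.zero_closed in auto)
  then have "additive_subgroup W V"
    by (simp add: additive_subgroup_def)
  then interpret W: abelian_subgroup W V
    by (rule abelian_subgroupI3) (rule V.abelian_group_axioms)
  have smult: "a \<odot>\<^bsub>quotient_module V W\<^esub> (W +>\<^bsub>V\<^esub> x) = W +>\<^bsub>V\<^esub> (a \<odot>\<^bsub>V\<^esub> x)"
    if a: "a \<in> carrier R" and x: "x \<in> carrier V" for a x
  proof -
    have "W +>\<^bsub>V\<^esub> (a \<odot>\<^bsub>V\<^esub> y) = W +>\<^bsub>V\<^esub> (a \<odot>\<^bsub>V\<^esub> x)" if y: "y \<in> W +>\<^bsub>V\<^esub> x" for y
    proof -
      obtain w where w: "w \<in> W" "y = w \<oplus>\<^bsub>V\<^esub> x"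
        using y by (auto simp: a_r_coset_def')
      then have "w \<in> carrier V"
        using S.subset by auto
      then have "a \<odot>\<^bsub>V\<^esub> y = a \<odot>\<^bsub>V\<^esub> w \<oplus>\<^bsub>V\<^esub> a \<odot>\<^bsub>V\<^esub> x"
        using w a x by (simp add: V.smult_r_distr)
      moreover have "a \<odot>\<^bsub>V\<^esub> w \<in> W"
        using a w(1) by (rule S.smult_closed)
      ultimately have "a \<odot>\<^bsub>V\<^esub> y \<in> W +>\<^bsub>V\<^esub> (a \<odot>\<^bsub>V\<^esub> x)"
        by (auto simp: a_r_coset_def')
      then show ?thesis
        using a x by (metis W.a_repr_independence' V.smult_closed)
    qed
    moreover have "W +>\<^bsub>V\<^esub> x \<noteq> {}"
      using W.a_rcos_self[OF x] by blast
    ultimately have "(\<Union>y\<in>W +>\<^bsub>V\<^esub> x. W +>\<^bsub>V\<^esub> (a \<odot>\<^bsub>V\<^esub> y)) = W +>\<^bsub>V\<^esub> (a \<odot>\<^bsub>V\<^esub> x)"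
      by (intro SUP_eq_const)
    then show ?thesis
      by (simp add: quotient_module_def)
  qed
  have add: "(W +>\<^bsub>V\<^esub> x) \<oplus>\<^bsub>quotient_module V W\<^esub> (W +>\<^bsub>V\<^esub> y) = W +>\<^bsub>V\<^esub> (x \<oplus>\<^bsub>V\<^esub> y)"
    if "x \<in> carrier V" "y \<in> carrier V" for x y
    using that by (simp add: quotient_module_def W.a_rcos_sum)
  have zero: "\<zero>\<^bsub>quotient_module V W\<^esub> = W +>\<^bsub>V\<^esub> \<zero>\<^bsub>V\<^esub>"
    by (simp add: quotient_module_def W.a_subset)
  have carrier: "carrier (quotient_module V W) = (\<lambda>x. W +>\<^bsub>V\<^esub> x) ` carrier V"
    by (auto simp: quotient_module_def A_RCOSETS_def' a_r_coset_def')
  show ?thesis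
  proof (rule vs_criteria)
    show "\<forall>v\<in>carrier (quotient_module V W). \<exists>neg_v\<in>carrier (quotient_module V W).
        v \<oplus>\<^bsub>quotient_module V W\<^esub> neg_v = \<zero>\<^bsub>quotient_module V W\<^esub>"
    proof
      fix v
      assume "v \<in> carrier (quotient_module V W)"
      then obtain x where x: "x \<in> carrier V" "v = W +>\<^bsub>V\<^esub> x"
        by (auto simp: carrier)
      show "\<exists>neg_v\<in>carrier (quotient_module V W).
          v \<oplus>\<^bsub>quotient_module V W\<^esub> neg_v = \<zero>\<^bsub>quotient_module V W\<^esub>"
        using x by (intro bexI[of _ "W +>\<^bsub>V\<^esub> (\<ominus>\<^bsub>V\<^esub> x)"]) (auto simp: carrier add zero V.r_neg)
    qed
  qed (auto simp: carrier add smult zero V.field_axioms V.a_ac V.smult_assoc1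
      V.smult_l_distr V.smult_r_distr)
qed

lemma chain_module_vectorspace:
  "vectorspace class_ring (chain_module K p :: ('f::field, _) module)" (is "vectorspace _ ?C")
proof (rule vs_criteria)
  show "\<forall>v\<in>carrier ?C. \<exists>w\<in>carrier ?C. v \<oplus>\<^bsub>?C\<^esub> w = \<zero>\<^bsub>?C\<^esub>"
  proof
    fix v
    assume "v \<in> carrier ?C"
    then show "\<exists>w\<in>carrier ?C. v \<oplus>\<^bsub>?C\<^esub> w = \<zero>\<^bsub>?C\<^esub>"
      by (intro bexI[of _ "- v"]) (auto simp: chain_module_def)
  qed
  show "\<forall>v w. v \<in> carrier ?C \<and> w \<in> carrier ?C \<longrightarrow> v \<oplus>\<^bsub>?C\<^esub> w \<in> carrier ?C"
    by (simp add: chain_module_def) (meson Poly_Mapping.keys_add Un_least order.trans)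
  show "\<forall>a v. a \<in> carrier class_ring \<and> v \<in> carrier ?C \<longrightarrow> a \<odot>\<^bsub>?C\<^esub> v \<in> carrier ?C"
    by (simp add: chain_module_def) (meson keys_scale order.trans)
qed (simp_all add: chain_module_def class_field add_ac poly_mapping_eq_iff fun_eq_iff lookup_add
    algebra_simps)

lemma submodule_cycles:
  "submodule class_ring (cycles K p) (chain_module K p :: ('f::field, _) module)"
proof -
  interpret vectorspace class_ring "chain_module K p :: ('f, _) module"
    by (rule chain_module_vectorspace)
  show ?thesis
  proof
    fix v w :: "_ \<Rightarrow>\<^sub>0 'f"
    assume "v \<in> cycles K p" "w \<in> cycles K p"
    then show "v \<oplus>\<^bsub>chain_module K p\<^esub> w \<in> cycles K p"
      using M.a_closed by (auto simp: cycles_def) (simp add: chain_module_def boundary_add)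
  next
    fix a :: 'f and v :: "_ \<Rightarrow>\<^sub>0 'f"
    assume "a \<in> carrier class_ring" "v \<in> cycles K p"
    then show "a \<odot>\<^bsub>chain_module K p\<^esub> v \<in> cycles K p"
      using smult_closed[of a v]
      by (auto simp: cycles_def) (auto simp: chain_module_def boundary_scale intro!: poly_mapping_eqI)
  qed (use M.zero_closed in \<open>auto simp: cycles_def\<close>, simp add: chain_module_def)
qed

lemma boundaries_subset_cycles:
  assumes "simplicial_complex K"
  shows "boundaries K p \<subseteq> cycles K p"
proof
  fix b :: "_ \<Rightarrow>\<^sub>0 'f::field"
  assume "b \<in> boundaries K p"
  then obtain c where c: "c \<in> carrier (chain_module K (p + 1))" "b = boundary (p + 1) c"
    by (auto simp: boundaries_def)
  have "finite \<sigma>" if "\<sigma> \<in> Poly_Mapping.keys c" for \<sigma>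
    using that c(1) assms by (auto simp: chain_module_def simplicial_complex_def)
  then have "boundary p b = 0"
    unfolding c(2) by (rule boundary_boundary)
  with c show "b \<in> cycles K p"
    using boundary_in_chain_module[OF assms c(1)] by (simp add: cycles_def)
qed

theorem homology_vectorspace:
  assumes "simplicial_complex K"
  shows "vectorspace class_ring (homology K p :: ('f::field, ('v::linorder set \<Rightarrow>\<^sub>0 'f) set) module)"
proof -
  let ?Z = "(chain_module K p)\<lparr>carrier := cycles K p\<rparr> :: ('f, 'v set \<Rightarrow>\<^sub>0 'f) module"
  interpret C: vectorspace class_ring "chain_module K (p + 1) :: ('f, 'v set \<Rightarrow>\<^sub>0 'f) module"
    by (rule chain_module_vectorspace)
  have Z: "vectorspace class_ring ?Z"
    by (intro vectorspace.subspace_is_vs subspace.intro chain_module_vectorspace submodule_cycles)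
  then interpret Z: vectorspace class_ring ?Z .
  have "submodule class_ring (boundaries K p) ?Z"
  proof
    show "boundaries K p \<subseteq> carrier ?Z"
      using boundaries_subset_cycles[OF assms] by simp
  next
    fix v w :: "'v set \<Rightarrow>\<^sub>0 'f"
    assume "v \<in> boundaries K p" "w \<in> boundaries K p"
    then obtain c d where "c \<in> carrier (chain_module K (p + 1))" "v = boundary (p + 1) c"
        "d \<in> carrier (chain_module K (p + 1))" "w = boundary (p + 1) d"
      by (auto simp: boundaries_def)
    then show "v \<oplus>\<^bsub>?Z\<^esub> w \<in> boundaries K p"
      using C.M.a_closed[of c d]
      by (auto simp: boundaries_def chain_module_def boundary_add[symmetric] simp del: One_nat_def)
  next
    fix a :: 'f and v :: "'v set \<Rightarrow>\<^sub>0 'f"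
    assume "v \<in> boundaries K p"
    then obtain c where "c \<in> carrier (chain_module K (p + 1))" "v = boundary (p + 1) c"
      by (auto simp: boundaries_def)
    then show "a \<odot>\<^bsub>?Z\<^esub> v \<in> boundaries K p"
      using C.smult_closed[of a c]
      by (auto simp: boundaries_def chain_module_def boundary_scale[symmetric])
  next
    show "\<zero>\<^bsub>?Z\<^esub> \<in> boundaries K p"
      unfolding boundaries_def by (rule image_eqI[of _ _ 0]) (auto simp: chain_module_def)
  qed
  with Z show ?thesis
    unfolding homology_def by (intro quotient_module_vectorspace) (auto simp: subspace_def)
qed

end

(* Adding node T attaches a cone over its link, the clique complex L on its at most m older
   neighbours. So H_q can only grow at T if the reduced H_(q-1)(L) is nonzero, and can only
   shrink if H_q(L) is nonzero.

   If H_(n-1)(L) is nonzero, a minimal vertex set W of L carrying homology has at least 2 n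
   vertices, each with at least 2 (n - 1) neighbours in W. An edge from s to u < s has
   probability about s^-x u^(x-1), and the joint probability of finitely many edges is bounded by
   the product of these. Lowering x to at most 1/2 only weakens the bound, and for n >= 2 the
   expected number of such W is then at most a constant times T^(-2 n x). By Borel-Cantelli, only
   finitely many links have homology in this degree if 2 n x > 1. The case n = q gives the
   finiteness, and n = q + 1 shows that finally no class in H_q dies.

   For 2 q x <= 1, fix a set V of at most 2 q nodes. Their degrees at time T are of order
   T^(1-x), so T attaches to all of V with conditional probability at least of order
   T^(-|V| x), which is not summable. Hence almost surely this happens infinitely often, and
   moreover with the other edges of T avoiding the neighbours of a chosen node of V. Iterated
   suspension over pairs of nonadjacent such T yields the boundary z of a cross-polytope with 2 q
   vertices. Its cones from infinitely many T, on whose links z is not a boundary, differ by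
   cycles that create infinitely many independent classes in H_q. *)

theory Submission
  imports Defs "HOL-Real_Asymp.Real_Asymp"
begin

text \<open>Both ranges of \<open>q\<close> come from one estimate. In a core, the edge from
  \<open>T\<close> alone gives each node \<open>w\<close> only \<open>w powr (x - 1)\<close>, which
  is not summable. Two inner edges per node, guaranteed for \<open>n \<ge> 2\<close>, and the
  symmetric bound with exponent \<open>- x\<close> at each end of an inner edge, valid for
  \<open>x \<le> 1 / 2\<close>, improve this to the summable \<open>w powr - (1 + x)\<close>. For
  \<open>n = 1\<close> a core may consist of two isolated nodes and the estimate breaks down; this
  is why finiteness is restricted to \<open>q \<ge> 2\<close>, while infinitude uses
  \<open>n = q + 1\<close>.

  The edges are dependent. Viewing the process as an urn with finitely many histories at each step
  reduces all moments to finite sums: rising factorials give the upper bounds, a negative moment the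
  lower bound for degrees. The latter holds with high probability at each single time, not at all
  times simultaneously. Hence the divergence of the conditional attachment probabilities is
  established only in probability, and is combined with an exponential supermartingale.\<close>

section \<open>Augmented chains and cones\<close>

text \<open>Unlike \<^const>\<open>boundary\<close>, this includes the augmentation: a vertex is mapped to the empty
  simplex. Chains are graded by the number of vertices, so that degree \<open>n\<close> below is dimension
  \<open>n - 1\<close> and \<open>no_homology\<close> refers to reduced homology.\<close>

definition aug_boundary :: "('v::linorder set \<Rightarrow>\<^sub>0 'f::field) \<Rightarrow> 'v set \<Rightarrow>\<^sub>0 'f" where
  "aug_boundary c = (\<Sum>\<sigma>\<in>Poly_Mapping.keys c. simplex_boundary \<sigma> (Poly_Mapping.lookup c \<sigma>))"

text \<open>The sign moves \<open>w\<close> from its place in the ordered simplex to the front, so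
  that the cone formula for the boundary has the same form for every position of
  \<open>w\<close>.\<close>

definition cone_simplex :: "'v::linorder \<Rightarrow> 'v set \<Rightarrow> 'f::field \<Rightarrow> 'v set \<Rightarrow>\<^sub>0 'f" where
  "cone_simplex w \<sigma> a = Poly_Mapping.single (insert w \<sigma>) ((-1) ^ card {u \<in> \<sigma>. u < w} * a)"

definition chain_cone :: "'v::linorder \<Rightarrow> ('v set \<Rightarrow>\<^sub>0 'f::field) \<Rightarrow> 'v set \<Rightarrow>\<^sub>0 'f" where
  "chain_cone w c = (\<Sum>\<sigma>\<in>Poly_Mapping.keys c. cone_simplex w \<sigma> (Poly_Mapping.lookup c \<sigma>))"

text \<open>Additivity of linear extensions that are written as sums over the support. Cancellation
  may shrink the support of \<open>c + d\<close>, so all sums are taken over the union, where the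
  extra terms \<open>f \<sigma> 0\<close> vanish.\<close>

lemma sum_keys_add:
  fixes c d :: "'a \<Rightarrow>\<^sub>0 'f::field" and f :: "'a \<Rightarrow> 'f \<Rightarrow> 'b::ab_group_add"
  assumes "\<And>\<sigma> a b. f \<sigma> (a + b) = f \<sigma> a + f \<sigma> b"
  shows "(\<Sum>\<sigma>\<in>Poly_Mapping.keys (c + d). f \<sigma> (Poly_Mapping.lookup (c + d) \<sigma>)) =
    (\<Sum>\<sigma>\<in>Poly_Mapping.keys c. f \<sigma> (Poly_Mapping.lookup c \<sigma>)) +
    (\<Sum>\<sigma>\<in>Poly_Mapping.keys d. f \<sigma> (Poly_Mapping.lookup d \<sigma>))"
proof -
  have f0: "f \<sigma> 0 = 0" for \<sigma>
    using assms[of \<sigma> 0 0] by simp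
  have *: "(\<Sum>\<sigma>\<in>Poly_Mapping.keys e. f \<sigma> (Poly_Mapping.lookup e \<sigma>)) =
      (\<Sum>\<sigma>\<in>Poly_Mapping.keys c \<union> Poly_Mapping.keys d. f \<sigma> (Poly_Mapping.lookup e \<sigma>))"
    if "Poly_Mapping.keys e \<subseteq> Poly_Mapping.keys c \<union> Poly_Mapping.keys d" for e
    by (rule sum.mono_neutral_left) (use that in \<open>auto simp: in_keys_iff f0\<close>)
  show ?thesis
    by (subst (1 2 3) *) (use Poly_Mapping.keys_add[of c d] in \<open>auto simp: lookup_add assms sum.distrib\<close>)
qed

lemma cone_simplex_add: "cone_simplex w \<sigma> (a + b) = cone_simplex w \<sigma> a + cone_simplex w \<sigma> b"
  by (simp add: cone_simplex_def distrib_left single_add)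

lemma aug_boundary_add: "aug_boundary (c + d) = aug_boundary c + aug_boundary d"
  unfolding aug_boundary_def by (rule sum_keys_add) (rule simplex_boundary_add)

lemma chain_cone_add: "chain_cone w (c + d) = chain_cone w c + chain_cone w d"
  unfolding chain_cone_def by (rule sum_keys_add) (rule cone_simplex_add)

lemma aug_boundary_0 [simp]: "aug_boundary 0 = 0"
  by (simp add: aug_boundary_def)

lemma chain_cone_0 [simp]: "chain_cone w 0 = 0"
  by (simp add: chain_cone_def)

lemma aug_boundary_uminus: "aug_boundary (- c) = - aug_boundary c"
  by (rule minus_unique[symmetric]) (simp add: aug_boundary_add[symmetric])

lemma chain_cone_uminus: "chain_cone w (- c) = - chain_cone w c"
  by (rule minus_unique[symmetric]) (simp add: chain_cone_add[symmetric])

lemma aug_boundary_diff: "aug_boundary (c - d) = aug_boundary c - aug_boundary d"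
  using aug_boundary_add[of c "- d"] by (simp add: aug_boundary_uminus)

lemma chain_cone_diff: "chain_cone w (c - d) = chain_cone w c - chain_cone w d"
  using chain_cone_add[of w c "- d"] by (simp add: chain_cone_uminus)

lemma aug_boundary_sum: "aug_boundary (sum g A) = (\<Sum>x\<in>A. aug_boundary (g x))"
  by (induction A rule: infinite_finite_induct) (simp_all add: aug_boundary_add)

lemma chain_cone_sum: "chain_cone w (sum g A) = (\<Sum>x\<in>A. chain_cone w (g x))"
  by (induction A rule: infinite_finite_induct) (simp_all add: chain_cone_add)

lemma aug_boundary_single: "aug_boundary (Poly_Mapping.single \<sigma> a) = simplex_boundary \<sigma> a"
  by (cases "a = 0") (simp_all add: aug_boundary_def)

lemma chain_cone_single: "chain_cone w (Poly_Mapping.single \<sigma> a) = cone_simplex w \<sigma> a"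
  by (cases "a = 0") (simp_all add: chain_cone_def cone_simplex_def)

lemma boundary_eq_aug_boundary: "p \<noteq> 0 \<Longrightarrow> boundary p c = aug_boundary c"
  by (simp add: aug_boundary_def boundary_superset[where A = "Poly_Mapping.keys c"])

lemma poly_mapping_eq_sum_single:
  fixes c :: "'a \<Rightarrow>\<^sub>0 'f::field"
  shows "c = (\<Sum>\<sigma>\<in>Poly_Mapping.keys c. Poly_Mapping.single \<sigma> (Poly_Mapping.lookup c \<sigma>))"
proof (rule poly_mapping_eqI)
  fix x
  show "Poly_Mapping.lookup c x = Poly_Mapping.lookup
      (\<Sum>\<sigma>\<in>Poly_Mapping.keys c. Poly_Mapping.single \<sigma> (Poly_Mapping.lookup c \<sigma>)) x"
    by (cases "x \<in> Poly_Mapping.keys c")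
      (auto simp: lookup_sum lookup_single when_def in_keys_iff sum.delta)
qed

text \<open>Deleting \<open>w\<close> gives back \<sigma>, since its sign occurs twice. Deleting
  \<open>v \<in> \<sigma>\<close> gives the cone over a face with the opposite sign: if
  \<open>w < v\<close>, then \<open>w\<close> shifts the position of \<open>v\<close> by one, and if
  \<open>v < w\<close>, the deletion of \<open>v\<close> shifts that of \<open>w\<close>.\<close>

lemma aug_boundary_chain_cone_simplex:
  fixes a :: "'f::field"
  assumes "finite \<sigma>" "w \<notin> \<sigma>"
  shows "aug_boundary (cone_simplex w \<sigma> a) =
    Poly_Mapping.single \<sigma> a - chain_cone w (simplex_boundary \<sigma> a)"
proof -
  define n where "n \<sigma> v = card {u \<in> \<sigma>. u < v}" for \<sigma> and v :: 'a
  let ?b = "(-1) ^ n \<sigma> w * a"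
  have "{u \<in> insert w \<sigma>. u < w} = {u \<in> \<sigma>. u < w}"
    by auto
  then have 1: "n (insert w \<sigma>) w = n \<sigma> w"
    by (simp add: n_def)
  have 2: "Poly_Mapping.single (insert w \<sigma> - {v}) ((-1) ^ n (insert w \<sigma>) v * ?b) =
      - chain_cone w (Poly_Mapping.single (\<sigma> - {v}) ((-1) ^ n \<sigma> v * a))" if v: "v \<in> \<sigma>" for v
  proof -
    have set: "insert w \<sigma> - {v} = insert w (\<sigma> - {v})"
      using v assms by auto
    consider "w < v" | "v < w"
      using v assms(2) by (cases w v rule: linorder_cases) auto
    then have "(-1) ^ n (insert w \<sigma>) v * ?b = - ((-1) ^ n (\<sigma> - {v}) w * ((-1) ^ n \<sigma> v * a))"
    proof cases
      case 1
      then have "{u \<in> insert w \<sigma>. u < v} = insert w {u \<in> \<sigma>. u < v}" "{u \<in> \<sigma> - {v}. u < w} = {u \<in> \<sigma>. u < w}"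
        by auto
      with assms show ?thesis
        by (simp add: n_def)
    next
      case 2
      then have "{u \<in> insert w \<sigma>. u < v} = {u \<in> \<sigma>. u < v}" "{u \<in> \<sigma>. u < w} = insert v {u \<in> \<sigma> - {v}. u < w}"
        using v by auto
      with assms show ?thesis
        by (simp add: n_def)
    qed
    then show ?thesis
      by (simp add: set chain_cone_single cone_simplex_def n_def single_uminus)
  qed
  have "aug_boundary (cone_simplex w \<sigma> a) = simplex_boundary (insert w \<sigma>) ?b"
    by (simp add: cone_simplex_def aug_boundary_single n_def)
  also have "\<dots> = Poly_Mapping.single (insert w \<sigma> - {w}) ((-1) ^ n (insert w \<sigma>) w * ?b) +
      (\<Sum>v\<in>\<sigma>. Poly_Mapping.single (insert w \<sigma> - {v}) ((-1) ^ n (insert w \<sigma>) v * ?b))"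
    unfolding simplex_boundary_def n_def using assms by (subst sum.insert) auto
  also have "insert w \<sigma> - {w} = \<sigma>"
    using assms by auto
  also have "(-1) ^ n (insert w \<sigma>) w * ?b = a"
    unfolding 1 by (simp add: mult.assoc[symmetric] power_add[symmetric] flip: mult_2)
  also have "(\<Sum>v\<in>\<sigma>. Poly_Mapping.single (insert w \<sigma> - {v}) ((-1) ^ n (insert w \<sigma>) v * ?b)) =
      - chain_cone w (simplex_boundary \<sigma> a)"
    unfolding simplex_boundary_def chain_cone_sum sum_negf[symmetric] n_def[symmetric]
    by (rule sum.cong[OF refl]) (rule 2)
  finally show ?thesis
    by simp
qed

text \<open>The chains to which the cone formula with apex \<open>w\<close> applies. Finiteness is
  included because the signs are cardinalities.\<close>

definition avoids :: "'v \<Rightarrow> ('v set \<Rightarrow>\<^sub>0 'f::zero) \<Rightarrow> bool" where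
  "avoids w c \<longleftrightarrow> (\<forall>\<sigma>\<in>Poly_Mapping.keys c. finite \<sigma> \<and> w \<notin> \<sigma>)"

lemma aug_boundary_chain_cone:
  assumes "avoids w c"
  shows "aug_boundary (chain_cone w c) = c - chain_cone w (aug_boundary c)"
proof -
  let ?s = "\<lambda>\<sigma>. Poly_Mapping.single \<sigma> (Poly_Mapping.lookup c \<sigma>)"
  have "aug_boundary (chain_cone w c) = (\<Sum>\<sigma>\<in>Poly_Mapping.keys c. ?s \<sigma> - chain_cone w (simplex_boundary \<sigma> (Poly_Mapping.lookup c \<sigma>)))"
    unfolding chain_cone_def[of w c] aug_boundary_sum
    by (intro sum.cong refl aug_boundary_chain_cone_simplex) (use assms in \<open>auto simp: avoids_def\<close>)
  also have "\<dots> = c - chain_cone w (aug_boundary c)"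
    by (simp add: sum_subtractf poly_mapping_eq_sum_single[symmetric] aug_boundary_def chain_cone_sum)
  finally show ?thesis .
qed

lemma keys_chain_cone: "Poly_Mapping.keys (chain_cone w c) \<subseteq> insert w ` Poly_Mapping.keys c"
  unfolding chain_cone_def by (intro order.trans[OF keys_sum_subset]) (auto simp: cone_simplex_def split: if_splits)

lemma keys_simplex_boundary: "Poly_Mapping.keys (simplex_boundary \<sigma> a) \<subseteq> (\<lambda>v. \<sigma> - {v}) ` \<sigma>"
  unfolding simplex_boundary_def by (intro order.trans[OF keys_sum_subset]) (auto split: if_splits)

lemma keys_aug_boundary:
  "Poly_Mapping.keys (aug_boundary c) \<subseteq> (\<Union>\<sigma>\<in>Poly_Mapping.keys c. (\<lambda>v. \<sigma> - {v}) ` \<sigma>)"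
  unfolding aug_boundary_def using keys_simplex_boundary
  by (intro order.trans[OF keys_sum_subset] UN_mono) auto

lemma avoids_aug_boundary: "avoids w c \<Longrightarrow> avoids w (aug_boundary c)"
  using keys_aug_boundary[of c] by (fastforce simp: avoids_def)

lemma keys_add_subset: "Poly_Mapping.keys c \<subseteq> S \<Longrightarrow> Poly_Mapping.keys d \<subseteq> S \<Longrightarrow> Poly_Mapping.keys (c + d) \<subseteq> S"
  using Poly_Mapping.keys_add[of c d] by auto

lemma keys_diff_subset:
  fixes c d :: "'a \<Rightarrow>\<^sub>0 'f::field"
  shows "Poly_Mapping.keys c \<subseteq> S \<Longrightarrow> Poly_Mapping.keys d \<subseteq> S \<Longrightarrow> Poly_Mapping.keys (c - d) \<subseteq> S"
  unfolding subset_iff in_keys_iff lookup_minus by (metis diff_self)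

lemma avoids_add: "avoids w c \<Longrightarrow> avoids w d \<Longrightarrow> avoids w (c + d)"
  using Poly_Mapping.keys_add[of c d] by (auto simp: avoids_def)

lemma avoids_diff: "avoids w c \<Longrightarrow> avoids w d \<Longrightarrow> avoids w (c - d)"
  for c d :: "'v set \<Rightarrow>\<^sub>0 'f::field"
  using keys_diff_subset[of c "{\<sigma>. finite \<sigma> \<and> w \<notin> \<sigma>}" d] by (auto simp: avoids_def)

lemma lookup_avoids: "avoids w c \<Longrightarrow> w \<in> \<sigma> \<Longrightarrow> Poly_Mapping.lookup c \<sigma> = 0"
  by (meson avoids_def not_in_keys_iff_lookup_eq_zero)

lemma lookup_chain_cone:
  assumes "avoids w c" "w \<notin> \<sigma>"
  shows "Poly_Mapping.lookup (chain_cone w c) (insert w \<sigma>) = (-1) ^ card {u \<in> \<sigma>. u < w} * Poly_Mapping.lookup c \<sigma>"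
proof -
  have "Poly_Mapping.lookup (chain_cone w c) (insert w \<sigma>) =
      (\<Sum>\<tau>\<in>Poly_Mapping.keys c. (-1) ^ card {u \<in> \<tau>. u < w} * Poly_Mapping.lookup c \<tau> when insert w \<tau> = insert w \<sigma>)"
    by (simp add: chain_cone_def lookup_sum cone_simplex_def lookup_single)
  also have "\<dots> = (\<Sum>\<tau>\<in>Poly_Mapping.keys c. (if \<tau> = \<sigma> then (-1) ^ card {u \<in> \<sigma>. u < w} * Poly_Mapping.lookup c \<sigma> else 0))"
    using assms by (intro sum.cong refl) (auto simp: when_def avoids_def insert_ident)
  also have "\<dots> = (-1) ^ card {u \<in> \<sigma>. u < w} * Poly_Mapping.lookup c \<sigma>"
    by (simp add: in_keys_iff)
  finally show ?thesis .
qed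

text \<open>All simplices of a cone contain \<open>w\<close> and those of the remainder do not, so
  the coefficients at \<open>insert w \<sigma>\<close> recover \<open>d\<close>. This allows the two
  parts of a boundary to be compared separately.\<close>

lemma chain_cone_plus_unique:
  assumes "avoids w d" "avoids w e" "avoids w d'" "avoids w e'" "chain_cone w d + e = chain_cone w d' + e'"
  shows "d = d'" "e = e'"
proof -
  have "d - d' = 0"
  proof (rule poly_mapping_eqI)
    fix \<sigma>
    have av: "avoids w (d - d')"
      using assms by (simp add: avoids_diff)
    show "Poly_Mapping.lookup (d - d') \<sigma> = Poly_Mapping.lookup 0 \<sigma>"
    proof (cases "w \<in> \<sigma>")
      case True
      then show ?thesis
        using av by (simp add: lookup_avoids)
    next
      case False
      have "chain_cone w (d - d') = e' - e"
        using assms(5) by (simp add: chain_cone_diff algebra_simps)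
      moreover have "Poly_Mapping.lookup (e' - e) (insert w \<sigma>) = 0"
        by (rule lookup_avoids[OF avoids_diff[OF assms(4,2)]]) simp
      ultimately show ?thesis
        using lookup_chain_cone[OF av False] by simp
    qed
  qed
  then show "d = d'"
    by simp
  then show "e = e'"
    using assms by simp
qed

lemma chain_cone_decomposition:
  fixes c :: "'v::linorder set \<Rightarrow>\<^sub>0 'f::field"
  assumes "\<And>\<sigma>. \<sigma> \<in> Poly_Mapping.keys c \<Longrightarrow> finite \<sigma>"
  obtains d e where "c = chain_cone w d + e" "avoids w d" "avoids w e"
    "Poly_Mapping.keys d \<subseteq> (\<lambda>\<sigma>. \<sigma> - {w}) ` {\<sigma> \<in> Poly_Mapping.keys c. w \<in> \<sigma>}"
    "Poly_Mapping.keys e \<subseteq> {\<sigma> \<in> Poly_Mapping.keys c. w \<notin> \<sigma>}"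
proof -
  let ?A = "{\<sigma> \<in> Poly_Mapping.keys c. w \<in> \<sigma>}" and ?B = "{\<sigma> \<in> Poly_Mapping.keys c. w \<notin> \<sigma>}"
  \<comment> \<open>\<open>d\<close> carries the sign of the cone, which the sign applied by
    \<open>chain_cone\<close> then cancels.\<close>
  define d where "d = (\<Sum>\<sigma>\<in>?A. Poly_Mapping.single (\<sigma> - {w}) ((-1) ^ card {u \<in> \<sigma> - {w}. u < w} * Poly_Mapping.lookup c \<sigma>))"
  define e where "e = (\<Sum>\<sigma>\<in>?B. Poly_Mapping.single \<sigma> (Poly_Mapping.lookup c \<sigma>))"
  have "chain_cone w d = (\<Sum>\<sigma>\<in>?A. Poly_Mapping.single \<sigma> (Poly_Mapping.lookup c \<sigma>))"
    unfolding d_def chain_cone_sum chain_cone_single cone_simplex_def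
    by (intro sum.cong refl) (auto simp: insert_absorb mult.assoc[symmetric] power_add[symmetric] simp flip: mult_2)
  moreover have "c = (\<Sum>\<sigma>\<in>?A \<union> ?B. Poly_Mapping.single \<sigma> (Poly_Mapping.lookup c \<sigma>))"
    by (subst poly_mapping_eq_sum_single[of c], rule sum.cong) auto
  moreover have "\<dots> = (\<Sum>\<sigma>\<in>?A. Poly_Mapping.single \<sigma> (Poly_Mapping.lookup c \<sigma>)) + e"
    unfolding e_def by (rule sum.union_disjoint) auto
  ultimately have "c = chain_cone w d + e"
    by simp
  moreover have d: "Poly_Mapping.keys d \<subseteq> (\<lambda>\<sigma>. \<sigma> - {w}) ` ?A"
    unfolding d_def by (intro order.trans[OF keys_sum_subset]) (auto split: if_splits)
  moreover have e: "Poly_Mapping.keys e \<subseteq> ?B"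
    unfolding e_def by (intro order.trans[OF keys_sum_subset]) (auto split: if_splits)
  moreover have "avoids w d" "avoids w e"
    using d e assms by (auto simp: avoids_def)
  ultimately show ?thesis
    using that by blast
qed

section \<open>Homology of clique complexes and links\<close>

text \<open>Unlike \<open>clique_complex\<close>, this admits the empty set, which is the only
  clique with 0 vertices. So \<open>no_homology\<close> in degree 0 says that \<open>V\<close> is
  nonempty.\<close>

definition cliques :: "('v \<Rightarrow> 'v \<Rightarrow> bool) \<Rightarrow> 'v set \<Rightarrow> nat \<Rightarrow> 'v set set" where
  "cliques adj V n = {\<sigma>. finite \<sigma> \<and> card \<sigma> = n \<and> \<sigma> \<subseteq> V \<and> (\<forall>u\<in>\<sigma>. \<forall>v\<in>\<sigma>. u \<noteq> v \<longrightarrow> adj u v)}"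

definition chains :: "('v \<Rightarrow> 'v \<Rightarrow> bool) \<Rightarrow> 'v set \<Rightarrow> nat \<Rightarrow> ('v set \<Rightarrow>\<^sub>0 'f::field) set" where
  "chains adj V n = {c. Poly_Mapping.keys c \<subseteq> cliques adj V n}"

definition no_homology ::
    "'f::field itself \<Rightarrow> ('v::linorder \<Rightarrow> 'v \<Rightarrow> bool) \<Rightarrow> 'v set \<Rightarrow> nat \<Rightarrow> bool" where
  "no_homology F adj V n \<longleftrightarrow>
     (\<forall>c\<in>chains adj V n :: ('v set \<Rightarrow>\<^sub>0 'f) set. aug_boundary c = 0 \<longrightarrow>
        (\<exists>b\<in>chains adj V (Suc n). aug_boundary b = c))"

definition nbhd :: "('v \<Rightarrow> 'v \<Rightarrow> bool) \<Rightarrow> 'v set \<Rightarrow> 'v \<Rightarrow> 'v set" where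
  "nbhd adj V w = {u \<in> V. u \<noteq> w \<and> adj w u}"

lemma chains_mono: "V \<subseteq> W \<Longrightarrow> chains adj V n \<subseteq> chains adj W n"
  by (auto simp: chains_def cliques_def)

lemma chains_0 [simp]: "0 \<in> chains adj V n"
  by (simp add: chains_def)

lemma chains_add: "c \<in> chains adj V n \<Longrightarrow> d \<in> chains adj V n \<Longrightarrow> c + d \<in> chains adj V n"
  by (simp add: chains_def keys_add_subset)

lemma chains_diff: "c \<in> chains adj V n \<Longrightarrow> d \<in> chains adj V n \<Longrightarrow> c - d \<in> chains adj V n"
  by (simp add: chains_def keys_diff_subset)

lemma chains_uminus: "c \<in> chains adj V n \<Longrightarrow> - c \<in> chains adj V n"
  using chains_diff[of 0 adj V n c] by simp

lemma chains_avoids: "c \<in> chains adj V n \<Longrightarrow> w \<notin> V \<Longrightarrow> avoids w c"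
  by (auto simp: chains_def cliques_def avoids_def)

lemma chains_finite: "c \<in> chains adj V n \<Longrightarrow> \<sigma> \<in> Poly_Mapping.keys c \<Longrightarrow> finite \<sigma>"
  by (auto simp: chains_def cliques_def)

lemma chain_cone_chains:
  assumes "symp adj" "w \<in> V" "d \<in> chains adj (nbhd adj V w) n"
  shows "chain_cone w d \<in> chains adj V (Suc n)"
proof -
  have "insert w ` Poly_Mapping.keys d \<subseteq> cliques adj V (Suc n)"
  proof
    fix \<tau> assume "\<tau> \<in> insert w ` Poly_Mapping.keys d"
    then obtain \<sigma> where \<sigma>: "\<sigma> \<in> Poly_Mapping.keys d" "\<tau> = insert w \<sigma>"
      by auto
    then have s: "\<sigma> \<in> cliques adj (nbhd adj V w) n"
      using assms(3) by (auto simp: chains_def)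
    then have "w \<notin> \<sigma>"
      by (auto simp: cliques_def nbhd_def)
    with s \<sigma> assms(1,2) show "\<tau> \<in> cliques adj V (Suc n)"
      by (auto simp: cliques_def nbhd_def dest: sympD)
  qed
  then show ?thesis
    using keys_chain_cone[of w d] by (auto simp: chains_def)
qed

lemma chains_decomposition:
  assumes "c \<in> chains adj V (Suc n)"
  obtains d e where "c = chain_cone w d + e" "d \<in> chains adj (nbhd adj V w) n" "e \<in> chains adj (V - {w}) (Suc n)"
proof -
  have fin: "\<And>\<sigma>. \<sigma> \<in> Poly_Mapping.keys c \<Longrightarrow> finite \<sigma>"
    using assms by (rule chains_finite)
  obtain d e where de: "c = chain_cone w d + e" "avoids w d" "avoids w e"
    "Poly_Mapping.keys d \<subseteq> (\<lambda>\<sigma>. \<sigma> - {w}) ` {\<sigma> \<in> Poly_Mapping.keys c. w \<in> \<sigma>}"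
    "Poly_Mapping.keys e \<subseteq> {\<sigma> \<in> Poly_Mapping.keys c. w \<notin> \<sigma>}"
    by (rule chain_cone_decomposition[OF fin, where w = w])
  have "(\<lambda>\<sigma>. \<sigma> - {w}) ` {\<sigma> \<in> Poly_Mapping.keys c. w \<in> \<sigma>} \<subseteq> cliques adj (nbhd adj V w) n"
    using assms by (auto simp: chains_def cliques_def nbhd_def subset_iff)
  moreover have "{\<sigma> \<in> Poly_Mapping.keys c. w \<notin> \<sigma>} \<subseteq> cliques adj (V - {w}) (Suc n)"
    using assms by (auto simp: chains_def cliques_def)
  ultimately have "d \<in> chains adj (nbhd adj V w) n" "e \<in> chains adj (V - {w}) (Suc n)"
    using de by (auto simp: chains_def)
  then show ?thesis
    using that de(1) by blast
qed

lemma nbhd_avoids: "d \<in> chains adj (nbhd adj V w) n \<Longrightarrow> avoids w d"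
  by (rule chains_avoids) (auto simp: nbhd_def)

lemma nbhd_subset: "nbhd adj V w \<subseteq> V - {w}"
  by (auto simp: nbhd_def)

text \<open>The cone formula splits the boundary of \<open>chain_cone w d + e\<close> into the cone
  over \<open>- aug_boundary d\<close> and the part \<open>d + aug_boundary e\<close> off
  \<open>w\<close>. On a cycle, \<open>d\<close> represents the connecting map of the Mayer-Vietoris
  sequence of the star and the complement of \<open>w\<close>, which meet in the link.\<close>

lemma aug_boundary_decomposition:
  assumes "d \<in> chains adj (nbhd adj V w) n" "e \<in> chains adj (V - {w}) (Suc n)"
    "avoids w d'" "avoids w e'"
    "aug_boundary (chain_cone w d + e) = chain_cone w d' + e'"
  shows "aug_boundary d = - d'" "d + aug_boundary e = e'"
proof -
  have d: "avoids w d" and e: "avoids w e"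
    using assms nbhd_avoids chains_avoids[of e adj "V - {w}" "Suc n" w] by auto
  have "chain_cone w (- aug_boundary d) + (d + aug_boundary e) = chain_cone w d' + e'"
    using assms(5) d by (simp add: aug_boundary_add aug_boundary_chain_cone chain_cone_uminus algebra_simps)
  moreover have "avoids w (- aug_boundary d)"
    using avoids_diff[of w 0 "aug_boundary d"] avoids_aug_boundary[OF d] by (simp add: avoids_def)
  ultimately have "- aug_boundary d = d'" and 2: "d + aug_boundary e = e'"
    using chain_cone_plus_unique[of w "- aug_boundary d" "d + aug_boundary e" d' e']
      assms(3,4) avoids_add[OF d avoids_aug_boundary[OF e]] by auto
  then show "aug_boundary d = - d'"
    by (metis minus_minus)
  show "d + aug_boundary e = e'"
    by (rule 2)
qed

text \<open>The part of the cycle at \<open>w\<close> is the cone over a cycle \<open>d\<close> of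
  the link. If \<open>f\<close> fills \<open>d\<close> in the link, adding the boundary of the cone
  over \<open>f\<close> moves \<open>c\<close> off \<open>w\<close>.\<close>

lemma no_homology_link_surj:
  fixes c :: "'v::linorder set \<Rightarrow>\<^sub>0 'f::field"
  assumes "symp adj" "w \<in> V" "no_homology TYPE('f) adj (nbhd adj V w) n"
    "c \<in> chains adj V (Suc n)" "aug_boundary c = 0"
  obtains b c' where "b \<in> chains adj V (Suc (Suc n))" "c' \<in> chains adj (V - {w}) (Suc n)"
    "c = c' + aug_boundary b"
proof -
  obtain d e where de: "c = chain_cone w d + e" "d \<in> chains adj (nbhd adj V w) n" "e \<in> chains adj (V - {w}) (Suc n)"
    using chains_decomposition[OF assms(4)] by metis
  have "aug_boundary d = 0"
    using aug_boundary_decomposition(1)[OF de(2,3), of 0 0] assms(5) de(1) by (simp add: avoids_def)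
  then obtain f where f: "f \<in> chains adj (nbhd adj V w) (Suc n)" "aug_boundary f = d"
    using assms(3) de(2) by (auto simp: no_homology_def)
  have "chain_cone w (- f) \<in> chains adj V (Suc (Suc n))"
    using assms f by (intro chain_cone_chains) (auto intro: chains_uminus)
  moreover have "e + f \<in> chains adj (V - {w}) (Suc n)"
    using de(3) by (intro chains_add subsetD[OF chains_mono[OF nbhd_subset] f(1)])
  moreover have "aug_boundary (chain_cone w (- f)) = - f + chain_cone w d"
    using f nbhd_avoids[OF f(1)] by (simp add: chain_cone_uminus aug_boundary_uminus aug_boundary_chain_cone)
  ultimately show ?thesis
    by (intro that) (auto simp: de(1))
qed

text \<open>If \<open>b\<close> fills \<open>c\<close> and \<open>c\<close> lies off
  \<open>w\<close>, the part of \<open>b\<close> at \<open>w\<close> is the cone over a cycle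
  \<open>d\<close> of the link. A chain \<open>f\<close> that fills \<open>d\<close> in the link can
  take the place of this cone.\<close>

lemma no_homology_link_inj:
  fixes c :: "'v::linorder set \<Rightarrow>\<^sub>0 'f::field"
  assumes "no_homology TYPE('f) adj (nbhd adj V w) n"
    "c \<in> chains adj (V - {w}) n" "b \<in> chains adj V (Suc n)" "c = aug_boundary b"
  obtains b' where "b' \<in> chains adj (V - {w}) (Suc n)" "c = aug_boundary b'"
proof -
  obtain d e where de: "b = chain_cone w d + e" "d \<in> chains adj (nbhd adj V w) n" "e \<in> chains adj (V - {w}) (Suc n)"
    using chains_decomposition[OF assms(3)] by metis
  have "avoids w c"
    using chains_avoids[OF assms(2)] by simp
  moreover have "avoids w (0 :: 'v set \<Rightarrow>\<^sub>0 'f)"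
    by (simp add: avoids_def)
  moreover have "aug_boundary (chain_cone w d + e) = chain_cone w 0 + c"
    unfolding assms(4) de(1) by simp
  ultimately have d: "aug_boundary d = 0" "d + aug_boundary e = c"
    using aug_boundary_decomposition[OF de(2,3), of 0 c] by (metis minus_zero)+
  then obtain f where f: "f \<in> chains adj (nbhd adj V w) (Suc n)" "aug_boundary f = d"
    using assms(1) de(2) by (auto simp: no_homology_def)
  have "f + e \<in> chains adj (V - {w}) (Suc n)"
    using de(3) by (intro chains_add subsetD[OF chains_mono[OF nbhd_subset] f(1)])
  then show ?thesis
    using d(2) f(2) by (intro that[of "f + e"]) (auto simp: aug_boundary_add)
qed

text \<open>In \<open>c = chain_cone w d + e\<close> the cycle condition forces
  \<open>d = - aug_boundary e\<close>, and \<open>e\<close> already lies in the link of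
  \<open>w\<close>, so the cone over \<open>e\<close> fills \<open>c\<close>. Degree 0 is separate,
  as there is no vertex to split off.\<close>

lemma no_homology_cone:
  assumes "symp adj" "w \<in> V" "nbhd adj V w = V - {w}"
  shows "no_homology TYPE('f::field) adj V n"
proof (cases n)
  case 0
  show ?thesis
    unfolding no_homology_def
  proof (intro ballI impI)
    fix c :: "'a set \<Rightarrow>\<^sub>0 'f"
    assume c: "c \<in> chains adj V n" "aug_boundary c = 0"
    then have "Poly_Mapping.keys c \<subseteq> {{}}"
      by (auto simp: chains_def cliques_def 0 subset_iff)
    moreover have "{{}} \<subseteq> cliques adj (nbhd adj V w) n"
      by (simp add: cliques_def 0)
    ultimately have nb: "c \<in> chains adj (nbhd adj V w) n"
      unfolding chains_def by blast
    have "chain_cone w c \<in> chains adj V (Suc n)"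
      by (rule chain_cone_chains[OF assms(1,2) nb])
    moreover have "aug_boundary (chain_cone w c) = c"
      using aug_boundary_chain_cone[OF nbhd_avoids[OF nb]] c(2) by simp
    ultimately show "\<exists>b\<in>chains adj V (Suc n). aug_boundary b = c"
      by blast
  qed
next
  case (Suc k)
  show ?thesis
    unfolding no_homology_def
  proof (intro ballI impI)
    fix c :: "'a set \<Rightarrow>\<^sub>0 'f"
    assume c: "c \<in> chains adj V n" "aug_boundary c = 0"
    then obtain d e where de: "c = chain_cone w d + e" "d \<in> chains adj (nbhd adj V w) k" "e \<in> chains adj (V - {w}) (Suc k)"
      using chains_decomposition[of c adj V k] Suc by metis
    have d: "d + aug_boundary e = 0"
      using aug_boundary_decomposition(2)[OF de(2,3), of 0 0] c de(1) by (simp add: avoids_def)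
    have e: "e \<in> chains adj (nbhd adj V w) n"
      using de(3) assms(3) Suc by simp
    have "aug_boundary (chain_cone w e) = e - chain_cone w (aug_boundary e)"
      using nbhd_avoids[OF e] by (rule aug_boundary_chain_cone)
    also have "aug_boundary e = - d"
      using d by (metis add.commute minus_unique)
    finally have "aug_boundary (chain_cone w e) = c"
      by (simp add: de(1) chain_cone_uminus)
    moreover have "chain_cone w e \<in> chains adj V (Suc n)"
      using assms e by (intro chain_cone_chains)
    ultimately show "\<exists>b\<in>chains adj V (Suc n). aug_boundary b = c"
      by blast
  qed
qed

text \<open>In a minimal vertex set carrying homology, every link carries homology one degree lower
  (otherwise the vertex could be deleted), and no vertex is a cone point.\<close>

lemma homology_core:
  assumes "symp adj" "finite V" "\<not> no_homology TYPE('f::field) adj V n"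
  obtains W where "W \<subseteq> V" "2 * n \<le> card W" "\<And>w. w \<in> W \<Longrightarrow> 2 * (n - 1) \<le> card (nbhd adj W w)"
  using assms(2,3)
proof (induction n arbitrary: V thesis)
  case 0
  then show ?case
    by (metis card.empty empty_iff empty_subsetI le0 mult_0_right)
next
  case (Suc n)
  let ?P = "\<lambda>W. W \<subseteq> V \<and> \<not> no_homology TYPE('f) adj W (Suc n)"
  obtain W where W: "?P W" and min: "\<And>U. ?P U \<Longrightarrow> card W \<le> card U"
    using ex_has_least_nat[of ?P V card] Suc.prems by auto
  have fin: "finite W"
    using W Suc.prems finite_subset by blast
  have link: "\<not> no_homology TYPE('f) adj (nbhd adj W w) n" if w: "w \<in> W" for w
  proof
    assume acyclic: "no_homology TYPE('f) adj (nbhd adj W w) n"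
    have "no_homology TYPE('f) adj W (Suc n)"
      unfolding no_homology_def
    proof (intro ballI impI)
      fix c :: "'a set \<Rightarrow>\<^sub>0 'f"
      assume c: "c \<in> chains adj W (Suc n)" "aug_boundary c = 0"
      obtain b c' where b: "b \<in> chains adj W (Suc (Suc n))" "c' \<in> chains adj (W - {w}) (Suc n)"
          "c = c' + aug_boundary b"
        using no_homology_link_surj[OF assms(1) w acyclic c] by metis
      have "aug_boundary (aug_boundary b) = 0"
        using boundary_boundary[of b "Suc n"] chains_finite[OF b(1)]
        by (simp add: boundary_eq_aug_boundary)
      then have "aug_boundary c' = 0"
        using c b(3) by (simp add: aug_boundary_add)
      moreover have "no_homology TYPE('f) adj (W - {w}) (Suc n)"
      proof (rule ccontr)
        assume "\<not> ?thesis"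
        then have "card W \<le> card (W - {w})"
          using min[of "W - {w}"] W by auto
        moreover have "card (W - {w}) < card W"
          using w fin by (meson card_Diff1_less)
        ultimately show False
          by linarith
      qed
      ultimately obtain b' where b': "b' \<in> chains adj (W - {w}) (Suc (Suc n))" "aug_boundary b' = c'"
        using b(2) by (auto simp: no_homology_def)
      then have "b' + b \<in> chains adj W (Suc (Suc n))" "aug_boundary (b' + b) = c"
        using b subsetD[OF chains_mono[of "W - {w}" W adj "Suc (Suc n)"] b'(1)]
        by (auto simp: aug_boundary_add intro!: chains_add)
      then show "\<exists>b\<in>chains adj W (Suc (Suc n)). aug_boundary b = c"
        by blast
    qed
    then show False
      using W by simp
  qed
  have deg: "2 * n \<le> card (nbhd adj W w)" if w: "w \<in> W" for w
  proof -
    have f: "finite (nbhd adj W w)"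
      using fin by (simp add: nbhd_def)
    obtain U where "U \<subseteq> nbhd adj W w" "2 * n \<le> card U"
      using Suc.IH[OF _ f link[OF w]] by metis
    then show ?thesis
      using f card_mono order.trans by blast
  qed
  have "W \<noteq> {}"
  proof
    assume "W = {}"
    then have "cliques adj W (Suc n) = {}"
      by (auto simp: cliques_def)
    then have "chains adj W (Suc n) = ({0} :: ('a set \<Rightarrow>\<^sub>0 'f) set)"
      by (simp add: chains_def)
    then have "no_homology TYPE('f) adj W (Suc n)"
      unfolding no_homology_def by (metis aug_boundary_0 chains_0 singletonD)
    then show False
      using W by simp
  qed
  then obtain w where w: "w \<in> W"
    by auto
  have "nbhd adj W w \<noteq> W - {w}"
    using no_homology_cone[OF assms(1) w] W by auto
  then have "nbhd adj W w \<subset> W - {w}"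
    using nbhd_subset[of adj W w] by auto
  then have "card (nbhd adj W w) < card (W - {w})"
    using fin by (intro psubset_card_mono) auto
  \<comment> \<open>The neighbours of \<open>w\<close>, the vertex \<open>w\<close> itself and at
    least one vertex not adjacent to it.\<close>
  then have "2 * Suc n \<le> card W"
    using deg[OF w] fin w by (simp add: card_Diff_singleton)
  then show ?case
    using Suc.prems(1)[of W] W deg by auto
qed

section \<open>Betti numbers of increasing clique complexes\<close>

text \<open>The later arguments use this criterion in place of the quotient module: all classes have
  representatives on one finite set of simplices. Forwards, \<open>S\<close> collects the supports
  of representatives of a finite spanning set; backwards, the chains on \<open>S\<close> have finite
  dimension.\<close>

lemma betti_finite_iff:
  assumes K: "simplicial_complex K"
  shows "betti_number TYPE('f::field) K p < \<infinity> \<longleftrightarrow>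
    (\<exists>S. finite S \<and> (\<forall>c\<in>cycles K p :: ('v::linorder set \<Rightarrow>\<^sub>0 'f) set.
       \<exists>c'\<in>cycles K p. Poly_Mapping.keys c' \<subseteq> S \<and> c - c' \<in> boundaries K p))"
    (is "_ \<longleftrightarrow> (\<exists>S. finite S \<and> ?fin S)")
proof -
  define H where "H = (homology K p :: ('f, ('v set \<Rightarrow>\<^sub>0 'f) set) module)"
  define Z where "Z = (cycles K p :: ('v set \<Rightarrow>\<^sub>0 'f) set)"
  define W where "W = (boundaries K p :: ('v set \<Rightarrow>\<^sub>0 'f) set)"
  define scale where "scale = (\<lambda>a::'f. Poly_Mapping.map ((*) a) :: ('v set \<Rightarrow>\<^sub>0 'f) \<Rightarrow> _)"
  define coset where "coset x = (\<lambda>w. w + x) ` W" for x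
  interpret C: vectorspace class_ring "chain_module K p :: ('f, 'v set \<Rightarrow>\<^sub>0 'f) module"
    by (rule chain_module_vectorspace)
  interpret C1: vectorspace class_ring "chain_module K (p + 1) :: ('f, 'v set \<Rightarrow>\<^sub>0 'f) module"
    by (rule chain_module_vectorspace)
  interpret ZS: submodule class_ring Z "chain_module K p :: ('f, 'v set \<Rightarrow>\<^sub>0 'f) module"
    unfolding Z_def by (rule submodule_cycles)
  interpret H: vectorspace class_ring H
    unfolding H_def by (rule homology_vectorspace[OF K])
  \<comment> \<open>The chains are also viewed as a type-based vector space, for bases and the bound
    on independent sets.\<close>
  interpret vs: vector_space scale
    by unfold_locales (auto simp: scale_def intro!: poly_mapping_eqI simp: lookup_add algebra_simps)
  have Z0: "0 \<in> Z" and Z_add: "x + y \<in> Z" and Z_scale: "scale a x \<in> Z" if "x \<in> Z" "y \<in> Z" for x y a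
    using ZS.zero_closed ZS.m_closed[of x y] ZS.smult_closed[of a x] that
    by (simp_all add: chain_module_def scale_def)
  have W0: "0 \<in> W"
    unfolding W_def boundaries_def by (rule image_eqI[of _ _ 0]) (auto simp: chain_module_def)
  have W_add: "x + y \<in> W" if xy: "x \<in> W" "y \<in> W" for x y
  proof -
    obtain c d where "c \<in> carrier (chain_module K (p + 1))" "x = boundary (p + 1) c"
      "d \<in> carrier (chain_module K (p + 1))" "y = boundary (p + 1) d"
      using xy by (auto simp: W_def boundaries_def)
    then show ?thesis
      using C1.M.a_closed[of c d] unfolding W_def boundaries_def
      by (intro image_eqI[of _ _ "c + d"]) (auto simp: boundary_add, simp add: chain_module_def)
  qed
  have W_scale: "scale a x \<in> W" if x: "x \<in> W" for a x
  proof -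
    obtain c where "c \<in> carrier (chain_module K (p + 1))" "x = boundary (p + 1) c"
      using x by (auto simp: W_def boundaries_def)
    then show ?thesis
      using C1.smult_closed[of a c] unfolding W_def boundaries_def scale_def
      by (intro image_eqI[of _ _ "Poly_Mapping.map ((*) a) c"])
        (auto simp: boundary_scale, simp add: chain_module_def)
  qed
  have W_uminus: "- x \<in> W" if "x \<in> W" for x
    using W_scale[OF that, of "-1"] by (simp add: vs.scale_minus_left)
  have coset_eq: "coset x = coset y" if "x - y \<in> W" for x y
  proof -
    have *: "coset x \<subseteq> coset y" if xy: "x - y \<in> W" for x y
    proof
      fix u assume "u \<in> coset x"
      then obtain w where "w \<in> W" "u = w + x"
        by (auto simp: coset_def)
      then show "u \<in> coset y"
        using W_add[of w "x - y"] xy unfolding coset_def by (intro image_eqI[of _ _ "w + (x - y)"]) auto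
    qed
    have "y - x \<in> W"
      using W_uminus[OF that] by simp
    then show ?thesis
      using *[OF that] *[of y x] by blast
  qed
  have in_coset: "y - x \<in> W" if "y \<in> coset x" for x y
    using that by (auto simp: coset_def)
  have self_coset: "x \<in> coset x" for x
    using W0 unfolding coset_def by (intro image_eqI[of _ _ 0]) auto
  have rcos: "W +>\<^bsub>(chain_module K p)\<lparr>carrier := Z\<rparr>\<^esub> x = coset x" for x
    by (auto simp: a_r_coset_def' coset_def chain_module_def)
  have carrier: "carrier H = coset ` Z"
    unfolding H_def homology_def quotient_module_def Z_def[symmetric] W_def[symmetric]
    using rcos by (auto simp: A_RCOSETS_def' a_r_coset_def')
  have zero: "\<zero>\<^bsub>H\<^esub> = coset 0"
    by (simp add: H_def homology_def quotient_module_def W_def coset_def)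
  have add: "coset x \<oplus>\<^bsub>H\<^esub> coset y = coset (x + y)" for x y
  proof -
    have "coset x \<oplus>\<^bsub>H\<^esub> coset y = {u + v |u v. u \<in> coset x \<and> v \<in> coset y}"
      by (auto simp: H_def homology_def quotient_module_def set_add_def set_mult_def chain_module_def)
    also have "\<dots> = coset (x + y)"
    proof (intro equalityI subsetI)
      fix u assume "u \<in> {u + v |u v. u \<in> coset x \<and> v \<in> coset y}"
      then obtain w w' where "w \<in> W" "w' \<in> W" "u = (w + x) + (w' + y)"
        by (auto simp: coset_def)
      then show "u \<in> coset (x + y)"
        using W_add[of w w'] unfolding coset_def by (intro image_eqI[of _ _ "w + w'"]) (auto simp: algebra_simps)
    next
      fix u assume "u \<in> coset (x + y)"
      then obtain w where w: "w \<in> W" "u = w + (x + y)"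
        by (auto simp: coset_def)
      then have "u = (w + x) + y" "w + x \<in> coset x"
        by (auto simp: coset_def algebra_simps)
      then show "u \<in> {u + v |u v. u \<in> coset x \<and> v \<in> coset y}"
        using self_coset by blast
    qed
    finally show ?thesis .
  qed
  have smult: "a \<odot>\<^bsub>H\<^esub> coset x = coset (scale a x)" for a x
  proof -
    have "a \<odot>\<^bsub>H\<^esub> coset x = (\<Union>y\<in>coset x. W +>\<^bsub>(chain_module K p)\<lparr>carrier := Z\<rparr>\<^esub> (scale a y))"
      by (simp add: H_def homology_def quotient_module_def Z_def W_def) (simp add: chain_module_def scale_def)
    also have "\<dots> = (\<Union>y\<in>coset x. coset (scale a y))"
      by (simp only: rcos)
    also have "\<dots> = coset (scale a x)"
    proof (rule SUP_eq_const)
      show "coset x \<noteq> {}"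
        using self_coset by blast
      show "coset (scale a y) = coset (scale a x)" if "y \<in> coset x" for y
        using W_scale[OF in_coset[OF that], of a] by (intro coset_eq) (simp add: vs.scale_right_diff_distrib)
    qed
    finally show ?thesis .
  qed
  have "betti_number TYPE('f) K p < \<infinity> \<longleftrightarrow> H.fin_dim"
    by (simp add: betti_number_def H_def Let_def)
  also have "\<dots> \<longleftrightarrow> (\<exists>S. finite S \<and> ?fin S)"
  proof
    assume "H.fin_dim"
    then obtain A where A: "finite A" "A \<subseteq> carrier H" "H.span A = carrier H"
      unfolding H.fin_dim_def by blast
    have "\<forall>a\<in>A. \<exists>x\<in>Z. a = coset x"
      using A(2) carrier by auto
    then obtain r where r: "\<And>a. a \<in> A \<Longrightarrow> r a \<in> Z \<and> a = coset (r a)"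
      by metis
    define S where "S = (\<Union>a\<in>A. Poly_Mapping.keys (r a))"
    \<comment> \<open>\<open>N\<close> is a subspace that contains the spanning set
      \<open>A\<close>, hence all of \<open>H\<close>.\<close>
    define N where "N = coset ` {z \<in> Z. Poly_Mapping.keys z \<subseteq> S}"
    have "submodule class_ring N H"
    proof
      show "N \<subseteq> carrier H"
        by (auto simp: N_def carrier)
      show "\<zero>\<^bsub>H\<^esub> \<in> N"
        unfolding N_def zero using Z0[of 0 0] ZS.zero_closed by (intro imageI) (auto simp: chain_module_def)
      show "v \<oplus>\<^bsub>H\<^esub> w \<in> N" if vw: "v \<in> N" "w \<in> N" for v w
      proof -
        obtain x y where "v = coset x" "w = coset y" "x \<in> Z" "y \<in> Z"
            "Poly_Mapping.keys x \<subseteq> S" "Poly_Mapping.keys y \<subseteq> S"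
          using vw by (auto simp: N_def)
        then show ?thesis
          unfolding N_def by (intro image_eqI[of _ _ "x + y"]) (auto simp: add Z_add dest: subsetD[OF keys_add_subset])
      qed
      show "a \<odot>\<^bsub>H\<^esub> v \<in> N" if "a \<in> carrier class_ring" and v: "v \<in> N" for a v
      proof -
        obtain x where x: "v = coset x" "x \<in> Z" "Poly_Mapping.keys x \<subseteq> S"
          using v by (auto simp: N_def)
        moreover have "Poly_Mapping.keys (scale a x) \<subseteq> S"
          using keys_scale[of a x] x(3) unfolding scale_def by blast
        ultimately show ?thesis
          unfolding N_def using Z_scale[of x x] by (intro image_eqI[of _ _ "scale a x"]) (auto simp: smult)
      qed
    qed
    moreover have "A \<subseteq> N"
    proof
      fix a assume "a \<in> A"
      then show "a \<in> N"
        using r[of a] unfolding N_def S_def by (intro image_eqI[of _ _ "r a"]) auto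
    qed
    ultimately have N: "carrier H \<subseteq> N"
      using H.span_is_subset[of A N] A(3) by simp
    have "finite S"
      using A(1) by (simp add: S_def)
    moreover have "?fin S"
    proof
      fix c :: "'v set \<Rightarrow>\<^sub>0 'f" assume "c \<in> cycles K p"
      then have "coset c \<in> N"
        using N carrier by (auto simp: Z_def)
      then obtain z where "coset c = coset z" "z \<in> Z" "Poly_Mapping.keys z \<subseteq> S"
        by (auto simp: N_def)
      moreover from this have "c - z \<in> W"
        using self_coset[of c] in_coset by simp
      ultimately show "\<exists>c'\<in>cycles K p. Poly_Mapping.keys c' \<subseteq> S \<and> c - c' \<in> boundaries K p"
        by (auto simp: Z_def W_def)
    qed
    ultimately show "\<exists>S. finite S \<and> ?fin S"
      by blast
  next
    assume "\<exists>S. finite S \<and> ?fin S"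
    then obtain S where S: "finite S" "?fin S"
      by blast
    define ZS where "ZS = {z \<in> Z. Poly_Mapping.keys z \<subseteq> S}"
    \<comment> \<open>A basis of the cycles on \<open>S\<close>; it is finite because these cycles
      lie in the span of the single simplices in \<open>S\<close>.\<close>
    obtain B where B: "B \<subseteq> ZS" "vs.independent B" "ZS \<subseteq> vs.span B"
      using vs.maximal_independent_subset[of ZS] by metis
    have "z \<in> vs.span ((\<lambda>\<sigma>. Poly_Mapping.single \<sigma> 1) ` S)" if z: "z \<in> ZS" for z
    proof -
      have "z = (\<Sum>\<sigma>\<in>Poly_Mapping.keys z. scale (Poly_Mapping.lookup z \<sigma>) (Poly_Mapping.single \<sigma> 1))"
        by (subst poly_mapping_eq_sum_single[of z], intro sum.cong refl)
          (auto simp: scale_def intro!: poly_mapping_eqI simp: lookup_single when_def)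
      moreover have "\<dots> \<in> vs.span ((\<lambda>\<sigma>. Poly_Mapping.single \<sigma> 1) ` S)"
        using z by (intro vs.span_sum vs.span_scale vs.span_base) (auto simp: ZS_def)
      ultimately show ?thesis
        by simp
    qed
    then have "finite B"
      using vs.independent_span_bound[of "(\<lambda>\<sigma>. Poly_Mapping.single \<sigma> 1) ` S" B] S(1) B by blast
    define A where "A = coset ` B"
    have A: "finite A" "A \<subseteq> carrier H"
      using \<open>finite B\<close> B(1) by (auto simp: A_def carrier ZS_def)
    interpret SA: submodule class_ring "H.span A" H
      using A(2) by (rule H.span_is_submodule)
    have span: "coset z \<in> H.span A" if "z \<in> vs.span B" for z
      using that
    proof (induction rule: vs.span_induct_alt)
      case base
      show ?case
        using SA.zero_closed by (simp add: zero)
    next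
      case (step a x y)
      have "coset x \<in> H.span A"
        using H.in_own_span[OF A(2)] step by (auto simp: A_def)
      then have "a \<odot>\<^bsub>H\<^esub> coset x \<oplus>\<^bsub>H\<^esub> coset y \<in> H.span A"
        using step by (intro SA.m_closed SA.smult_closed) auto
      then show ?case
        by (simp add: smult add)
    qed
    have "carrier H \<subseteq> H.span A"
    proof
      fix h assume "h \<in> carrier H"
      then obtain c where c: "h = coset c" "c \<in> Z"
        by (auto simp: carrier)
      then obtain c' where "c' \<in> ZS" "c - c' \<in> W"
        using S(2) by (auto simp: Z_def W_def ZS_def)
      then show "h \<in> H.span A"
        using coset_eq[of c c'] span[of c'] B(3) c by auto
    qed
    then show "H.fin_dim"
      unfolding H.fin_dim_def using A SA.subset by blast
  qed
  finally show ?thesis .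
qed

section \<open>Clique complexes filtered by the initial segments of the nodes\<close>

lemma chain_module_clique_complex:
  "carrier (chain_module (clique_complex V G) p) = chains (adjacent G) V (Suc p)"
  by (auto simp: chain_module_def chains_def cliques_def clique_complex_def)

lemma cycles_clique_complex:
  "p \<noteq> 0 \<Longrightarrow> cycles (clique_complex V G) p = {c \<in> chains (adjacent G) V (Suc p). aug_boundary c = 0}"
  by (simp add: cycles_def chain_module_clique_complex boundary_eq_aug_boundary)

lemma boundaries_clique_complex:
  "boundaries (clique_complex V G) p = aug_boundary ` chains (adjacent G) V (Suc (Suc p))"
  by (simp add: boundaries_def chain_module_clique_complex boundary_eq_aug_boundary)

lemma symp_adjacent: "symp (adjacent G)"
  by (auto simp: symp_def adjacent_def)

lemma atMost_Suc_Diff: "{1..Suc N} - {Suc N} = {1..N}"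
  by auto

lemma chains_bounded:
  fixes c :: "nat set \<Rightarrow>\<^sub>0 'f::field"
  assumes "c \<in> chains adj {1..} n"
  obtains N where "c \<in> chains adj {1..N} n" "N \<ge> M"
proof -
  let ?U = "\<Union>(Poly_Mapping.keys c)"
  have "finite ?U"
    using chains_finite[OF assms] by auto
  then obtain N where "\<And>u. u \<in> ?U \<Longrightarrow> u \<le> N"
    using finite_nat_set_iff_bounded_le by metis
  then have "c \<in> chains adj {1..max M N} n"
    using assms by (fastforce simp: chains_def cliques_def)
  then show ?thesis
    by (intro that) auto
qed

text \<open>As long as the newest node exceeds \<open>T0\<close>,
  \<open>no_homology_link_surj\<close> moves the cycle off it; the boundaries used on the way add up
  to \<open>aug_boundary b\<close>.\<close>

lemma cycle_in_initial_segment: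
  fixes c :: "nat set \<Rightarrow>\<^sub>0 'f::field"
  assumes "symp adj" and "\<And>T. T > T0 \<Longrightarrow> no_homology TYPE('f) adj (nbhd adj {1..T} T) n"
    and "c \<in> chains adj {1..N} (Suc n)" "aug_boundary c = 0" "N \<ge> T0"
  shows "\<exists>c'\<in>chains adj {1..T0} (Suc n). aug_boundary c' = 0 \<and>
    (\<exists>b\<in>chains adj {1..} (Suc (Suc n)). c = c' + aug_boundary b)"
  using assms(5,3,4)
proof (induction N arbitrary: c rule: dec_induct)
  case base
  then show ?case
    by (intro bexI[of _ c]) (auto intro!: bexI[of _ 0])
next
  case (step N)
  have "no_homology TYPE('f) adj (nbhd adj {1..Suc N} (Suc N)) n"
    using step.hyps by (intro assms(2)) simp
  then obtain b c1 where b: "b \<in> chains adj {1..Suc N} (Suc (Suc n))" "c1 \<in> chains adj ({1..Suc N} - {Suc N}) (Suc n)"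
      "c = c1 + aug_boundary b"
    using no_homology_link_surj[OF assms(1) _ _ step.prems(1,2), of "Suc N"] by auto
  have "aug_boundary (aug_boundary b) = 0"
    using boundary_boundary[of b "Suc n"] chains_finite[OF b(1)]
    by (simp add: boundary_eq_aug_boundary)
  then have "aug_boundary c1 = 0"
    using step.prems b(3) by (simp add: aug_boundary_add)
  then obtain c' b' where c': "c' \<in> chains adj {1..T0} (Suc n)" "aug_boundary c' = 0"
      "b' \<in> chains adj {1..} (Suc (Suc n))" "c1 = c' + aug_boundary b'"
    using step.IH[of c1] b(2) unfolding atMost_Suc_Diff by blast
  have "b \<in> chains adj {1..} (Suc (Suc n))"
    using b(1) by (rule subsetD[OF chains_mono, rotated]) auto
  then have "b' + b \<in> chains adj {1..} (Suc (Suc n))" "c = c' + aug_boundary (b' + b)"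
    using b(3) c' by (auto simp: aug_boundary_add intro: chains_add)
  with c' show ?case
    by blast
qed

text \<open>The same descent with \<open>no_homology_link_inj\<close>: a class that lives on
  \<open>{1..T0}\<close> cannot die through a later node.\<close>

lemma boundary_in_initial_segment:
  fixes c :: "nat set \<Rightarrow>\<^sub>0 'f::field"
  assumes "\<And>T. T > T0 \<Longrightarrow> no_homology TYPE('f) adj (nbhd adj {1..T} T) n"
    and "c \<in> chains adj {1..T0} n" "b \<in> chains adj {1..N} (Suc n)" "c = aug_boundary b" "N \<ge> T0"
  shows "\<exists>b'\<in>chains adj {1..T0} (Suc n). c = aug_boundary b'"
  using assms(5,3,4)
proof (induction N arbitrary: b rule: dec_induct)
  case base
  then show ?case
    by blast
next
  case (step N)
  have nh: "no_homology TYPE('f) adj (nbhd adj {1..Suc N} (Suc N)) n"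
    using step.hyps by (intro assms(1)) simp
  have c: "c \<in> chains adj ({1..Suc N} - {Suc N}) n"
    unfolding atMost_Suc_Diff using assms(2) by (rule subsetD[OF chains_mono, rotated]) (use step.hyps in auto)
  obtain b' where "b' \<in> chains adj ({1..Suc N} - {Suc N}) (Suc n)" "c = aug_boundary b'"
    by (rule no_homology_link_inj[OF nh c step.prems])
  then show ?case
    using step.IH unfolding atMost_Suc_Diff by blast
qed

text \<open>A cycle involves finitely many nodes, so it is homologous to one on
  \<open>{1..T0}\<close>, which carries only finitely many simplices. The links are tested in degree
  \<open>p\<close>, that is in dimension \<open>p - 1\<close>.\<close>

lemma betti_finiteI:
  assumes "p \<noteq> 0" "\<And>T. T > T0 \<Longrightarrow> no_homology TYPE('f::field) (adjacent G) (nbhd (adjacent G) {1..T} T) p"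
  shows "betti_number TYPE('f) (clique_complex {1..} G) p < \<infinity>"
  unfolding betti_finite_iff[OF simplicial_complex_clique_complex]
proof (intro exI[of _ "Pow {1..T0}"] conjI ballI)
  fix c :: "nat set \<Rightarrow>\<^sub>0 'f"
  assume "c \<in> cycles (clique_complex {1..} G) p"
  then have c: "c \<in> chains (adjacent G) {1..} (Suc p)" "aug_boundary c = 0"
    by (auto simp: cycles_clique_complex[OF assms(1)])
  obtain N where N: "c \<in> chains (adjacent G) {1..N} (Suc p)" "N \<ge> T0"
    by (rule chains_bounded[OF c(1)])
  obtain c' b where c': "c' \<in> chains (adjacent G) {1..T0} (Suc p)" "aug_boundary c' = 0"
      "b \<in> chains (adjacent G) {1..} (Suc (Suc p))" "c = c' + aug_boundary b"
    using cycle_in_initial_segment[OF symp_adjacent assms(2) N(1) c(2) N(2)] by auto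
  have "c' \<in> chains (adjacent G) {1..} (Suc p)"
    using c'(1) by (rule subsetD[OF chains_mono, rotated]) auto
  moreover have "Poly_Mapping.keys c' \<subseteq> Pow {1..T0}"
    using c'(1) by (auto simp: chains_def cliques_def)
  ultimately show "\<exists>c'\<in>cycles (clique_complex {1..} G) p. Poly_Mapping.keys c' \<subseteq> Pow {1..T0} \<and>
      c - c' \<in> boundaries (clique_complex {1..} G) p"
    using c' by (intro bexI[of _ c']) (auto simp: cycles_clique_complex[OF assms(1)] boundaries_clique_complex)
qed simp

section \<open>Spheres, and how they create infinitely many classes\<close>

text \<open>The cycle \<open>z\<close> will be an iterated suspension of the empty sphere, that is the boundary of a
  cross-polytope with vertex set \<open>V\<close>. The last condition makes \<open>\<sigma>\<close> a maximal clique in \<open>V\<close>,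
  which certifies that \<open>z\<close> is not a boundary.\<close>

definition sphere ::
    "(nat \<Rightarrow> nat \<Rightarrow> bool) \<Rightarrow> nat \<Rightarrow> nat set \<Rightarrow> (nat set \<Rightarrow>\<^sub>0 'f::field) \<Rightarrow> nat set \<Rightarrow> bool" where
  "sphere adj k V z \<sigma> \<longleftrightarrow> finite V \<and> V \<subseteq> {1..} \<and> card V = 2 * k \<and> z \<in> chains adj V k \<and>
     aug_boundary z = 0 \<and> \<sigma> \<in> Poly_Mapping.keys z \<and> (\<forall>u\<in>V. \<exists>v\<in>\<sigma>. u = v \<or> \<not> adj u v)"

text \<open>The difference of the cones from two poles over a cycle is a cycle. As
  \<open>insert a \<sigma>\<close> lacks \<open>b\<close>, the second cone cannot cancel its
  coefficient; it is maximal because \<open>b\<close> is not adjacent to \<open>a\<close>.\<close>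

lemma sphere_suspension:
  assumes "symp adj" "sphere adj k V z \<sigma>" "{a, b} \<subseteq> {1..} - V" "a \<noteq> b" "\<not> adj a b"
    and adj: "\<And>v. v \<in> V \<Longrightarrow> adj a v \<and> adj b v"
  shows "sphere adj (Suc k) (insert a (insert b V)) (chain_cone a z - chain_cone b z) (insert a \<sigma>)"
proof -
  let ?V = "insert a (insert b V)"
  have z: "z \<in> chains adj V k" "aug_boundary z = 0" "\<sigma> \<in> Poly_Mapping.keys z"
    using assms(2) by (auto simp: sphere_def)
  have \<sigma>: "\<sigma> \<subseteq> V"
    using z by (auto simp: chains_def cliques_def)
  have av: "avoids a z" "avoids b z"
    using chains_avoids[OF z(1)] assms(3) by auto
  have "z \<in> chains adj (nbhd adj ?V u) k" if "u = a \<or> u = b" for u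
    using z(1) by (rule subsetD[OF chains_mono, rotated]) (use that adj assms(3) in \<open>auto simp: nbhd_def\<close>)
  then have 1: "chain_cone a z - chain_cone b z \<in> chains adj ?V (Suc k)"
    using assms(1) by (intro chains_diff chain_cone_chains) auto
  have 2: "aug_boundary (chain_cone a z - chain_cone b z) = 0"
    using av z(2) by (simp add: aug_boundary_diff aug_boundary_chain_cone)
  have "insert a \<sigma> \<notin> Poly_Mapping.keys (chain_cone b z)"
  proof
    assume "insert a \<sigma> \<in> Poly_Mapping.keys (chain_cone b z)"
    then have "b \<in> insert a \<sigma>"
      using keys_chain_cone[of b z] by auto
    then show False
      using \<sigma> assms(3,4) by auto
  qed
  moreover have "a \<notin> \<sigma>"
    using \<sigma> assms(3) by auto
  then have "Poly_Mapping.lookup (chain_cone a z) (insert a \<sigma>) \<noteq> 0"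
    using lookup_chain_cone[OF av(1)] z(3) by (simp add: in_keys_iff)
  ultimately have 3: "insert a \<sigma> \<in> Poly_Mapping.keys (chain_cone a z - chain_cone b z)"
    by (simp add: in_keys_iff lookup_minus)
  have "\<not> adj b a"
    using assms(1,5) by (meson sympD)
  then have 4: "\<forall>u\<in>?V. \<exists>v\<in>insert a \<sigma>. u = v \<or> \<not> adj u v"
    using assms(2) by (auto simp: sphere_def)
  have "card ?V = 2 * Suc k"
    using assms(2,3,4) by (simp add: sphere_def)
  with 1 2 3 4 show ?thesis
    using assms(2,3) by (simp add: sphere_def)
qed

text \<open>Among \<open>m + 2\<close> pairwise adjacent nodes the newest would have
  \<open>m + 1\<close> older neighbours.\<close>

lemma infinite_set_nonadjacent:
  assumes "infinite I" and deg: "\<And>T::nat. card {u \<in> I. u < T \<and> adj T u} \<le> m"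
  obtains a b where "a \<in> I" "b \<in> I" "a \<noteq> b" "\<not> adj a b"
proof (rule ccontr)
  assume "\<not> thesis"
  then have adj: "adj a b" if "a \<in> I" "b \<in> I" "a \<noteq> b" for a b
    using that \<open>\<And>b a. \<lbrakk>a \<in> I; b \<in> I; a \<noteq> b; \<not> adj a b\<rbrakk> \<Longrightarrow> thesis\<close> by blast
  obtain J where J: "J \<subseteq> I" "finite J" "card J = m + 2"
    using infinite_arbitrarily_large[OF assms(1)] by metis
  then have "J \<noteq> {}"
    by auto
  then have Max: "Max J \<in> J"
    using J by simp
  have "J - {Max J} \<subseteq> {u \<in> I. u < Max J \<and> adj (Max J) u}"
    using J Max adj by (auto simp: less_le)
  then have "card (J - {Max J}) \<le> m"
    using card_mono[of "{u \<in> I. u < Max J \<and> adj (Max J) u}" "J - {Max J}"] deg[of "Max J"] by simp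
  then show False
    using J Max by simp
qed

lemma spheres_exist:
  assumes "symp adj" and deg: "\<And>T. card {u. u < T \<and> adj T u} \<le> m"
    and att: "\<And>V v. finite V \<Longrightarrow> V \<subseteq> {1..} \<Longrightarrow> v \<in> V \<Longrightarrow> card V \<le> 2 * q \<Longrightarrow> infinite {T. \<forall>u\<in>V. adj T u}"
    and "k \<le> q"
  shows "\<exists>V (z :: nat set \<Rightarrow>\<^sub>0 'f::field) \<sigma>. sphere adj k V z \<sigma>"
  using assms(4)
proof (induction k)
  case 0
  have "sphere adj 0 {} (Poly_Mapping.single {} (1::'f)) {}"
    by (auto simp: sphere_def chains_def cliques_def aug_boundary_single simplex_boundary_def)
  then show ?case
    by blast
next
  case (Suc k)
  then obtain V \<sigma> and z :: "nat set \<Rightarrow>\<^sub>0 'f" where sph: "sphere adj k V z \<sigma>"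
    by auto
  then have V: "finite V" "V \<subseteq> {1..}" "card V \<le> 2 * q"
    using Suc.prems by (auto simp: sphere_def)
  have "infinite {T. \<forall>u\<in>V. adj T u}"
  proof (cases "V = {}")
    case False
    then show ?thesis
      using att[of V] V by auto
  qed simp
  \<comment> \<open>The poles must be nodes, which excludes 0, and must be new.\<close>
  then have "infinite ({T. \<forall>u\<in>V. adj T u} - insert 0 V)"
    using V by (intro Diff_infinite_finite) auto
  moreover have "card {u \<in> {T. \<forall>u\<in>V. adj T u} - insert 0 V. u < T \<and> adj T u} \<le> m" for T
    by (rule order.trans[OF card_mono deg[of T]]) auto
  ultimately obtain a b where ab: "a \<in> {T. \<forall>u\<in>V. adj T u} - insert 0 V"
      "b \<in> {T. \<forall>u\<in>V. adj T u} - insert 0 V" "a \<noteq> b" "\<not> adj a b"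
    by (rule infinite_set_nonadjacent)
  have "sphere adj (Suc k) (insert a (insert b V)) (chain_cone a z - chain_cone b z) (insert a \<sigma>)"
  proof (rule sphere_suspension[OF assms(1) sph _ ab(3,4)])
    show "{a, b} \<subseteq> {1..} - V" "\<And>v. v \<in> V \<Longrightarrow> adj a v \<and> adj b v"
      using ab(1,2) by auto
  qed
  then show ?case
    by blast
qed

text \<open>If all classes lived on a finite set of simplices, take two nodes \<open>T1 < T\<close>
  of the given infinite set beyond it. The difference of their cones over \<open>z\<close> would be
  homologous to a cycle \<open>c'\<close> that meets neither, and a chain realising this would fill
  \<open>z\<close> up to sign in the link of \<open>T\<close>. The conditions on \<open>V\<close>
  and \<open>v\<close> exclude this.\<close>

lemma betti_infiniteI:
  fixes G :: multigraph and z :: "nat set \<Rightarrow>\<^sub>0 'f::field"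
  defines "adj \<equiv> adjacent G"
  assumes "p \<noteq> 0"
    and nh: "\<And>T. T > T0 \<Longrightarrow> no_homology TYPE('f) adj (nbhd adj {1..T} T) (Suc p)"
    and sph: "sphere adj p V z \<sigma>" and "v \<in> \<sigma>"
    and inf: "infinite {T. (\<forall>u\<in>V. adj T u) \<and> (\<forall>u\<in>nbhd adj {1..T} T - V. \<not> adj u v)}"
      (is "infinite ?I")
  shows "betti_number TYPE('f) (clique_complex {1..} G) p = \<infinity>"
proof (rule ccontr)
  assume "\<not> ?thesis"
  then have "betti_number TYPE('f) (clique_complex {1..} G) p < \<infinity>"
    by (metis enat_ord_simps(4))
  then obtain S where S: "finite S" and S': "\<And>c::nat set \<Rightarrow>\<^sub>0 'f. c \<in> cycles (clique_complex {1..} G) p \<Longrightarrow>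
      \<exists>c'\<in>cycles (clique_complex {1..} G) p. Poly_Mapping.keys c' \<subseteq> S \<and>
        c - c' \<in> boundaries (clique_complex {1..} G) p"
    unfolding betti_finite_iff[OF simplicial_complex_clique_complex] by blast
  let ?A = "V \<union> \<Union>{\<tau> \<in> S. finite \<tau>} \<union> {T0}"
  have V: "finite V" "V \<subseteq> {1..}" and z: "z \<in> chains adj V p" "aug_boundary z = 0" "\<sigma> \<in> Poly_Mapping.keys z"
    and max: "\<And>u. u \<in> V \<Longrightarrow> \<exists>v\<in>\<sigma>. u = v \<or> \<not> adj u v"
    using sph by (auto simp: sphere_def)
  have symp: "symp adj"
    unfolding adj_def by (rule symp_adjacent)
  have "finite ?A"
    using S V by auto
  then obtain N where N: "\<And>u. u \<in> ?A \<Longrightarrow> u \<le> N"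
    using finite_nat_set_iff_bounded_le by metis
  obtain T1 where T1: "T1 \<in> ?I" "T1 > N"
    using inf by (meson infinite_nat_iff_unbounded)
  obtain T where T: "T \<in> ?I" "T > T1"
    using inf by (meson infinite_nat_iff_unbounded)
  have T0: "T > T0"
    using N[of T0] T1 T by auto
  have nbhd: "V \<subseteq> nbhd adj {1..U} U" if "U \<in> ?I" "U > N" for U
  proof
    fix u assume "u \<in> V"
    then have "u \<le> N" "1 \<le> u" "adj U u"
      using N[of u] V(2) that(1) by auto
    then show "u \<in> nbhd adj {1..U} U"
      using that(2) by (simp add: nbhd_def)
  qed
  have "T > N"
    using T T1 by simp
  then have zT: "z \<in> chains adj (nbhd adj {1..T} T) p" "z \<in> chains adj (nbhd adj {1..T1} T1) p"
    using z(1) chains_mono[OF nbhd[OF T(1)], of adj p] chains_mono[OF nbhd[OF T1], of adj p] by blast+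
  have coneT: "chain_cone T z \<in> chains adj {1..T} (Suc p)"
    using chain_cone_chains[OF symp _ zT(1)] T by auto
  have coneT1: "chain_cone T1 z \<in> chains adj {1..T1} (Suc p)"
    using chain_cone_chains[OF symp _ zT(2)] T1 by auto
  then have coneT1': "chain_cone T1 z \<in> chains adj {1..T} (Suc p)"
    by (rule subsetD[OF chains_mono, rotated]) (use T in auto)
  let ?c = "chain_cone T z - chain_cone T1 z"
  have c: "?c \<in> chains adj {1..T} (Suc p)"
    by (intro chains_diff coneT coneT1')
  have "aug_boundary ?c = 0"
    using z(2) nbhd_avoids[OF zT(1)] nbhd_avoids[OF zT(2)] by (simp add: aug_boundary_diff aug_boundary_chain_cone)
  moreover have "?c \<in> chains adj {1..} (Suc p)"
    using c by (rule subsetD[OF chains_mono, rotated]) auto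
  ultimately have "?c \<in> cycles (clique_complex {1..} G) p"
    by (simp add: cycles_clique_complex[OF assms(2)] adj_def)
  then obtain c' where c': "c' \<in> chains adj {1..} (Suc p)" "Poly_Mapping.keys c' \<subseteq> S"
      "?c - c' \<in> aug_boundary ` chains adj {1..} (Suc (Suc p))"
    using S'[of ?c] unfolding cycles_clique_complex[OF assms(2)] boundaries_clique_complex adj_def by blast
  have c'N: "c' \<in> chains adj {1..N} (Suc p)"
  proof -
    have "\<tau> \<subseteq> {1..N}" if \<tau>: "\<tau> \<in> Poly_Mapping.keys c'" for \<tau>
    proof -
      have "finite \<tau>" "\<tau> \<subseteq> {1..}" "\<tau> \<in> S"
        using \<tau> c' by (auto simp: chains_def cliques_def)
      then have "\<tau> \<subseteq> ?A"
        by auto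
      then show ?thesis
        using N \<open>\<tau> \<subseteq> {1..}\<close> by (simp add: subset_iff)
    qed
    then show ?thesis
      using c'(1) by (auto simp: chains_def cliques_def subset_iff)
  qed
  then have c'T: "c' \<in> chains adj {1..T} (Suc p)"
    by (rule subsetD[OF chains_mono, rotated]) (use T T1 in auto)
  obtain b where b: "b \<in> chains adj {1..} (Suc (Suc p))" "?c - c' = aug_boundary b"
    using c'(3) by auto
  obtain M where M: "b \<in> chains adj {1..M} (Suc (Suc p))" "M \<ge> T"
    by (rule chains_bounded[OF b(1)])
  have nh': "no_homology TYPE('f) adj (nbhd adj {1..U} U) (Suc p)" if "U > T" for U
    using that T0 by (intro nh) auto
  \<comment> \<open>The links after \<open>T\<close> are acyclic in degree \<open>p + 1\<close>, so
    no later node can turn a nontrivial class into a boundary: the bounding chain may be chosen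
    among the nodes up to \<open>T\<close>.\<close>
  obtain b' where b': "b' \<in> chains adj {1..T} (Suc (Suc p))" "?c - c' = aug_boundary b'"
    using boundary_in_initial_segment[OF nh' chains_diff[OF c c'T] M(1) b(2) M(2)] by blast
  obtain d e where de: "b' = chain_cone T d + e" "d \<in> chains adj (nbhd adj {1..T} T) (Suc p)"
      "e \<in> chains adj ({1..T} - {T}) (Suc (Suc p))"
    by (rule chains_decomposition[OF b'(1)])
  have "avoids T (chain_cone T1 z)" "avoids T c'"
    using chains_avoids[OF coneT1, of T] chains_avoids[OF c'N, of T] T T1 by auto
  then have "avoids T (- chain_cone T1 z - c')"
    using avoids_diff[of T "0 - chain_cone T1 z" c'] avoids_diff[of T 0 "chain_cone T1 z"]
    by (simp add: avoids_def)
  moreover have "aug_boundary (chain_cone T d + e) = chain_cone T z + (- chain_cone T1 z - c')"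
    using b'(2) de(1) by (simp add: algebra_simps)
  \<comment> \<open>In \<open>?c - c'\<close> only the cone from \<open>T\<close> has a part at
    \<open>T\<close>; so the part \<open>d\<close> of the bounding chain fills \<open>- z\<close> in
    the link.\<close>
  ultimately have d: "aug_boundary d = - z"
    using aug_boundary_decomposition(1)[OF de(2,3) nbhd_avoids[OF zT(1)]] by blast
  \<comment> \<open>Hence \<sigma> is a proper face of a simplex \<open>insert w \<sigma>\<close> of
    the link. If \<open>w \<in> V\<close>, this contradicts the maximality of \<sigma> in
    \<open>V\<close>; otherwise \<open>w\<close> would be a forbidden neighbour of
    \<open>v\<close>.\<close>
  have "\<sigma> \<in> Poly_Mapping.keys (aug_boundary d)"
    using z(3) by (simp add: d in_keys_iff)
  then obtain \<tau> w where \<tau>: "\<tau> \<in> Poly_Mapping.keys d" "w \<in> \<tau>" "\<sigma> = \<tau> - {w}"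
    using keys_aug_boundary[of d] by blast
  then have w: "w \<in> nbhd adj {1..T} T" "\<And>u. u \<in> \<sigma> \<Longrightarrow> u \<noteq> w \<and> adj w u"
    using de(2) by (auto simp: chains_def cliques_def)
  show False
  proof (cases "w \<in> V")
    case True
    then show False
      using max[of w] w(2) by blast
  next
    case False
    then show False
      using T(1) w \<open>v \<in> \<sigma>\<close> by auto
  qed
qed

section \<open>Preferential attachment as an urn process\<close>

lemma count_list_eq_card: "count_list h v = card {i. i < length h \<and> h ! i = v}"
  by (simp add: count_list_eq_length_filter length_filter_conv_card eq_commute[of v])

context preferential_attachment
begin

text \<open>The random edges are enumerated in the order in which they are sent: step \<open>k * m + r\<close> with
  \<open>r < m\<close> is the edge \<open>r + 1\<close> of node \<open>k + 3\<close>. Every node \<open>v\<close> that exists at a step has degree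
  \<open>m\<close> plus the number of earlier steps with target \<open>v\<close>, so the process is an urn scheme.\<close>

definition node :: "nat \<Rightarrow> nat" where "node n = 3 + n div m"
definition slot :: "nat \<Rightarrow> nat" where "slot n = 1 + n mod m"
definition target :: "nat \<Rightarrow> 'w \<Rightarrow> nat" where "target n \<omega> = E (node n) (slot n) \<omega>"
definition hist :: "nat \<Rightarrow> 'w \<Rightarrow> nat list" where "hist n \<omega> = map (\<lambda>i. target i \<omega>) [0..<n]"
text \<open>The denominator of the attachment law, written as the sum of all weights:
  \<open>m + \<delta>\<close> for each of the \<open>2 + n div m\<close> existing nodes and 1 for
  each earlier step.\<close>

definition total :: "nat \<Rightarrow> real" where
  "total n = real n + real (2 + n div m) * (real m + \<delta>)"
definition weight :: "nat list \<Rightarrow> nat \<Rightarrow> real" where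
  "weight h v = real m + \<delta> + real (count_list h v)"
definition legal :: "nat \<Rightarrow> nat set" where "legal n = {1..2 + n div m}"
definition hists :: "nat \<Rightarrow> nat list set" where
  "hists n = {h. length h = n \<and> (\<forall>i<n. h ! i \<in> legal i)}"

definition base_graph :: multigraph where "base_graph = (\<lambda>\<beta>. (2, \<beta>, 1)) ` {1..m}"
definition hist_graph :: "nat list \<Rightarrow> multigraph" where
  "hist_graph h = base_graph \<union> (\<lambda>i. (node i, slot i, h ! i)) ` {..<length h}"

lemma node_slot_inject: "node i = node j \<Longrightarrow> slot i = slot j \<Longrightarrow> i = j"
  unfolding node_def slot_def by (metis add_left_cancel div_mult_mod_eq)

lemma node_block: "r < m \<Longrightarrow> node (k * m + r) = 3 + k \<and> slot (k * m + r) = Suc r"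
  by (simp add: node_def slot_def)

lemma slot_in: "slot n \<in> {1..m}"
  using m_pos by (simp add: slot_def Suc_le_eq)

lemma legal_eq: "legal n = {1..node n - 1}"
  by (simp add: legal_def node_def)

lemma add_edges_steps:
  assumes "r \<le> m"
  shows "add_edges t (3 + k) r G = G \<union> (\<lambda>i. (node i, slot i, t (node i) (slot i))) ` {k * m..<k * m + r}"
proof -
  have 1: "{k * m..<k * m + r} = (\<lambda>j. k * m + j) ` {..<r}"
    by (force simp: image_iff le_iff_add)
  have 2: "{1..r} = Suc ` {..<r}"
    by (simp add: image_Suc_lessThan)
  have "(\<lambda>\<beta>. (3 + k, \<beta>, t (3 + k) \<beta>)) ` {1..r} =
      (\<lambda>i. (node i, slot i, t (node i) (slot i))) ` {k * m..<k * m + r}"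
    unfolding 1 2 image_image by (rule image_cong[OF refl]) (use assms in \<open>auto simp: node_block\<close>)
  then show ?thesis
    by (simp add: add_edges_def)
qed

lemma pa_graph_steps:
  "pa_graph m t (2 + k) = base_graph \<union> (\<lambda>i. (node i, slot i, t (node i) (slot i))) ` {..<k * m}"
proof (induction k)
  case 0
  then show ?case
    by (simp add: pa_graph.simps base_graph_def)
next
  case (Suc k)
  have "pa_graph m t (2 + Suc k) = add_edges t (3 + k) m (pa_graph m t (2 + k))"
    by (subst pa_graph.simps) (simp add: numeral_3_eq_3)
  also have "\<dots> = base_graph \<union> (\<lambda>i. (node i, slot i, t (node i) (slot i))) ` ({..<k * m} \<union> {k * m..<k * m + m})"
    unfolding Suc.IH add_edges_steps[OF order.refl] by auto
  also have "{..<k * m} \<union> {k * m..<k * m + m} = {..<Suc k * m}"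
    by auto
  finally show ?case .
qed

lemma pa_graph_partial_eq:
  "pa_graph_partial m (\<lambda>s \<beta>. E s \<beta> \<omega>) (node n - 1) (slot n - 1) = hist_graph (hist n \<omega>)"
proof -
  define k r where "k = n div m" and "r = n mod m"
  have r: "r < m" and n: "n = k * m + r"
    using m_pos by (simp_all add: k_def r_def)
  let ?t = "\<lambda>s \<beta>. E s \<beta> \<omega>"
  have node: "node n - 1 = 2 + k" "slot n - 1 = r"
    by (simp_all add: node_def slot_def k_def r_def)
  have "pa_graph_partial m ?t (node n - 1) (slot n - 1) = add_edges ?t (3 + k) r (pa_graph m ?t (2 + k))"
    unfolding pa_graph_partial_def node by (simp add: numeral_3_eq_3)
  also have "\<dots> = base_graph \<union> (\<lambda>i. (node i, slot i, target i \<omega>)) ` ({..<k * m} \<union> {k * m..<k * m + r})"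
    unfolding pa_graph_steps add_edges_steps[OF less_imp_le[OF r]] target_def by auto
  also have "{..<k * m} \<union> {k * m..<k * m + r} = {..<n}"
    unfolding n by auto
  also have "base_graph \<union> (\<lambda>i. (node i, slot i, target i \<omega>)) ` {..<n} = hist_graph (hist n \<omega>)"
    by (simp add: hist_graph_def hist_def)
  finally show ?thesis .
qed

text \<open>Makes conditioning on the graph the same as conditioning on the history. Node and slot
  determine the step, and \<open>node i \<ge> 3\<close> separates the steps from the edges between 1
  and 2.\<close>

lemma hist_graph_inject:
  assumes "length h = length h'" "hist_graph h = hist_graph h'"
  shows "h = h'"
proof (rule nth_equalityI[OF assms(1)])
  fix i assume i: "i < length h"
  then have "(node i, slot i, h ! i) \<in> hist_graph h'"
    using assms(2) by (auto simp: hist_graph_def)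
  moreover have "(node i, slot i, h ! i) \<notin> base_graph"
    by (auto simp: base_graph_def node_def)
  ultimately obtain j where "node i = node j" "slot i = slot j" "h ! i = h' ! j"
    by (auto simp: hist_graph_def)
  then show "h ! i = h' ! i"
    using node_slot_inject[of i j] by simp
qed

lemma hists_nth: "h \<in> hists n \<Longrightarrow> i < n \<Longrightarrow> 1 \<le> h ! i \<and> h ! i < node i"
  by (auto simp: hists_def legal_def node_def)

text \<open>The initial degree \<open>m\<close> of the nodes 1 and 2 comes from
  \<open>base_graph\<close>, that of a later node from the block of steps that it sent, which is
  complete before \<open>v\<close> becomes a possible target. Every step with target
  \<open>v\<close> adds one.\<close>

lemma degree_hist_graph:
  assumes h: "h \<in> hists n" and v: "v \<in> legal n"
  shows "degree (hist_graph h) v = m + count_list h v"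
proof -
  have len: "length h = n"
    using h by (simp add: hists_def)
  let ?f = "\<lambda>i. (node i, slot i, h ! i)"
  have inj: "inj_on ?f A" for A
    using node_slot_inject by (auto simp: inj_on_def)
  define A where "A = {i. i < n \<and> node i = v}"
  define B where "B = {i. i < n \<and> h ! i = v}"
  have dis: "A \<inter> B = {}"
    using hists_nth[OF h] by (fastforce simp: A_def B_def)
  define base where "base = (if v \<le> 2 then base_graph else {})"
  have "{(s, \<beta>, u). (s, \<beta>, u) \<in> hist_graph h \<and> (s = v \<or> u = v)} = base \<union> ?f ` (A \<union> B)"
    using v by (auto simp: hist_graph_def base_graph_def base_def A_def B_def len legal_def)
  moreover have "base \<inter> ?f ` (A \<union> B) = {}"
    by (auto simp: base_def base_graph_def node_def)
  moreover have "finite base" "finite A" "finite B"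
    by (auto simp: base_def base_graph_def A_def B_def)
  ultimately have deg: "degree (hist_graph h) v = card base + (card A + card B)"
    using dis by (simp add: degree_def card_Un_disjoint card_image[OF inj])
  have base: "card base = (if v \<le> 2 then m else 0)"
    by (simp add: base_def base_graph_def card_image inj_on_def)
  have A: "card A = (if v \<le> 2 then 0 else m)"
  proof (cases "v \<le> 2")
    case False
    then have vk: "v = 3 + (v - 3)" "v - 3 < n div m"
      using v by (auto simp: legal_def)
    then have "Suc (v - 3) * m \<le> n div m * m"
      by (intro mult_le_mono1) simp
    also have "\<dots> \<le> n"
      by simp
    finally have le: "(v - 3) * m + m \<le> n"
      by simp
    have "A = {(v - 3) * m..<(v - 3) * m + m}"
    proof (intro equalityI subsetI)
      fix i assume "i \<in> A"
      then have "i div m = v - 3"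
        by (auto simp: A_def node_def)
      then show "i \<in> {(v - 3) * m..<(v - 3) * m + m}"
        using m_pos by (metis atLeastLessThan_iff div_mult_mod_eq le_add1 mod_less_divisor nat_add_left_cancel_less)
    next
      fix i assume "i \<in> {(v - 3) * m..<(v - 3) * m + m}"
      then have "i < n" "i div m = v - 3"
        using le by (auto intro!: div_nat_eqI simp: mult.commute)
      then show "i \<in> A"
        using False by (simp add: A_def node_def)
    qed
    then show ?thesis
      using False by simp
  qed (auto simp: A_def node_def)
  show ?thesis
    using deg base A by (simp add: B_def count_list_eq_card len)
qed

lemma total_pos: "total n > 0"
proof -
  have "real (2 + n div m) * (real m + \<delta>) > 0"
    using delta_gt by (intro mult_pos_pos) auto
  then show ?thesis
    by (simp add: total_def)
qed

lemma weight_pos: "weight h v > 0"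
  using delta_gt by (simp add: weight_def)

lemma hists_0: "hists 0 = {[]}"
  by (auto simp: hists_def)

lemma hists_Suc: "hists (Suc n) = (\<lambda>(h, v). h @ [v]) ` (hists n \<times> legal n)"
proof (intro equalityI subsetI)
  fix h assume h: "h \<in> hists (Suc n)"
  then have "length h = Suc n"
    by (simp add: hists_def)
  then have "h = take n h @ [h ! n]"
    using take_Suc_conv_app_nth[of n h] by simp
  moreover have "take n h \<in> hists n" "h ! n \<in> legal n"
    using h by (auto simp: hists_def)
  ultimately show "h \<in> (\<lambda>(h, v). h @ [v]) ` (hists n \<times> legal n)"
    by (intro image_eqI[of _ _ "(take n h, h ! n)"]) auto
qed (auto simp: hists_def nth_append less_Suc_eq)

lemma finite_legal [simp]: "finite (legal n)"
  by (simp add: legal_def)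

lemma finite_hists [simp]: "finite (hists n)"
  by (induction n) (simp_all add: hists_0 hists_Suc)

lemma sum_hists_Suc: "(\<Sum>h\<in>hists (Suc n). f h) = (\<Sum>h\<in>hists n. \<Sum>v\<in>legal n. f (h @ [v]))"
proof -
  have "inj_on (\<lambda>(h, v). h @ [v]) (hists n \<times> legal n)"
    by (auto simp: inj_on_def)
  then show ?thesis
    unfolding hists_Suc by (subst sum.reindex) (auto simp: sum.cartesian_product intro: sum.cong)
qed

lemma sum_weight: "h \<in> hists n \<Longrightarrow> (\<Sum>v\<in>legal n. weight h v) = total n"
proof -
  assume h: "h \<in> hists n"
  have "set h \<subseteq> legal n"
  proof
    fix v assume "v \<in> set h"
    then obtain i where i: "i < n" "v = h ! i"
      using h by (auto simp: in_set_conv_nth hists_def)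
    then have "i div m \<le> n div m"
      by (intro div_le_mono) simp
    then show "v \<in> legal n"
      using h i by (fastforce simp: hists_def legal_def)
  qed
  then have "(\<Sum>v\<in>legal n. count_list h v) = length h"
    by (metis finite_legal sum_count_set)
  moreover have "length h = n"
    using h by (simp add: hists_def)
  ultimately have "(\<Sum>v\<in>legal n. real (count_list h v)) = real n"
    by (simp only: of_nat_sum[symmetric])
  then show ?thesis
    by (simp add: weight_def sum.distrib total_def legal_def)
qed

lemma target_measurable [measurable]: "target n \<in> measurable M (count_space UNIV)"
proof -
  have "random_variable (count_space {1..node n - 1}) (E (node n) (slot n))"
    using slot_in[of n] by (intro target_random_variable) (simp_all add: node_def)
  then have "E (node n) (slot n) \<in> measurable M (count_space UNIV)"
    by (rule measurable_compose) simp
  then show ?thesis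
    unfolding target_def[abs_def] .
qed

lemma target_legal: "\<omega> \<in> space M \<Longrightarrow> target n \<omega> \<in> legal n"
  using target_random_variable[of "node n" "slot n"] slot_in[of n]
  by (auto simp: target_def legal_eq node_def dest: measurable_space)

lemma hist_in_hists: "\<omega> \<in> space M \<Longrightarrow> hist n \<omega> \<in> hists n"
  using target_legal by (auto simp: hists_def hist_def)

lemma hist_Suc: "hist (Suc n) \<omega> = hist n \<omega> @ [target n \<omega>]"
  by (simp add: hist_def)

lemma hist_nth: "i < n \<Longrightarrow> hist n \<omega> ! i = target i \<omega>"
  by (simp add: hist_def)

lemma take_hist: "k \<le> n \<Longrightarrow> take k (hist n \<omega>) = hist k \<omega>"
  by (auto simp: hist_def take_map)

lemma hist_event [measurable]: "{\<omega> \<in> space M. hist n \<omega> = h} \<in> events"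
proof (induction n arbitrary: h)
  case 0
  then show ?case
    by (cases "h = []") (simp_all add: hist_def)
next
  case (Suc n)
  show ?case
  proof (cases h rule: rev_cases)
    case Nil
    then show ?thesis
      by (simp add: hist_Suc)
  next
    case (snoc h' v)
    then have "{\<omega> \<in> space M. hist (Suc n) \<omega> = h} =
        {\<omega> \<in> space M. hist n \<omega> = h'} \<inter> {\<omega> \<in> space M. target n \<omega> = v}"
      by (auto simp: hist_Suc)
    moreover have "{\<omega> \<in> space M. target n \<omega> = v} \<in> events"
      by measurable
    ultimately show ?thesis
      using Suc by auto
  qed
qed

lemma hist_pred_event: "{\<omega> \<in> space M. P (hist n \<omega>)} \<in> events"
proof -
  have "{\<omega> \<in> space M. P (hist n \<omega>)} = (\<Union>h\<in>{h \<in> hists n. P h}. {\<omega> \<in> space M. hist n \<omega> = h})"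
    using hist_in_hists by auto
  then show ?thesis
    by (auto intro: sets.finite_UN)
qed

definition hist_prob :: "nat \<Rightarrow> nat list \<Rightarrow> real" where
  "hist_prob n h = prob {\<omega> \<in> space M. hist n \<omega> = h}"

lemma hist_prob_nonneg: "hist_prob n h \<ge> 0"
  by (simp add: hist_prob_def)

lemma hist_prob_Suc:
  assumes h: "h \<in> hists n" and v: "v \<in> legal n"
  shows "hist_prob (Suc n) (h @ [v]) = hist_prob n h * (weight h v / total n)"
proof -
  have len: "length h = n"
    using h by (simp add: hists_def)
  have ev: "{\<omega> \<in> space M. hist (Suc n) \<omega> = h @ [v]} = {\<omega> \<in> space M. target n \<omega> = v \<and> hist n \<omega> = h}"
    by (auto simp: hist_Suc)
  show ?thesis
  \<comment> \<open>\<open>target_law\<close> is silent on histories of probability 0; there both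
    sides vanish by monotonicity.\<close>
  proof (cases "hist_prob n h = 0")
    case True
    have "hist_prob (Suc n) (h @ [v]) \<le> hist_prob n h"
      unfolding hist_prob_def ev by (intro finite_measure_mono) auto
    then show ?thesis
      using True hist_prob_nonneg[of "Suc n" "h @ [v]"] by simp
  next
    case False
    have graph: "pa_graph_partial m (\<lambda>s \<beta>. E s \<beta> \<omega>) (node n - 1) (slot n - 1) = hist_graph h \<longleftrightarrow> hist n \<omega> = h" for \<omega>
      unfolding pa_graph_partial_eq using hist_graph_inject[of "hist n \<omega>" h] len by (auto simp: hist_def)
    have "prob {\<omega> \<in> space M. pa_graph_partial m (\<lambda>s \<beta>. E s \<beta> \<omega>) (node n - 1) (slot n - 1) = hist_graph h} > 0"
      unfolding graph using False by (simp add: hist_prob_def zero_less_measure_iff)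
    then have "\<P>(\<omega> in M. E (node n) (slot n) \<omega> = v \<bar>
        pa_graph_partial m (\<lambda>s \<beta>. E s \<beta> \<omega>) (node n - 1) (slot n - 1) = hist_graph h) =
        (real (degree (hist_graph h) v) + \<delta>) /
          (2 * (real (node n) - 2) * real m + real (slot n) - 1 + (real (node n) - 1) * \<delta>)"
      using slot_in[of n] v by (intro target_law) (auto simp: legal_eq node_def)
    also have "real (degree (hist_graph h) v) + \<delta> = weight h v"
      using degree_hist_graph[OF h v] by (simp add: weight_def)
    also have "2 * (real (node n) - 2) * real m + real (slot n) - 1 + (real (node n) - 1) * \<delta> = total n"
    proof -
      have n: "real n = real (n div m) * real m + real (n mod m)"
        by (metis div_mult_mod_eq of_nat_add of_nat_mult)
      show ?thesis
        unfolding total_def node_def slot_def n by (simp add: algebra_simps)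
    qed
    finally have "prob {\<omega> \<in> space M. target n \<omega> = v \<and> hist n \<omega> = h} / hist_prob n h = weight h v / total n"
      unfolding cond_prob_def graph hist_prob_def target_def by simp
    then show ?thesis
      unfolding hist_prob_def[of "Suc n"] ev using False by (simp add: field_simps)
  qed
qed

section \<open>Expectations of functions of the history, as finite sums\<close>

definition hist_exp :: "nat \<Rightarrow> (nat list \<Rightarrow> real) \<Rightarrow> real" where
  "hist_exp n f = (\<Sum>h\<in>hists n. hist_prob n h * f h)"

text \<open>The conditional expectation of \<open>f\<close> at the next history, given that the
  present one is \<open>h\<close>; \<open>hist_exp_Suc\<close> is the tower property.\<close>

definition step :: "nat \<Rightarrow> (nat list \<Rightarrow> real) \<Rightarrow> nat list \<Rightarrow> real" where
  "step n f h = (\<Sum>v\<in>legal n. weight h v / total n * f (h @ [v]))"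

lemma hist_exp_Suc: "hist_exp (Suc n) f = hist_exp n (step n f)"
  unfolding hist_exp_def step_def sum_hists_Suc sum_distrib_left
  by (intro sum.cong refl) (simp add: hist_prob_Suc)

lemma hist_exp_0: "hist_exp 0 f = f []"
  by (simp add: hist_exp_def hists_0 hist_prob_def hist_def prob_space)

lemma hist_exp_mono: "(\<And>h. h \<in> hists n \<Longrightarrow> f h \<le> g h) \<Longrightarrow> hist_exp n f \<le> hist_exp n g"
  unfolding hist_exp_def by (intro sum_mono mult_left_mono hist_prob_nonneg)

lemma hist_exp_cong: "(\<And>h. h \<in> hists n \<Longrightarrow> f h = g h) \<Longrightarrow> hist_exp n f = hist_exp n g"
  unfolding hist_exp_def by (intro sum.cong) auto

lemma hist_exp_cmult: "hist_exp n (\<lambda>h. c * f h) = c * hist_exp n f"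
  by (simp add: hist_exp_def sum_distrib_left mult_ac)

lemma hist_exp_add: "hist_exp n (\<lambda>h. f h + g h) = hist_exp n f + hist_exp n g"
  by (simp add: hist_exp_def algebra_simps sum.distrib)

lemma hist_exp_diff: "hist_exp n (\<lambda>h. f h - g h) = hist_exp n f - hist_exp n g"
  by (simp add: hist_exp_def algebra_simps sum_subtractf)

lemma step_const: "h \<in> hists n \<Longrightarrow> step n (\<lambda>h'. f (take n h')) h = f h"
proof -
  assume h: "h \<in> hists n"
  then have "step n (\<lambda>h'. f (take n h')) h = (\<Sum>v\<in>legal n. weight h v / total n * f h)"
    by (simp add: step_def hists_def)
  also have "\<dots> = f h"
    using sum_weight[OF h] total_pos[of n]
    by (simp flip: sum_distrib_right sum_divide_distrib)
  finally show ?thesis .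
qed

lemma hist_exp_take:
  assumes "k \<le> n"
  shows "hist_exp n (\<lambda>h. f (take k h)) = hist_exp k f"
  using assms
proof (induction n rule: dec_induct)
  case base
  then show ?case
    by (intro hist_exp_cong) (simp add: hists_def)
next
  case (step n)
  have "step n (\<lambda>h. f (take k h)) h = f (take k h)" if "h \<in> hists n" for h
    using step_const[OF that, of "\<lambda>h. f (take k h)"] step.hyps by (simp add: min_absorb1)
  then show ?case
    using step.IH by (simp add: hist_exp_Suc cong: hist_exp_cong)
qed

lemma prob_hist: "prob {\<omega> \<in> space M. P (hist n \<omega>)} = hist_exp n (\<lambda>h. of_bool (P h))"
proof -
  have "{\<omega> \<in> space M. P (hist n \<omega>)} = (\<Union>h\<in>{h \<in> hists n. P h}. {\<omega> \<in> space M. hist n \<omega> = h})"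
    using hist_in_hists by auto
  also have "prob \<dots> = (\<Sum>h\<in>{h \<in> hists n. P h}. hist_prob n h)"
    unfolding hist_prob_def by (intro finite_measure_finite_Union) (auto simp: disjoint_family_on_def)
  also have "\<dots> = hist_exp n (\<lambda>h. of_bool (P h))"
    unfolding hist_exp_def by (rule sum.mono_neutral_cong_left) auto
  finally show ?thesis .
qed

lemma hist_markov:
  assumes "\<And>h. h \<in> hists n \<Longrightarrow> f h \<ge> 0" "a > 0"
  shows "prob {\<omega> \<in> space M. f (hist n \<omega>) \<ge> a} \<le> hist_exp n f / a"
proof -
  have "prob {\<omega> \<in> space M. f (hist n \<omega>) \<ge> a} = hist_exp n (\<lambda>h. of_bool (a \<le> f h))"
    by (rule prob_hist)
  then have "a * prob {\<omega> \<in> space M. f (hist n \<omega>) \<ge> a} = hist_exp n (\<lambda>h. a * of_bool (a \<le> f h))"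
    by (simp add: hist_exp_cmult)
  also have "\<dots> \<le> hist_exp n f"
    using assms by (intro hist_exp_mono) auto
  finally show ?thesis
    using assms(2) by (simp add: field_simps)
qed

end

lemma pochhammer_shift: "a * pochhammer (a + 1) r = pochhammer a r * (a + of_nat r)"
  for a :: "'a::comm_semiring_1"
  using pochhammer_rec[of a r] pochhammer_Suc[of a r] by simp

lemma ln_ratio_ge: "1 / (b + 1) \<le> ln (b + 1) - ln b" if "b > 0" for b :: real
proof -
  have "ln (b / (b + 1)) \<le> b / (b + 1) - 1"
    using that by (intro ln_le_minus_one) auto
  then show ?thesis
    using that by (simp add: ln_div field_simps)
qed

lemma ln_ratio_le: "ln (b + 1) - ln b \<le> 1 / b" if "b > 0" for b :: real
proof -
  have "ln ((b + 1) / b) \<le> (b + 1) / b - 1"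
    using that by (intro ln_le_minus_one) auto
  then show ?thesis
    using that by (simp add: ln_div field_simps)
qed

section \<open>Growth of the normalising constants\<close>

context preferential_attachment
begin

text \<open>The growth exponent of the degrees: the \<open>m\<close> steps of block \<open>k\<close>
  contribute about \<open>m / total\<close>, that is about \<open>rate / k\<close>, to the relative
  growth of a weight.\<close>

definition rate :: real where "rate = real m / (2 * real m + \<delta>)"

lemma pa_exponent_eq: "pa_exponent \<delta> m = 1 - rate"
  using m_pos delta_gt by (simp add: pa_exponent_def rate_def field_simps)

lemma rate_pos: "0 < rate" and rate_less_1: "rate < 1"
  using m_pos delta_gt by (simp_all add: rate_def field_simps)

lemma total_eq: "total n = (real (n div m) + 2) * (2 * real m + \<delta>) - 2 * real m + real (n mod m)"
proof -
  have n: "real n = real (n div m) * real m + real (n mod m)"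
    by (metis div_mult_mod_eq of_nat_add of_nat_mult)
  show ?thesis
    unfolding total_def n by (simp add: algebra_simps)
qed

lemma total_le: "total n \<le> (real (n div m) + 2) * (2 * real m + \<delta>)"
  using mod_less_divisor[OF m_pos, of n] by (simp add: total_eq)

lemma total_ge_linear: "total n \<ge> (real (n div m) + 2) * (real m + \<delta>)"
proof -
  have "real (n div m) * real m \<ge> 0"
    by simp
  then show ?thesis
    by (simp add: total_eq algebra_simps)
qed

lemma sum_block:
  assumes "A \<le> B"
  shows "(\<Sum>j\<in>{A * m..<Suc B * m}. f j) = (\<Sum>j\<in>{A * m..<B * m}. f j) + (\<Sum>j\<in>{B * m..<B * m + m}. f j)"
  using assms sum.atLeastLessThan_concat[of "A * m" "B * m" "B * m + m" f] by (simp add: add.commute)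

lemma div_block: "j \<in> {B * m..<B * m + m} \<Longrightarrow> j div m = B"
  by (auto intro!: div_nat_eqI simp: mult.commute)

text \<open>A block of \<open>m\<close> steps contributes at least \<open>rate / (B + 2)\<close>,
  which dominates \<open>rate\<close> times the increment of the logarithm.\<close>

lemma sum_inverse_total_lower:
  assumes "A \<le> B"
  shows "rate * (ln (real B + 2) - ln (real A + 2)) \<le> (\<Sum>j\<in>{A * m..<B * m}. 1 / total j)"
  using assms
proof (induction B rule: dec_induct)
  case (step B)
  have kappa: "2 * real m + \<delta> > 0"
    using delta_gt m_pos by simp
  have "(\<Sum>j\<in>{B * m..<B * m + m}. 1 / ((real B + 2) * (2 * real m + \<delta>))) \<le> (\<Sum>j\<in>{B * m..<B * m + m}. 1 / total j)"
  proof (rule sum_mono)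
    fix j assume "j \<in> {B * m..<B * m + m}"
    then have "j div m = B"
      by (rule div_block)
    then have "total j \<le> (real B + 2) * (2 * real m + \<delta>)"
      using total_le[of j] by simp
    then show "1 / ((real B + 2) * (2 * real m + \<delta>)) \<le> 1 / total j"
      using total_pos[of j] kappa by (intro divide_left_mono mult_pos_pos) auto
  qed
  moreover have "(\<Sum>j\<in>{B * m..<B * m + m}. 1 / ((real B + 2) * (2 * real m + \<delta>))) = rate * (1 / (real B + 2))"
    by (simp add: rate_def)
  moreover have "rate * (ln (real B + 2 + 1) - ln (real B + 2)) \<le> rate * (1 / (real B + 2))"
    using rate_pos by (intro mult_left_mono ln_ratio_le) auto
  moreover note sum_block[OF step.hyps(1), of "\<lambda>j. 1 / total j"]
  ultimately show ?case
    using step.IH by (simp add: algebra_simps)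
qed simp

text \<open>\<open>corr\<close> bounds the error of replacing \<open>1 / (b - 2 * rate)\<close>, with \<open>b = k + 2\<close>, by \<open>1 / (b + 1)\<close>
  in all blocks \<open>k\<close>: the differences are at most \<open>corr * (1 / b - 1 / (b + 1))\<close>.\<close>

definition corr :: real where
  "corr = (1 + 2 * rate) / (1 - rate)"

lemma corr_pos: "corr > 0"
  using rate_pos rate_less_1 by (simp add: corr_def)

text \<open>The term \<open>- corr / b\<close> next to \<open>ln b\<close> makes the errors
  telescope as well, so that the induction closes.\<close>

lemma sum_inverse_total_upper_aux:
  assumes "A \<le> B"
  shows "(\<Sum>j\<in>{A * m..<B * m}. 1 / total j) \<le>
    rate * ((ln (real B + 2) - corr / (real B + 2)) - (ln (real A + 2) - corr / (real A + 2)))"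
  using assms
proof (induction B rule: dec_induct)
  case (step B)
  have kappa: "2 * real m + \<delta> > 0"
    using delta_gt m_pos by simp
  define b where "b = real B + 2"
  have b: "b \<ge> 2"
    by (simp add: b_def)
  \<comment> \<open>From \<open>b \<ge> 2\<close> follows \<open>2 * rate \<le> rate * b\<close>;
    hence the denominators stay of order \<open>b\<close>, uniformly in the block.\<close>
  have pos: "(1 - rate) * b > 0" and pos': "b - 2 * rate \<ge> (1 - rate) * b"
    using b rate_pos rate_less_1 by (auto simp: algebra_simps)
  have "(\<Sum>j\<in>{B * m..<B * m + m}. 1 / total j) \<le> (\<Sum>j\<in>{B * m..<B * m + m}. 1 / ((b - 2 * rate) * (2 * real m + \<delta>)))"
  proof (rule sum_mono)
    fix j assume "j \<in> {B * m..<B * m + m}"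
    then have "j div m = B"
      by (rule div_block)
    then have "total j \<ge> b * (2 * real m + \<delta>) - 2 * real m"
      by (simp add: total_eq b_def)
    also have "b * (2 * real m + \<delta>) - 2 * real m = (b - 2 * rate) * (2 * real m + \<delta>)"
      using kappa by (simp add: rate_def field_simps)
    finally show "1 / total j \<le> 1 / ((b - 2 * rate) * (2 * real m + \<delta>))"
      using total_pos[of j] kappa pos pos' by (intro divide_left_mono mult_pos_pos) auto
  qed
  also have "\<dots> = rate * (1 / (b - 2 * rate))"
    by (simp add: rate_def)
  also have "\<dots> \<le> rate * ((ln (b + 1) - corr / (b + 1)) - (ln b - corr / b))"
  proof (rule mult_left_mono)
    have "1 / (b - 2 * rate) - 1 / (b + 1) = (1 + 2 * rate) / ((b - 2 * rate) * (b + 1))"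
      using b pos pos' by (simp add: field_simps)
    also have "\<dots> \<le> (1 + 2 * rate) / ((1 - rate) * b * (b + 1))"
      using b pos pos' rate_pos rate_less_1 by (intro divide_left_mono mult_pos_pos mult_right_mono) auto
    also have "\<dots> = corr * (1 / (b * (b + 1)))"
      using rate_less_1 b by (simp add: corr_def field_simps)
    also have "1 / (b * (b + 1)) = 1 / b - 1 / (b + 1)"
      using b by (simp add: field_simps)
    finally show "1 / (b - 2 * rate) \<le> (ln (b + 1) - corr / (b + 1)) - (ln b - corr / b)"
      using ln_ratio_ge[of b] b by (simp add: algebra_simps)
  qed (use rate_pos in simp)
  finally have "(\<Sum>j\<in>{B * m..<B * m + m}. 1 / total j) \<le>
      rate * ((ln (b + 1) - corr / (b + 1)) - (ln b - corr / b))" .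
  moreover note sum_block[OF step.hyps(1), of "\<lambda>j. 1 / total j"]
  moreover have "real (Suc B) + 2 = b + 1"
    by (simp add: b_def)
  ultimately show ?case
    using step.IH unfolding b_def[symmetric] by (simp add: algebra_simps)
qed simp

lemma sum_inverse_total_upper:
  assumes "A \<le> B"
  shows "(\<Sum>j\<in>{A * m..<B * m}. 1 / total j) \<le> rate * (ln (real B + 2) - ln (real A + 2)) + corr"
proof -
  have "corr / (real A + 2) \<le> corr" "corr / (real B + 2) \<ge> 0"
    using corr_pos by (auto simp: field_simps)
  then have "corr / (real A + 2) - corr / (real B + 2) \<le> corr"
    by linarith
  then have "rate * (corr / (real A + 2) - corr / (real B + 2)) \<le> rate * corr"
    using rate_pos by (intro mult_left_mono) auto
  also have "\<dots> \<le> 1 * corr"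
    using rate_less_1 corr_pos by (intro mult_right_mono) auto
  finally have "rate * (corr / (real A + 2) - corr / (real B + 2)) \<le> corr"
    by simp
  then show ?thesis
    using sum_inverse_total_upper_aux[OF assms] by (simp add: algebra_simps)
qed

section \<open>Joint probability of prescribed targets\<close>

lemma weight_append: "weight (h @ [v]) u = weight h u + of_bool (u = v)"
  by (simp add: weight_def)

text \<open>A step \<open>j\<close> multiplies the expected weight of an existing node
  \<open>u\<close> by \<open>1 + 1 / total j\<close>, so \<open>exp (gain i u)\<close> bounds the
  growth up to step \<open>i\<close>.\<close>

definition gain :: "nat \<Rightarrow> nat \<Rightarrow> real" where
  "gain i u = (\<Sum>j | j < i \<and> u \<in> legal j. 1 / total j)"

definition rising :: "nat set \<Rightarrow> (nat \<Rightarrow> nat) \<Rightarrow> nat list \<Rightarrow> real" where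
  "rising U r h = (\<Prod>u\<in>U. pochhammer (weight h u) (r u))"

lemma rising_nonneg: "rising U r h \<ge> 0"
  unfolding rising_def by (intro prod_nonneg pochhammer_nonneg) (simp add: weight_pos)

lemma rising_append:
  assumes "finite U"
  shows "weight h v * rising U r (h @ [v]) = rising U r h * (weight h v + (if v \<in> U then real (r v) else 0))"
proof (cases "v \<in> U")
  case True
  have "(\<Prod>u\<in>U - {v}. pochhammer (weight (h @ [v]) u) (r u)) = (\<Prod>u\<in>U - {v}. pochhammer (weight h u) (r u))"
    by (intro prod.cong) (auto simp: weight_append)
  then have "weight h v * rising U r (h @ [v]) =
      (weight h v * pochhammer (weight h v + 1) (r v)) * (\<Prod>u\<in>U - {v}. pochhammer (weight h u) (r u))"
    unfolding rising_def prod.remove[OF assms True] by (simp add: weight_append)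
  also have "\<dots> = rising U r h * (weight h v + real (r v))"
    unfolding rising_def prod.remove[OF assms True] pochhammer_shift by simp
  finally show ?thesis
    using True by simp
next
  case False
  have "rising U r (h @ [v]) = rising U r h"
    unfolding rising_def by (intro prod.cong) (use False in \<open>auto simp: weight_append\<close>)
  then show ?thesis
    using False by simp
qed

lemma rising_Suc:
  assumes "finite U" "v \<in> U" "r' v = Suc (r v)" "\<And>u. u \<in> U - {v} \<Longrightarrow> r' u = r u"
  shows "rising U r' h = rising U r h * (weight h v + real (r v))"
proof -
  have "(\<Prod>u\<in>U - {v}. pochhammer (weight h u) (r' u)) = (\<Prod>u\<in>U - {v}. pochhammer (weight h u) (r u))"
    using assms(4) by (intro prod.cong) auto
  then show ?thesis
    unfolding rising_def prod.remove[OF assms(1,2)] by (simp add: assms(3) pochhammer_Suc)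
qed

text \<open>The product of the rising factorials of the weights of the prescribed targets, each with the
  number of its remaining draws as exponent, is a martingale up to a deterministic factor in every
  step, because \<open>y * pochhammer (y + 1) r = pochhammer y r * (y + r)\<close>.\<close>

lemma prob_prescribed_targets:
  assumes I: "I \<subseteq> {..<N}"
  shows "prob {\<omega> \<in> space M. \<forall>i\<in>I. target i \<omega> = \<tau> i} \<le>
    (\<Prod>u\<in>\<tau> ` I. pochhammer (real m + \<delta>) (card {i \<in> I. \<tau> i = u})) *
    (\<Prod>i\<in>I. 1 / total i * exp (gain i (\<tau> i)))"
proof -
  have finI: "finite I"
    using I finite_subset by blast
  define U where "U = \<tau> ` I"
  have finU: "finite U"
    using finI by (simp add: U_def)
  define r where "r n u = card {i \<in> I. n \<le> i \<and> \<tau> i = u}" for n u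
  define ok where "ok n h \<longleftrightarrow> (\<forall>i\<in>I. i < n \<longrightarrow> h ! i = \<tau> i)" for n h
  define \<Psi> where "\<Psi> n h = of_bool (ok n h) * rising U (r n) h" for n h
  \<comment> \<open>Counts the prescribed draws that are still to come and whose target already
    exists. In a step that is not prescribed they raise the expectation of \<open>\<Psi>\<close> by
    the factor \<open>1 + R n / total n\<close>.\<close>
  define R where "R n = (\<Sum>i\<in>I. of_bool (n < i \<and> \<tau> i \<in> legal n) :: real)" for n
  \<comment> \<open>In a prescribed step \<open>1 / total n\<close> would do; the exponential, which
    is at least 1, gives one formula for all steps.\<close>
  define a where "a n = (if n \<in> I then 1 / total n else 1) * exp (R n / total n)" for n
  have R_nonneg: "R n \<ge> 0" for n
    by (simp add: R_def sum_nonneg)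
  have a_nonneg: "a n \<ge> 0" for n
    using total_pos[of n] by (simp add: a_def)
  have ok_append: "ok (Suc n) (h @ [v]) \<longleftrightarrow> ok n h \<and> (n \<in> I \<longrightarrow> v = \<tau> n)" if "h \<in> hists n" for n h v
    using that by (auto simp: ok_def hists_def nth_append less_Suc_eq)
  have rn: "r n u = r (Suc n) u + (if n \<in> I \<and> \<tau> n = u then 1 else 0)" for n u
  proof -
    have "{i \<in> I. n \<le> i \<and> \<tau> i = u} = {i \<in> I. Suc n \<le> i \<and> \<tau> i = u} \<union> (if n \<in> I \<and> \<tau> n = u then {n} else {})"
      by (auto simp: Suc_le_eq le_less)
    then show ?thesis
      using finI by (auto simp: r_def card_insert_if)
  qed
  have stp: "step n (\<Psi> (Suc n)) h \<le> a n * \<Psi> n h" if h: "h \<in> hists n" for n h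
  proof (cases "n \<in> I")
    case False
    have req: "r (Suc n) = r n"
      using False by (intro ext) (simp add: rn[of n])
    have "(\<Sum>v\<in>legal n. if v \<in> U then real (r (Suc n) v) else 0) = (\<Sum>v\<in>legal n \<inter> U. real (r (Suc n) v))"
      by (simp add: sum.inter_restrict)
    also have "\<dots> = (\<Sum>v\<in>legal n \<inter> U. \<Sum>i\<in>I. of_bool (n < i \<and> \<tau> i = v))"
      by (intro sum.cong refl) (simp add: r_def Suc_le_eq finI Int_def of_bool_def sum.If_cases)
    also have "\<dots> = (\<Sum>i\<in>I. \<Sum>v\<in>legal n \<inter> U. of_bool (n < i \<and> \<tau> i = v))"
      by (rule sum.swap)
    also have "\<dots> = R n"
      unfolding R_def
    proof (intro sum.cong refl)
      fix i assume "i \<in> I"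
      have "(\<Sum>v\<in>legal n \<inter> U. of_bool (n < i \<and> \<tau> i = v)) = (\<Sum>v\<in>legal n \<inter> U. if \<tau> i = v then of_bool (n < i) else (0::real))"
        by (intro sum.cong) auto
      also have "\<dots> = of_bool (n < i \<and> \<tau> i \<in> legal n)"
        using finU \<open>i \<in> I\<close> by (simp add: U_def)
      finally show "(\<Sum>v\<in>legal n \<inter> U. of_bool (n < i \<and> \<tau> i = v)) = (of_bool (n < i \<and> \<tau> i \<in> legal n) :: real)" .
    qed
    finally have R: "(\<Sum>v\<in>legal n. if v \<in> U then real (r (Suc n) v) else 0) = R n" .
    have "step n (\<Psi> (Suc n)) h =
        (\<Sum>v\<in>legal n. of_bool (ok n h) / total n * (weight h v * rising U (r (Suc n)) (h @ [v])))"
      unfolding step_def \<Psi>_def using ok_append[OF h] False by (intro sum.cong refl) auto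
    also have "\<dots> = of_bool (ok n h) / total n * (rising U (r n) h *
        (\<Sum>v\<in>legal n. weight h v + (if v \<in> U then real (r (Suc n) v) else 0)))"
      unfolding rising_append[OF finU] sum_distrib_left[symmetric] req by simp
    also have "\<dots> = \<Psi> n h * (1 + R n / total n)"
      unfolding sum.distrib sum_weight[OF h] R \<Psi>_def using total_pos[of n] by (simp add: divide_simps)
    also have "\<dots> \<le> \<Psi> n h * exp (R n / total n)"
      using rising_nonneg by (intro mult_left_mono exp_ge_add_one_self) (auto simp: \<Psi>_def)
    also have "\<dots> = a n * \<Psi> n h"
      using False by (simp add: a_def)
    finally show ?thesis .
  next
    case True
    then have \<tau>U: "\<tau> n \<in> U"
      by (simp add: U_def)
    have "step n (\<Psi> (Suc n)) h =
        (\<Sum>v\<in>legal n. if v = \<tau> n then of_bool (ok n h) / total n * (weight h v * rising U (r (Suc n)) (h @ [v])) else 0)"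
      unfolding step_def \<Psi>_def using ok_append[OF h] True by (intro sum.cong refl) auto
    also have "\<dots> = (if \<tau> n \<in> legal n then of_bool (ok n h) / total n * (weight h (\<tau> n) * rising U (r (Suc n)) (h @ [\<tau> n])) else 0)"
      by simp
    also have "\<dots> \<le> of_bool (ok n h) / total n * (weight h (\<tau> n) * rising U (r (Suc n)) (h @ [\<tau> n]))"
      using total_pos[of n] weight_pos[of h "\<tau> n"] rising_nonneg[of U "r (Suc n)" "h @ [\<tau> n]"] by (auto intro!: mult_nonneg_nonneg)
    also have "weight h (\<tau> n) * rising U (r (Suc n)) (h @ [\<tau> n]) = rising U (r n) h"
    proof -
      have "rising U (r n) h = rising U (r (Suc n)) h * (weight h (\<tau> n) + real (r (Suc n) (\<tau> n)))"
        by (rule rising_Suc[OF finU \<tau>U]) (use True rn[of n] in auto)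
      then show ?thesis
        unfolding rising_append[OF finU] using \<tau>U by simp
    qed
    also have "of_bool (ok n h) / total n * rising U (r n) h = 1 / total n * 1 * \<Psi> n h"
      by (simp add: \<Psi>_def)
    also have "\<dots> \<le> 1 / total n * exp (R n / total n) * \<Psi> n h"
      using total_pos[of n] R_nonneg[of n] rising_nonneg by (intro mult_right_mono mult_left_mono) (auto simp: \<Psi>_def)
    also have "\<dots> = a n * \<Psi> n h"
      using True by (simp add: a_def)
    finally show ?thesis .
  qed
  have ind: "hist_exp n (\<Psi> n) \<le> (\<Prod>k<n. a k) * \<Psi> 0 []" for n
  proof (induction n)
    case (Suc n)
    have "hist_exp (Suc n) (\<Psi> (Suc n)) \<le> hist_exp n (\<lambda>h. a n * \<Psi> n h)"
      unfolding hist_exp_Suc by (rule hist_exp_mono) (rule stp)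
    also have "\<dots> \<le> a n * ((\<Prod>k<n. a k) * \<Psi> 0 [])"
      unfolding hist_exp_cmult by (intro mult_left_mono Suc.IH a_nonneg)
    finally show ?case
      by (simp add: mult_ac)
  qed (simp add: hist_exp_0)
  have "{\<omega> \<in> space M. \<forall>i\<in>I. target i \<omega> = \<tau> i} = {\<omega> \<in> space M. ok N (hist N \<omega>)}"
    using I by (auto simp: ok_def hist_nth)
  then have "prob {\<omega> \<in> space M. \<forall>i\<in>I. target i \<omega> = \<tau> i} = hist_exp N (\<lambda>h. of_bool (ok N h))"
    by (simp add: prob_hist)
  also have "\<dots> = hist_exp N (\<Psi> N)"
  proof (rule hist_exp_cong)
    have "r N u = 0" for u
      using I finI by (auto simp: r_def)
    then show "of_bool (ok N h) = \<Psi> N h" for h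
      by (simp add: \<Psi>_def rising_def)
  qed
  also have "\<dots> \<le> (\<Prod>k<N. a k) * \<Psi> 0 []"
    by (rule ind)
  also have "\<Psi> 0 [] = (\<Prod>u\<in>\<tau> ` I. pochhammer (real m + \<delta>) (card {i \<in> I. \<tau> i = u}))"
    by (simp add: \<Psi>_def ok_def rising_def U_def weight_def r_def)
  also have "(\<Prod>k<N. a k) = (\<Prod>i\<in>I. 1 / total i) * exp (\<Sum>k<N. R k / total k)"
  proof -
    have "(\<Prod>k<N. if k \<in> I then 1 / total k else 1) = (\<Prod>i\<in>I. 1 / total i)"
      using I by (simp add: prod.inter_restrict[symmetric] Int_absorb1)
    then show ?thesis
      unfolding a_def prod.distrib by (simp add: exp_sum)
  qed
  \<comment> \<open>Sorted by prescribed draws instead of steps, this sum is the sum of their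
    gains.\<close>
  also have "(\<Sum>k<N. R k / total k) = (\<Sum>k<N. \<Sum>i\<in>I. of_bool (k < i \<and> \<tau> i \<in> legal k) / total k)"
    by (simp add: R_def sum_divide_distrib)
  also have "\<dots> = (\<Sum>i\<in>I. \<Sum>k<N. of_bool (k < i \<and> \<tau> i \<in> legal k) / total k)"
    by (rule sum.swap)
  also have "\<dots> = (\<Sum>i\<in>I. gain i (\<tau> i))"
    unfolding gain_def using I by (intro sum.cong[OF refl] sum.mono_neutral_cong_right) auto
  finally show ?thesis
    unfolding exp_sum[OF finI] prod.distrib by (simp only: mult_ac)
qed

text \<open>\<open>gain i u\<close> is at most \<open>rate * ln (node i / u)\<close> up to a
  constant, and \<open>1 / total i\<close> is at most of order \<open>1 / node i\<close>. Since
  \<open>node i \<ge> u\<close>, the bound persists when \<open>rate\<close> is replaced by the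
  larger \<open>1 - x\<close>; this allows \<open>x\<close> to be lowered.\<close>

lemma attachment_factor_le:
  assumes "x \<le> 1 - rate"
  shows "\<exists>C>0. \<forall>i u. u \<in> legal i \<longrightarrow>
    1 / total i * exp (gain i u) \<le> C * (real (node i) powr - x * real u powr (x - 1))"
\<comment> \<open>The factor \<open>3 / 2\<close> compares \<open>node i\<close>, which is
  \<open>i div m + 3\<close>, with the \<open>i div m + 2\<close> in \<open>total_ge_linear\<close>;
  \<open>exp corr\<close> is the error of the logarithmic sum.\<close>
proof (intro exI[of _ "3 / (2 * (real m + \<delta>)) * exp corr"] conjI allI impI)
  have md: "real m + \<delta> > 0"
    using delta_gt by simp
  then show "0 < 3 / (2 * (real m + \<delta>)) * exp corr"
    by simp
  fix i u assume u: "u \<in> legal i"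
  define t where "t = real (node i)"
  have u1: "1 \<le> u" "u \<le> 2 + i div m"
    using u by (auto simp: legal_def)
  have t: "t = real (i div m) + 3"
    by (simp add: t_def node_def)
  have ut: "1 \<le> t / real u"
    using u1 by (simp add: t field_simps)
  \<comment> \<open>Node \<open>u\<close> is a possible target from block \<open>u - 2\<close> on;
    truncated subtraction covers \<open>u = 1\<close>.\<close>
  have "gain i u \<le> (\<Sum>j\<in>{(u - 2) * m..<Suc (i div m) * m}. 1 / total j)"
    unfolding gain_def
  proof (rule sum_mono2)
    show "{j. j < i \<and> u \<in> legal j} \<subseteq> {(u - 2) * m..<Suc (i div m) * m}"
    proof
      fix j assume "j \<in> {j. j < i \<and> u \<in> legal j}"
      then have j: "j < i" "u - 2 \<le> j div m"
        by (auto simp: legal_def)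
      then have "(u - 2) * m \<le> j div m * m"
        by (intro mult_le_mono1)
      also have "\<dots> \<le> j"
        by simp
      finally have "(u - 2) * m \<le> j" .
      moreover have "i < Suc (i div m) * m"
        using m_pos dividend_less_div_times[of m i] by simp
      ultimately show "j \<in> {(u - 2) * m..<Suc (i div m) * m}"
        using j by simp
    qed
    show "0 \<le> 1 / total j" for j
      using total_pos[of j] by simp
  qed simp
  also have "\<dots> \<le> rate * (ln (real (Suc (i div m)) + 2) - ln (real (u - 2) + 2)) + corr"
    using u1 by (intro sum_inverse_total_upper) simp
  also have "\<dots> \<le> rate * (ln t - ln (real u)) + corr"
    using u1 rate_pos by (intro add_right_mono mult_left_mono diff_mono) (auto simp: t)
  also have "\<dots> \<le> (1 - x) * (ln t - ln (real u)) + corr"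
    using u1 ut assms by (intro add_right_mono mult_right_mono) (auto simp: t)
  finally have "exp (gain i u) \<le> exp ((1 - x) * (ln t - ln (real u)) + corr)"
    by simp
  also have "\<dots> = exp corr * (t powr (1 - x) * real u powr (x - 1))"
    using u1 by (simp add: powr_def t exp_add[symmetric] algebra_simps)
  finally have e: "exp (gain i u) \<le> exp corr * (t powr (1 - x) * real u powr (x - 1))" .
  have "2 * t * (real m + \<delta>) \<le> 3 * ((real (i div m) + 2) * (real m + \<delta>))"
  proof -
    have "2 * t \<le> 3 * (real (i div m) + 2)"
      by (simp add: t)
    from mult_right_mono[OF this, of "real m + \<delta>"] show ?thesis
      using md by (simp add: mult.assoc)
  qed
  also have "\<dots> \<le> 3 * total i"
    using total_ge_linear[of i] by simp
  finally have "3 / (3 * total i) \<le> 3 / (2 * t * (real m + \<delta>))"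
    using total_pos[of i] md by (intro divide_left_mono mult_pos_pos) (auto simp: t)
  then have "1 / total i \<le> 3 / (2 * (real m + \<delta>)) * (1 / t)"
    by (simp add: mult_ac)
  then have "1 / total i * exp (gain i u) \<le>
      3 / (2 * (real m + \<delta>)) * (1 / t) * (exp corr * (t powr (1 - x) * real u powr (x - 1)))"
    using md total_pos[of i] by (intro mult_mono e) (auto simp: t)
  also have "\<dots> = 3 / (2 * (real m + \<delta>)) * exp corr * ((1 / t * t powr (1 - x)) * real u powr (x - 1))"
    by simp
  also have "1 / t * t powr (1 - x) = t powr - x"
  proof -
    have "t powr - x = t powr (- 1 + (1 - x))"
      by simp
    also have "\<dots> = t powr - 1 * t powr (1 - x)"
      by (rule powr_add)
    also have "t powr - 1 = 1 / t"
      by (simp add: powr_minus t divide_inverse)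
    finally show ?thesis
      by simp
  qed
  finally show "1 / total i * exp (gain i u) \<le>
      3 / (2 * (real m + \<delta>)) * exp corr * (real (node i) powr - x * real u powr (x - 1))"
    by (simp add: t_def)
qed

text \<open>Bounding the number of edges by \<open>K\<close> makes the constant independent of
  \<open>I\<close> and \<tau>: both \<open>b\<close> and \<open>C1\<close> are at least 1, so their
  \<open>K\<close>-th powers dominate the lower ones. An illegal target makes the event
  empty.\<close>

lemma prob_prescribed_targets_le:
  assumes "x \<le> 1 - rate"
  shows "\<exists>C\<ge>0. \<forall>I \<tau>. finite I \<longrightarrow> card I \<le> K \<longrightarrow>
    prob {\<omega> \<in> space M. \<forall>i\<in>I. target i \<omega> = \<tau> i} \<le> C * (\<Prod>i\<in>I. real (node i) powr - x * real (\<tau> i) powr (x - 1))"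
proof -
  obtain C where C: "C > 0" "\<And>i u. u \<in> legal i \<Longrightarrow>
    1 / total i * exp (gain i u) \<le> C * (real (node i) powr - x * real u powr (x - 1))"
    using attachment_factor_le[OF assms] by blast
  define C1 where "C1 = max 1 C"
  \<comment> \<open>Bounds every factor of a rising factorial of \<open>m + \<delta>\<close> of
    length at most \<open>K\<close>.\<close>
  define b where "b = real m + \<delta> + real K + 1"
  have b: "b \<ge> 1"
    using delta_gt by (simp add: b_def)
  show ?thesis
  proof (intro exI[of _ "b ^ K * C1 ^ K"] conjI allI impI)
    show "0 \<le> b ^ K * C1 ^ K"
      using b by (simp add: C1_def)
    fix I :: "nat set" and \<tau> :: "nat \<Rightarrow> nat" assume I: "finite I" "card I \<le> K"
    let ?f = "\<lambda>i. real (node i) powr - x * real (\<tau> i) powr (x - 1)"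
    let ?g = "\<lambda>i. 1 / total i * exp (gain i (\<tau> i))"
    show "prob {\<omega> \<in> space M. \<forall>i\<in>I. target i \<omega> = \<tau> i} \<le> b ^ K * C1 ^ K * (\<Prod>i\<in>I. ?f i)"
    proof (cases "\<forall>i\<in>I. \<tau> i \<in> legal i")
      case False
      then obtain i where i: "i \<in> I" "\<tau> i \<notin> legal i"
        by blast
      have "target i \<omega> \<noteq> \<tau> i" if "\<omega> \<in> space M" for \<omega>
        using target_legal[OF that, of i] i(2) by auto
      then have "{\<omega> \<in> space M. \<forall>i\<in>I. target i \<omega> = \<tau> i} = {}"
        using i(1) by blast
      then show ?thesis
        using b by (simp only: measure_empty) (auto intro!: mult_nonneg_nonneg prod_nonneg simp: C1_def)
    next
      case True
      obtain N where N: "I \<subseteq> {..<N}"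
        using I(1) finite_nat_iff_bounded by blast
      have "(\<Prod>u\<in>\<tau> ` I. pochhammer (real m + \<delta>) (card {i \<in> I. \<tau> i = u})) \<le> (\<Prod>u\<in>\<tau> ` I. b ^ card {i \<in> I. \<tau> i = u})"
      proof (rule prod_mono, intro conjI)
        fix u assume "u \<in> \<tau> ` I"
        show "0 \<le> pochhammer (real m + \<delta>) (card {i \<in> I. \<tau> i = u})"
          using delta_gt by (intro pochhammer_nonneg) simp
        have "card {i \<in> I. \<tau> i = u} \<le> K"
          using card_mono[of I "{i \<in> I. \<tau> i = u}"] I by auto
        then have "pochhammer (real m + \<delta>) (card {i \<in> I. \<tau> i = u}) \<le> (\<Prod>i = 0..<card {i \<in> I. \<tau> i = u}. b)"
          unfolding pochhammer_prod using delta_gt by (intro prod_mono) (auto simp: b_def)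
        then show "pochhammer (real m + \<delta>) (card {i \<in> I. \<tau> i = u}) \<le> b ^ card {i \<in> I. \<tau> i = u}"
          by simp
      qed
      also have "\<dots> = b ^ (\<Sum>u\<in>\<tau> ` I. card {i \<in> I. \<tau> i = u})"
        by (simp add: power_sum)
      also have "(\<Sum>u\<in>\<tau> ` I. card {i \<in> I. \<tau> i = u}) = card I"
        using sum.image_gen[OF I(1), of "\<lambda>_. 1::nat" \<tau>] by simp
      also have "b ^ card I \<le> b ^ K"
        using b I by (intro power_increasing)
      finally have 1: "(\<Prod>u\<in>\<tau> ` I. pochhammer (real m + \<delta>) (card {i \<in> I. \<tau> i = u})) \<le> b ^ K" .
      have "(\<Prod>i\<in>I. ?g i) \<le> (\<Prod>i\<in>I. C1 * ?f i)"
      proof (rule prod_mono, intro conjI)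
        fix i assume "i \<in> I"
        show "0 \<le> ?g i"
          using total_pos[of i] by simp
        have "?g i \<le> C * ?f i"
          using True \<open>i \<in> I\<close> by (intro C(2)) auto
        also have "\<dots> \<le> C1 * ?f i"
          by (intro mult_right_mono) (auto simp: C1_def)
        finally show "?g i \<le> C1 * ?f i" .
      qed
      also have "\<dots> = C1 ^ card I * (\<Prod>i\<in>I. ?f i)"
        by (simp add: prod.distrib)
      also have "\<dots> \<le> C1 ^ K * (\<Prod>i\<in>I. ?f i)"
        using I by (intro mult_right_mono power_increasing prod_nonneg) (auto simp: C1_def)
      finally have 2: "(\<Prod>i\<in>I. ?g i) \<le> C1 ^ K * (\<Prod>i\<in>I. ?f i)" .
      have "0 \<le> (\<Prod>i\<in>I. ?g i)"
        using total_pos by (intro prod_nonneg) (simp add: less_imp_le)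
      then have "prob {\<omega> \<in> space M. \<forall>i\<in>I. target i \<omega> = \<tau> i} \<le> b ^ K * (C1 ^ K * (\<Prod>i\<in>I. ?f i))"
        using b by (intro order.trans[OF prob_prescribed_targets[OF N] mult_mono[OF 1 2]]) auto
      then show ?thesis
        by simp
    qed
  qed
qed

end

section \<open>Homology of the links\<close>

context preferential_attachment
begin

definition adj :: "'w \<Rightarrow> nat \<Rightarrow> nat \<Rightarrow> bool" where
  "adj \<omega> = adjacent (pa_graph_infinite m (\<lambda>s \<beta>. E s \<beta> \<omega>))"

lemma pa_graph_infinite_eq:
  "pa_graph_infinite m (\<lambda>s \<beta>. E s \<beta> \<omega>) = base_graph \<union> range (\<lambda>i. (node i, slot i, target i \<omega>))"
proof -
  have ge2: "{2::nat..} = range (\<lambda>k. 2 + k)"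
    by (force simp: image_iff le_iff_add)
  have "i < Suc i * m" for i
    using m_pos by (cases m) auto
  then have "(\<Union>k. {..<k * m}) = UNIV"
    by blast
  then have "(\<Union>k. (\<lambda>i. (node i, slot i, target i \<omega>)) ` {..<k * m}) = range (\<lambda>i. (node i, slot i, target i \<omega>))"
    by (simp only: image_UN[symmetric])
  then show ?thesis
    unfolding pa_graph_infinite_def ge2 image_image pa_graph_steps target_def[symmetric] UN_Un_distrib
    by simp
qed

text \<open>Edges point to older nodes, so only those sent by \<open>s\<close> count; the edges from
  2 to 1 are the only ones outside the urn process.\<close>

lemma adj_older:
  assumes "\<omega> \<in> space M" "u < s"
  shows "adj \<omega> s u \<longleftrightarrow> (s = 2 \<and> u = 1) \<or> (\<exists>i. node i = s \<and> target i \<omega> = u)"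
proof -
  let ?G = "base_graph \<union> range (\<lambda>i. (node i, slot i, target i \<omega>))"
  have lt: "target i \<omega> < node i" for i
    using target_legal[OF assms(1), of i] by (auto simp: legal_def node_def)
  have "(u, \<beta>, s) \<notin> ?G" for \<beta>
  proof
    assume "(u, \<beta>, s) \<in> ?G"
    then consider "u = 2" "s = 1" | i where "u = node i" "s = target i \<omega>"
      by (auto simp: base_graph_def)
    then show False
      using assms(2) lt by cases (auto dest: less_asym)
  qed
  moreover have "(2, 1, 1) \<in> ?G"
    using m_pos by (auto simp: base_graph_def)
  then have "(\<exists>\<beta>. (s, \<beta>, u) \<in> ?G) \<longleftrightarrow> (s = 2 \<and> u = 1) \<or> (\<exists>i. node i = s \<and> target i \<omega> = u)"
    by (auto simp: base_graph_def)
  ultimately show ?thesis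
    unfolding adj_def adjacent_def pa_graph_infinite_eq by blast
qed

lemma symp_adj: "symp (adj \<omega>)"
  unfolding adj_def by (rule symp_adjacent)

lemma node_steps: "finite {i. node i = s}" "card {i. node i = s} \<le> m"
proof -
  have sub: "{i. node i = s} \<subseteq> {(s - 3) * m..<(s - 3) * m + m}"
  proof
    fix i assume "i \<in> {i. node i = s}"
    then have "i div m = s - 3"
      by (auto simp: node_def)
    then show "i \<in> {(s - 3) * m..<(s - 3) * m + m}"
      using m_pos by (metis atLeastLessThan_iff div_mult_mod_eq le_add1 mod_less_divisor nat_add_left_cancel_less)
  qed
  then show "finite {i. node i = s}"
    by (rule finite_subset) simp
  show "card {i. node i = s} \<le> m"
    using card_mono[OF _ sub] by simp
qed

lemma card_older_neighbours:
  assumes "\<omega> \<in> space M"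
  shows "card {u. u < s \<and> adj \<omega> s u} \<le> m"
proof (cases "s = 2")
  case True
  have "{u. u < s \<and> adj \<omega> s u} \<subseteq> {1}"
    using adj_older[OF assms, of _ s] True by (auto simp: node_def)
  then have "card {u. u < s \<and> adj \<omega> s u} \<le> card {1::nat}"
    by (intro card_mono) auto
  then show ?thesis
    using m_pos by simp
next
  case False
  have "{u. u < s \<and> adj \<omega> s u} \<subseteq> (\<lambda>i. target i \<omega>) ` {i. node i = s}"
    using adj_older[OF assms, of _ s] False by auto
  then have "card {u. u < s \<and> adj \<omega> s u} \<le> card ((\<lambda>i. target i \<omega>) ` {i. node i = s})"
    using node_steps by (intro card_mono) auto
  also have "\<dots> \<le> m"
    using card_image_le[OF node_steps(1)] node_steps(2) le_trans by blast
  finally show ?thesis .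
qed

section \<open>Cores of links and their encoding by steps\<close>

text \<open>A core of the link of node \<open>T\<close> on the vertex set \<open>W\<close>, encoded by the steps (edges) sent by
  \<open>T\<close> and by \<open>W\<close>: \<open>\<tau> i = 0\<close> stands for a target outside \<open>W\<close>. The nodes 1 and 2 are exceptional
  because the edges between them do not belong to any step.\<close>

definition core_steps :: "nat \<Rightarrow> nat set \<Rightarrow> nat set" where
  "core_steps T W = {i. node i \<in> insert T W}"

definition core_degree :: "nat \<Rightarrow> nat set \<Rightarrow> (nat \<Rightarrow> nat) \<Rightarrow> nat \<Rightarrow> nat" where
  "core_degree T W \<tau> w = card {i \<in> core_steps T W. \<tau> i \<in> W \<and> node i \<in> W \<and> (node i = w \<or> \<tau> i = w)}"

text \<open>Degree 2 is what a core guarantees for \<open>n \<ge> 2\<close>. Node 1 is exempt since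
  powers of 1 equal 1 anyway, and node 2 may lose its neighbour 1.\<close>

definition core_patterns :: "nat \<Rightarrow> nat set \<Rightarrow> (nat \<Rightarrow> nat) set" where
  "core_patterns T W = {\<tau> \<in> core_steps T W \<rightarrow>\<^sub>E insert 0 W.
     (\<forall>w\<in>W. \<exists>i\<in>core_steps T W. node i = T \<and> \<tau> i = w) \<and>
     (\<forall>w\<in>W. w = 1 \<or> (if w = 2 then 1 else 2) \<le> core_degree T W \<tau> w)}"

text \<open>Only the edges into \<open>W\<close> are prescribed and the others are left free, which
  gives an event that \<open>prob_prescribed_targets_le\<close> estimates.\<close>

definition core_event :: "nat \<Rightarrow> nat set \<Rightarrow> (nat \<Rightarrow> nat) \<Rightarrow> 'w set" where
  "core_event T W \<tau> = {\<omega> \<in> space M. \<forall>i\<in>{i \<in> core_steps T W. \<tau> i \<in> W}. target i \<omega> = \<tau> i}"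

lemma core_steps_bound:
  assumes "finite W" "card W \<le> m"
  shows "finite (core_steps T W)" "card (core_steps T W) \<le> (m + 1) * m"
proof -
  have eq: "core_steps T W = (\<Union>s\<in>insert T W. {i. node i = s})"
    by (auto simp: core_steps_def)
  then show "finite (core_steps T W)"
    using assms node_steps by auto
  have "card (core_steps T W) \<le> (\<Sum>s\<in>insert T W. card {i. node i = s})"
    unfolding eq using assms by (intro card_UN_le) auto
  also have "\<dots> \<le> (\<Sum>s\<in>insert T W. m)"
    by (intro sum_mono node_steps)
  also have "\<dots> = card (insert T W) * m"
    by simp
  also have "\<dots> \<le> (m + 1) * m"
    using assms card_insert_if[of W T] by (intro mult_le_mono1) auto
  finally show "card (core_steps T W) \<le> (m + 1) * m" .
qed

text \<open>The bound depends on \<open>m\<close> alone, uniformly in \<open>T\<close> and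
  \<open>W\<close>, so the union bound over patterns costs a constant factor.\<close>

lemma card_core_patterns:
  assumes "finite W" "card W \<le> m"
  shows "finite (core_patterns T W)" "card (core_patterns T W) \<le> (m + 1) ^ ((m + 1) * m)"
proof -
  let ?P = "core_steps T W \<rightarrow>\<^sub>E insert 0 W"
  have fin: "finite ?P"
    using assms core_steps_bound by (intro finite_PiE) auto
  have sub: "core_patterns T W \<subseteq> ?P"
    by (auto simp: core_patterns_def)
  then show "finite (core_patterns T W)"
    using fin finite_subset by blast
  have "card (core_patterns T W) \<le> card ?P"
    by (intro card_mono fin sub)
  also have "\<dots> = card (insert 0 W) ^ card (core_steps T W)"
    using core_steps_bound(1)[OF assms] by (simp add: card_PiE)
  also have "\<dots> \<le> (m + 1) ^ card (core_steps T W)"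
    using assms by (intro power_mono) (auto simp: card_insert_if)
  also have "\<dots> \<le> (m + 1) ^ ((m + 1) * m)"
    by (intro power_increasing core_steps_bound(2)[OF assms]) auto
  finally show "card (core_patterns T W) \<le> (m + 1) ^ ((m + 1) * m)" .
qed

lemma core_event_measurable:
  assumes "finite W" "card W \<le> m"
  shows "core_event T W \<tau> \<in> events"
  unfolding core_event_def using core_steps_bound(1)[OF assms] by measurable

lemma core_event_cover:
  assumes \<omega>: "\<omega> \<in> space M" and W: "W \<subseteq> nbhd (adj \<omega>) {1..T} T" and T: "T \<ge> 3"
    and deg: "\<And>w. w \<in> W \<Longrightarrow> card (nbhd (adj \<omega>) W w) \<ge> 2"
  shows "finite W \<and> W \<subseteq> {1..<T} \<and> card W \<le> m \<and> (\<exists>\<tau>\<in>core_patterns T W. \<omega> \<in> core_event T W \<tau>)"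
proof -
  have WT: "W \<subseteq> {1..<T}"
    using W by (auto simp: nbhd_def)
  then have fin: "finite W"
    using finite_subset by blast
  have "card W \<le> card {u. u < T \<and> adj \<omega> T u}"
    using W by (intro card_mono) (auto simp: nbhd_def)
  then have cm: "card W \<le> m"
    using card_older_neighbours[OF \<omega>, of T] by simp
  define \<tau> where "\<tau> = restrict (\<lambda>i. if target i \<omega> \<in> W then target i \<omega> else 0) (core_steps T W)"
  have \<tau>: "\<tau> i = u \<longleftrightarrow> target i \<omega> = u" if "i \<in> core_steps T W" "u \<in> W" for i u
    using that WT by (auto simp: \<tau>_def)
  have "\<tau> \<in> core_steps T W \<rightarrow>\<^sub>E insert 0 W"
    by (auto simp: \<tau>_def)
  moreover have "\<exists>i\<in>core_steps T W. node i = T \<and> \<tau> i = w" if w: "w \<in> W" for w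
  proof -
    have "adj \<omega> T w" "w < T"
      using w W by (auto simp: nbhd_def)
    then obtain i where "node i = T" "target i \<omega> = w"
      using adj_older[OF \<omega>, of w T] T by auto
    then show ?thesis
      using \<tau>[of i w] w by (intro bexI[of _ i]) (auto simp: core_steps_def)
  qed
  moreover have "w = 1 \<or> (if w = 2 then 1 else 2) \<le>
      core_degree T W \<tau> w" if w: "w \<in> W" for w
  proof (cases "w = 1")
    case False
    let ?D = "{i \<in> core_steps T W. \<tau> i \<in> W \<and> node i \<in> W \<and> (node i = w \<or> \<tau> i = w)}"
    \<comment> \<open>The adjacency of 2 and 1 does not come from a step, so it is not counted at
      node 2.\<close>
    define B where "B = nbhd (adj \<omega>) W w - (if w = 2 then {1} else {})"
    have "\<exists>i\<in>?D. {node i, \<tau> i} = {w, u}" if u: "u \<in> B" for u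
    proof -
      have uw: "u \<in> W" "u \<noteq> w" "adj \<omega> (max u w) (min u w)"
        using u symp_adj[of \<omega>] by (auto simp: B_def nbhd_def max_def min_def dest: sympD split: if_splits)
      moreover have "min u w < max u w" "\<not> (max u w = 2 \<and> min u w = 1)"
        using uw False u by (auto simp: B_def max_def min_def split: if_splits)
      ultimately obtain i where i: "node i = max u w" "target i \<omega> = min u w"
        using adj_older[OF \<omega>] by blast
      have mem: "max u w \<in> W" "min u w \<in> W"
        using uw w by (auto simp: max_def min_def)
      then have ic: "i \<in> core_steps T W"
        by (simp add: core_steps_def i)
      have "\<tau> i = min u w"
        using \<tau>[OF ic mem(2)] i(2) by simp
      then show ?thesis
        using ic mem i(1) by (intro bexI[of _ i]) (auto simp: max_def min_def)
    qed
    then have "\<forall>u\<in>B. \<exists>i. i \<in> ?D \<and> {node i, \<tau> i} = {w, u}"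
      by blast
    from bchoice[OF this] obtain g where g: "\<And>u. u \<in> B \<Longrightarrow> g u \<in> ?D \<and> {node (g u), \<tau> (g u)} = {w, u}"
      by blast
    \<comment> \<open>An edge has only two ends, so different neighbours of \<open>w\<close> use
      different steps.\<close>
    have "inj_on g B"
    proof (rule inj_onI)
      fix u v assume "u \<in> B" "v \<in> B" "g u = g v"
      then have "{w, u} = {w, v}"
        using g by metis
      then show "u = v"
        by (auto simp: doubleton_eq_iff)
    qed
    moreover have "finite ?D"
      using core_steps_bound(1)[OF fin cm] by simp
    ultimately have "card B \<le> card ?D"
      using g by (intro card_inj_on_le[of g]) auto
    moreover have "(if w = 2 then 1 else 2) \<le> card B"
      using deg[OF w] diff_card_le_card_Diff[of "{1}" "nbhd (adj \<omega>) W w"] by (auto simp: B_def)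
    ultimately show ?thesis
      unfolding core_degree_def by linarith
  qed simp
  ultimately have "\<tau> \<in> core_patterns T W"
    unfolding core_patterns_def by blast
  moreover have "\<omega> \<in> core_event T W \<tau>"
    using \<tau> \<omega> by (auto simp: core_event_def)
  ultimately show ?thesis
    using fin cm WT by blast
qed

text \<open>For \<open>x \<le> 1 / 2\<close> each vertex \<open>w\<close> of a core contributes at most \<open>w powr - (1 + x)\<close>: the edge
  from \<open>T\<close> gives \<open>w powr (x - 1)\<close> and each of at least two edges in \<open>W\<close> at most \<open>w powr - x\<close>. The
  sum over all \<open>W\<close> is then bounded by a convergent product. The factor 2 makes up for the missing
  edge at the node 2.\<close>

lemma core_pattern_weight:
  assumes x: "0 < x" "x \<le> 1 / 2" and "T > 0" and W: "W \<subseteq> {1..<T}" and \<tau>: "\<tau> \<in> core_patterns T W" and fin: "finite (core_steps T W)"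
  shows "(\<Prod>i\<in>{i \<in> core_steps T W. \<tau> i \<in> W}. real (node i) powr - x * real (\<tau> i) powr (x - 1)) \<le>
    2 * (real T powr (- x * card W) * (\<Prod>w\<in>W. real w powr - (1 + x)))"
proof -
  define f where "f i = real (node i) powr - x * real (\<tau> i) powr (x - 1)" for i
  define I1 where "I1 = {i \<in> core_steps T W. \<tau> i \<in> W \<and> node i = T}"
  define I2 where "I2 = {i \<in> core_steps T W. \<tau> i \<in> W \<and> node i \<in> W}"
  have fW: "finite W"
    using W finite_subset by blast
  have f1: "finite I1" "finite I2"
    using fin by (auto simp: I1_def I2_def)
  have W1: "w \<in> W \<Longrightarrow> real w \<ge> 1" for w
    using W by auto
  have pow1: "real w powr - y \<le> 1" if "real w \<ge> 1" "y \<ge> 0" for w y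
    using powr_mono[of "- y" 0 "real w"] that by simp
  have node1: "real (node i) \<ge> 1" for i
    by (simp add: node_def)
  have f_le: "0 \<le> f i \<and> f i \<le> 1" if "\<tau> i \<in> W" for i
    using pow1[OF node1, of x i] pow1[OF W1[OF that], of "1 - x"] x unfolding f_def by (auto intro!: mult_le_one)
  have "\<forall>w\<in>W. \<exists>i. i \<in> core_steps T W \<and> node i = T \<and> \<tau> i = w"
    using \<tau> by (auto simp: core_patterns_def)
  then obtain g where g: "\<And>w. w \<in> W \<Longrightarrow> g w \<in> core_steps T W \<and> node (g w) = T \<and> \<tau> (g w) = w"
    by metis
  have inj: "inj_on g W"
    using g by (metis inj_onI)
  have gI: "g ` W \<subseteq> I1"
    using g by (auto simp: I1_def)
  \<comment> \<open>One edge from \<open>T\<close> to each node of \<open>W\<close> is kept;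
    repeated ones contribute factors of at most 1.\<close>
  have "prod f I1 = prod f (g ` W) * prod f (I1 - g ` W)"
    using prod.subset_diff[OF gI f1(1), of f] by (simp add: mult.commute)
  also have "\<dots> \<le> prod f (g ` W) * 1"
    using f_le gI g by (intro mult_left_mono prod_le_1 prod_nonneg) (auto simp: I1_def)
  also have "prod f (g ` W) = (\<Prod>w\<in>W. real T powr - x * real w powr (x - 1))"
    using g by (simp add: prod.reindex[OF inj] f_def)
  finally have P1: "prod f I1 \<le> (\<Prod>w\<in>W. real T powr - x * real w powr (x - 1))"
    by simp
  define d where "d w = card {i \<in> I2. node i = w} + card {i \<in> I2. \<tau> i = w}" for w
  \<comment> \<open>Here \<open>x \<le> 1 / 2\<close> enters: by \<open>x - 1 \<le> - x\<close>,
    both ends of an inner edge may be given the exponent \<open>- x\<close>.\<close>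
  have "prod f I2 \<le> (\<Prod>i\<in>I2. real (node i) powr - x * real (\<tau> i) powr - x)"
    using x W1 unfolding f_def by (intro prod_mono) (auto simp: I2_def intro!: mult_left_mono powr_mono)
  also have "\<dots> = (\<Prod>w\<in>W. \<Prod>i\<in>{i \<in> I2. node i = w}. real (node i) powr - x) *
      (\<Prod>w\<in>W. \<Prod>i\<in>{i \<in> I2. \<tau> i = w}. real (\<tau> i) powr - x)"
    unfolding prod.distrib using f1 fW by (subst (1 2) prod.group) (auto simp: I2_def)
  also have "\<dots> = (\<Prod>w\<in>W. (real w powr - x) ^ d w)"
  proof -
    have "(\<Prod>i\<in>{i \<in> I2. node i = w}. real (node i) powr - x) = (\<Prod>i\<in>{i \<in> I2. node i = w}. real w powr - x)"
      "(\<Prod>i\<in>{i \<in> I2. \<tau> i = w}. real (\<tau> i) powr - x) = (\<Prod>i\<in>{i \<in> I2. \<tau> i = w}. real w powr - x)" for w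
      by (rule prod.cong; simp)+
    then show ?thesis
      unfolding d_def power_add prod.distrib by (simp only: prod_constant)
  qed
  also have "\<dots> \<le> (\<Prod>w\<in>W. (if w = 2 then 2 else 1) * real w powr (- 2 * x))"
  proof (rule prod_mono, intro conjI)
    fix w assume w: "w \<in> W"
    show "0 \<le> (real w powr - x) ^ d w"
      by simp
    have le1: "real w powr - x \<le> 1"
      using pow1[OF W1[OF w], of x] x by simp
    have sq: "(real w powr - x) ^ 2 = real w powr (- 2 * x)"
      by (simp add: power2_eq_square flip: powr_add)
    have "{i \<in> core_steps T W. \<tau> i \<in> W \<and> node i \<in> W \<and> (node i = w \<or> \<tau> i = w)} =
        {i \<in> I2. node i = w} \<union> {i \<in> I2. \<tau> i = w}"
      by (auto simp: I2_def)
    then have "core_degree T W \<tau> w \<le> d w"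
      unfolding d_def core_degree_def using card_Un_le by metis
    then consider "w = 1" | "w = 2" "1 \<le> d w" | "w \<noteq> 2" "2 \<le> d w"
      using \<tau> w unfolding core_patterns_def by (fastforce split: if_splits)
    then show "(real w powr - x) ^ d w \<le> (if w = 2 then 2 else 1) * real w powr (- 2 * x)"
    proof cases
      case 2
      have "(real w powr - x) ^ d w \<le> (real w powr - x) ^ 1"
        using 2 le1 by (intro power_decreasing) auto
      also have "\<dots> = 2 powr x * 2 powr (- 2 * x)"
        using 2 by (simp add: powr_add[symmetric])
      also have "\<dots> \<le> 2 powr 1 * 2 powr (- 2 * x)"
        using x by (intro mult_right_mono powr_mono) auto
      finally show ?thesis
        using 2 by simp
    next
      case 3
      have "(real w powr - x) ^ d w \<le> (real w powr - x) ^ 2"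
        using 3 le1 by (intro power_decreasing) auto
      then show ?thesis
        using 3 sq by simp
    qed simp
  qed
  also have "\<dots> = (\<Prod>w\<in>W. if w = 2 then 2 else 1) * (\<Prod>w\<in>W. real w powr (- 2 * x))"
    by (rule prod.distrib)
  also have "\<dots> \<le> 2 * (\<Prod>w\<in>W. real w powr (- 2 * x))"
    using fW by (intro mult_right_mono prod_nonneg) (auto simp: prod.delta)
  finally have P2: "prod f I2 \<le> 2 * (\<Prod>w\<in>W. real w powr (- 2 * x))" .
  have split: "{i \<in> core_steps T W. \<tau> i \<in> W} = I1 \<union> I2" "I1 \<inter> I2 = {}"
    using W by (auto simp: I1_def I2_def core_steps_def)
  have "prod f {i \<in> core_steps T W. \<tau> i \<in> W} = prod f I1 * prod f I2"
    unfolding split(1) by (rule prod.union_disjoint[OF f1 split(2)])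
  also have "\<dots> \<le> (\<Prod>w\<in>W. real T powr - x * real w powr (x - 1)) * (2 * (\<Prod>w\<in>W. real w powr (- 2 * x)))"
    using f_le by (intro mult_mono P1 P2 prod_nonneg) (auto simp: I2_def)
  also have "\<dots> = 2 * (\<Prod>w\<in>W. real T powr - x * (real w powr (x - 1) * real w powr (- 2 * x)))"
    by (simp add: prod.distrib)
  also have "\<dots> = 2 * (\<Prod>w\<in>W. real T powr - x * real w powr - (1 + x))"
    by (simp add: powr_add[symmetric] algebra_simps)
  also have "\<dots> = 2 * (real T powr (- x * card W) * (\<Prod>w\<in>W. real w powr - (1 + x)))"
    using \<open>T > 0\<close> by (simp add: prod.distrib powr_power mult.commute[of x])
  finally show ?thesis
    unfolding f_def .
qed

definition core_union :: "nat \<Rightarrow> nat \<Rightarrow> 'w set" where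
  "core_union n T = (\<Union>W\<in>{W. W \<subseteq> {1..<T} \<and> 2 * n \<le> card W \<and> card W \<le> m}. \<Union>\<tau>\<in>core_patterns T W. core_event T W \<tau>)"

lemma core_union_measurable: "core_union n T \<in> events"
proof -
  have "finite W" if "W \<subseteq> {1..<T}" for W
    using that finite_subset by blast
  then show ?thesis
    unfolding core_union_def
    by (intro sets.finite_UN core_event_measurable card_core_patterns)
      (auto intro: finite_subset[of _ "Pow {1..<T}"])
qed

lemma prob_core_union:
  assumes "n \<ge> 2" "2 * real n * (1 - rate) > 1"
  shows "summable (\<lambda>T. prob (core_union n T))"
proof -
  \<comment> \<open>If the minimum is \<open>1 / 2\<close>, then \<open>2 * n * x = n > 1\<close>,
    so the second hypothesis survives the lowering of \<open>x\<close>.\<close>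
  define x where "x = min (1 - rate) (1 / 2)"
  have x: "0 < x" "x \<le> 1 / 2" "x \<le> 1 - rate"
    using rate_less_1 by (auto simp: x_def min_def)
  have nx: "2 * real n * x > 1"
    using assms by (auto simp: x_def min_def)
  obtain C where C: "C \<ge> 0" "\<And>I \<tau>. finite I \<Longrightarrow> card I \<le> (m + 1) * m \<Longrightarrow>
    prob {\<omega> \<in> space M. \<forall>i\<in>I. target i \<omega> = \<tau> i} \<le> C * (\<Prod>i\<in>I. real (node i) powr - x * real (\<tau> i) powr (x - 1))"
    using prob_prescribed_targets_le[OF x(3), of "(m + 1) * m"] by blast
  define K where "K = real ((m + 1) ^ ((m + 1) * m)) * C * 2"
  define z where "z w = real w powr - (1 + x)" for w
  have z: "summable z"
    unfolding z_def summable_real_powr_iff using x by simp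
  have z0: "z w \<ge> 0" for w
    by (simp add: z_def)
  have "prob (core_union n T) \<le> K * exp (suminf z) * real T powr - (2 * real n * x)" if T: "T \<ge> 3" for T
  proof -
    define F where "F = {W. W \<subseteq> {1..<T} \<and> 2 * n \<le> card W \<and> card W \<le> m}"
    have finF: "finite F"
      unfolding F_def by (rule finite_subset[of _ "Pow {1..<T}"]) auto
    have WF: "finite W" "card W \<le> m" "W \<subseteq> {1..<T}" "2 * n \<le> card W" if "W \<in> F" for W
      using that finite_subset[of W "{1..<T}"] by (auto simp: F_def)
    let ?c = "\<lambda>W. C * (2 * (real T powr - (2 * real n * x) * (\<Prod>w\<in>W. z w)))"
    let ?K = "real ((m + 1) ^ ((m + 1) * m))"
    have ev: "prob (core_event T W \<tau>) \<le> ?c W"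
      if W: "W \<in> F" and \<tau>: "\<tau> \<in> core_patterns T W" for W \<tau>
    proof -
      note b = core_steps_bound[OF WF(1,2)[OF W], of T]
      have "card {i \<in> core_steps T W. \<tau> i \<in> W} \<le> card (core_steps T W)"
        using b by (intro card_mono) auto
      then have "prob (core_event T W \<tau>) \<le>
          C * (\<Prod>i\<in>{i \<in> core_steps T W. \<tau> i \<in> W}. real (node i) powr - x * real (\<tau> i) powr (x - 1))"
        unfolding core_event_def using b by (intro C(2)) auto
      also have "\<dots> \<le> C * (2 * (real T powr (- x * card W) * (\<Prod>w\<in>W. z w)))"
        unfolding z_def using C(1) by (intro mult_left_mono core_pattern_weight x WF W \<tau> b) (use T in auto)
      also have "\<dots> \<le> ?c W"
      proof -
        have "2 * real n \<le> real (card W)"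
          using WF(4)[OF W] by linarith
        then have "2 * real n * x \<le> x * real (card W)"
          using x(1) by (simp add: mult.commute)
        then show ?thesis
          using C(1) T z0 by (intro mult_left_mono mult_right_mono powr_mono prod_nonneg) auto
      qed
      finally show ?thesis .
    qed
    have "prob (core_union n T) \<le> (\<Sum>W\<in>F. prob (\<Union>\<tau>\<in>core_patterns T W. core_event T W \<tau>))"
      unfolding core_union_def F_def[symmetric] using finF WF
      by (intro finite_measure_subadditive_finite)
        (auto intro!: sets.finite_UN core_event_measurable card_core_patterns)
    also have "\<dots> \<le> (\<Sum>W\<in>F. \<Sum>\<tau>\<in>core_patterns T W. prob (core_event T W \<tau>))"
      using WF by (intro sum_mono finite_measure_subadditive_finite)
        (auto intro!: core_event_measurable card_core_patterns)
    also have "\<dots> \<le> (\<Sum>W\<in>F. \<Sum>\<tau>\<in>core_patterns T W. ?c W)"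
      by (intro sum_mono ev)
    also have "\<dots> \<le> (\<Sum>W\<in>F. ?K * ?c W)"
    proof (rule sum_mono)
      fix W assume "W \<in> F"
      then have "real (card (core_patterns T W)) \<le> ?K"
        using card_core_patterns(2)[OF WF(1,2)] of_nat_le_iff by blast
      then show "(\<Sum>\<tau>\<in>core_patterns T W. ?c W) \<le>
          ?K * ?c W"
        unfolding sum_constant using C(1) z0 by (intro mult_right_mono) (auto intro!: mult_nonneg_nonneg prod_nonneg)
    qed
    also have "\<dots> = K * real T powr - (2 * real n * x) * (\<Sum>W\<in>F. \<Prod>w\<in>W. z w)"
      unfolding K_def sum_distrib_left by (intro sum.cong refl) (simp add: mult_ac)
    also have "\<dots> \<le> K * real T powr - (2 * real n * x) * exp (suminf z)"
    proof (rule mult_left_mono)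
      \<comment> \<open>Without the restriction on the size of \<open>W\<close>, the sum over
        subsets is an expanded product, to which \<open>1 + z w \<le> exp (z w)\<close>
        applies.\<close>
      have "(\<Sum>W\<in>F. \<Prod>w\<in>W. z w) \<le> (\<Sum>W\<in>Pow {1..<T}. \<Prod>w\<in>W. z w)"
        using z0 by (intro sum_mono2) (auto simp: F_def intro!: prod_nonneg)
      also have "\<dots> = (\<Prod>w\<in>{1..<T}. z w + 1)"
        by (subst prod_add) auto
      also have "\<dots> \<le> (\<Prod>w\<in>{1..<T}. exp (z w))"
        using z0 by (intro prod_mono) (auto simp: add.commute[of _ 1] add_nonneg_nonneg)
      also have "\<dots> = exp (\<Sum>w\<in>{1..<T}. z w)"
        by (simp add: exp_sum)
      also have "\<dots> \<le> exp (suminf z)"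
        using sum_le_suminf[OF z, of "{1..<T}"] z0 by simp
      finally show "(\<Sum>W\<in>F. \<Prod>w\<in>W. z w) \<le> exp (suminf z)" .
      show "0 \<le> K * real T powr - (2 * real n * x)"
        using C(1) by (simp add: K_def)
    qed
    finally show ?thesis
      by (simp add: mult_ac)
  qed
  then have "\<exists>N. \<forall>T\<ge>N. norm (prob (core_union n T)) \<le> K * exp (suminf z) * real T powr - (2 * real n * x)"
    by (intro exI[of _ 3]) simp
  then show ?thesis
    by (rule summable_comparison_test) (use nx in \<open>intro summable_mult; simp add: summable_real_powr_iff\<close>)
qed

lemma AE_links_no_homology:
  assumes "n \<ge> 2" "2 * real n * (1 - rate) > 1"
  shows "AE \<omega> in M. \<exists>T0. \<forall>T>T0. no_homology TYPE('f::field) (adj \<omega>) (nbhd (adj \<omega>) {1..T} T) n"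
proof -
  have "AE \<omega> in M. eventually (\<lambda>T. \<omega> \<in> space M - core_union n T) sequentially"
    by (rule borel_cantelli_AE1)
      (auto intro: core_union_measurable prob_core_union[OF assms] simp: emeasure_eq_measure)
  then show ?thesis
  proof (rule AE_mp, intro AE_I2 impI)
    fix \<omega> assume \<omega>: "\<omega> \<in> space M" and "eventually (\<lambda>T. \<omega> \<in> space M - core_union n T) sequentially"
    then obtain T0 where T0: "\<And>T. T \<ge> T0 \<Longrightarrow> \<omega> \<notin> core_union n T"
      by (auto simp: eventually_sequentially)
    show "\<exists>T0. \<forall>T>T0. no_homology TYPE('f) (adj \<omega>) (nbhd (adj \<omega>) {1..T} T) n"
    proof (intro exI[of _ "max T0 3"] allI impI, rule ccontr)
      fix T assume T: "max T0 3 < T"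
      let ?V = "nbhd (adj \<omega>) {1..T} T"
      assume nh: "\<not> no_homology TYPE('f) (adj \<omega>) ?V n"
      have fin: "finite ?V"
        by (simp add: nbhd_def)
      have "\<exists>W\<subseteq>?V. 2 * n \<le> card W \<and> (\<forall>w\<in>W. 2 * (n - 1) \<le> card (nbhd (adj \<omega>) W w))"
        by (rule homology_core[OF symp_adj fin nh]) (intro exI conjI ballI; assumption)
      then obtain W where W: "W \<subseteq> ?V" "2 * n \<le> card W"
          "\<And>w. w \<in> W \<Longrightarrow> 2 * (n - 1) \<le> card (nbhd (adj \<omega>) W w)"
        by blast
      \<comment> \<open>This is where \<open>n \<ge> 2\<close> enters; for \<open>n = 1\<close> a
        core might have no inner edges.\<close>
      have "card (nbhd (adj \<omega>) W w) \<ge> 2" if "w \<in> W" for w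
        using W(3)[OF that] assms(1) by simp
      then have "finite W \<and> W \<subseteq> {1..<T} \<and> card W \<le> m \<and> (\<exists>\<tau>\<in>core_patterns T W. \<omega> \<in> core_event T W \<tau>)"
        using T by (intro core_event_cover[OF \<omega> W(1)]) auto
      then have "\<omega> \<in> core_union n T"
        using W(2) unfolding core_union_def by blast
      then show False
        using T0[of T] T by simp
    qed
  qed
qed

end

section \<open>Degrees of fixed nodes\<close>

context preferential_attachment
begin

lemma step_weight:
  assumes h: "h \<in> hists n"
  shows "step n (\<lambda>h. weight h v) h \<le> weight h v * exp (1 / total n)"
proof -
  have "step n (\<lambda>h. weight h v) h =
      (\<Sum>u\<in>legal n. weight h u * (weight h v / total n) + (if u = v then weight h v / total n else 0))"
    unfolding step_def by (intro sum.cong refl) (auto simp: weight_append add_divide_distrib distrib_left)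
  also have "\<dots> = weight h v + (if v \<in> legal n then weight h v / total n else 0)"
    unfolding sum.distrib sum_distrib_right[symmetric] sum_weight[OF h] using total_pos[of n] by simp
  also have "\<dots> \<le> weight h v * (1 + 1 / total n)"
    using total_pos[of n] weight_pos[of h v] by (auto simp: field_simps)
  also have "\<dots> \<le> weight h v * exp (1 / total n)"
    using weight_pos[of h v] by (intro mult_left_mono exp_ge_add_one_self) auto
  finally show ?thesis .
qed

lemma hist_exp_weight:
  "hist_exp (k * m) (\<lambda>h. weight h v) \<le> (real m + \<delta>) * exp corr * (real k + 2) powr rate"
proof -
  have "hist_exp n (\<lambda>h. weight h v) \<le> (real m + \<delta>) * exp (\<Sum>j<n. 1 / total j)" for n
  proof (induction n)
    case (Suc n)
    have "hist_exp (Suc n) (\<lambda>h. weight h v) \<le> hist_exp n (\<lambda>h. exp (1 / total n) * weight h v)"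
      unfolding hist_exp_Suc by (intro hist_exp_mono order.trans[OF step_weight]) (auto simp: mult.commute)
    also have "\<dots> \<le> exp (1 / total n) * ((real m + \<delta>) * exp (\<Sum>j<n. 1 / total j))"
      unfolding hist_exp_cmult by (intro mult_left_mono Suc.IH) auto
    finally show ?case
      by (simp add: exp_add mult_ac)
  qed (simp add: hist_exp_0 weight_def)
  then have "hist_exp (k * m) (\<lambda>h. weight h v) \<le> (real m + \<delta>) * exp (\<Sum>j<k * m. 1 / total j)" .
  also have "\<dots> \<le> (real m + \<delta>) * exp (rate * ln (real k + 2) + corr)"
  proof -
    have "(\<Sum>j<k * m. 1 / total j) \<le> rate * (ln (real k + 2) - ln 2) + corr"
      using sum_inverse_total_upper[of 0 k] by (simp add: lessThan_atLeast0)
    also have "\<dots> \<le> rate * ln (real k + 2) + corr"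
      using rate_pos by (simp add: algebra_simps)
    finally show ?thesis
      using delta_gt by (intro mult_left_mono) auto
  qed
  also have "\<dots> = (real m + \<delta>) * exp corr * (real k + 2) powr rate"
    by (simp add: powr_def exp_add mult_ac)
  finally show ?thesis .
qed

section \<open>Lower tails of the degrees\<close>

text \<open>The analogue of a rising factorial with negative exponent \<open>- s\<close>: its expectation decays like
  the power \<open>- s\<close> of the typical degree, so Markov's inequality bounds the probability of a small
  degree.\<close>

definition decay :: "real \<Rightarrow> nat \<Rightarrow> real" where
  "decay s c = (\<Prod>j<c. 1 - s / (real m + \<delta> + real j))"

text \<open>Any positive exponent would serve in Markov's inequality. A value of at most half the
  least weight \<open>m + \<delta>\<close> keeps the factors of \<open>decay\<close> at least
  \<open>1 / 2\<close>, and a value of at most 1 permits Bernoulli's inequality.\<close>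

definition decay_exp :: real where
  "decay_exp = min (1 / 2) ((real m + \<delta>) / 2)"

lemma decay_exp: "0 < decay_exp" "decay_exp \<le> 1" "2 * decay_exp \<le> real m + \<delta>"
  using delta_gt by (auto simp: decay_exp_def min_def)

lemma decay_factor: "1 / 2 \<le> 1 - decay_exp / (real m + \<delta> + real j)"
proof -
  have "2 * decay_exp \<le> real m + \<delta> + real j"
    using decay_exp(3) by simp
  then show ?thesis
    using delta_gt by (simp add: field_simps)
qed

lemma decay_nonneg: "decay decay_exp c \<ge> 0"
  unfolding decay_def using decay_factor by (intro prod_nonneg) (metis le_numeral_extra(3) order.trans zero_le_divide_1_iff zero_le_numeral)

text \<open>Bernoulli's inequality \<open>(1 - 1 / y) powr s \<le> 1 - s / y\<close> turns the
  product into a telescoping one. The factor at 0 is bounded by \<open>1 / 2\<close> instead,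
  because there \<open>y = m + \<delta>\<close> may be less than 1.\<close>

lemma decay_lower_Suc: "decay decay_exp (Suc c) \<ge> 1 / 2 * ((real m + \<delta>) / (real m + \<delta> + real c)) powr decay_exp"
proof (induction c)
  case 0
  then show ?case
    using decay_factor[of 0] delta_gt by (simp add: decay_def)
next
  case (Suc c)
  let ?a = "real m + \<delta>" and ?s = decay_exp
  have a: "?a > 0"
    using delta_gt by simp
  define y where "y = ?a + real (Suc c)"
  have y: "y > 1"
    using a by (simp add: y_def)
  \<comment> \<open>Weighted geometric and arithmetic mean of \<open>1 - 1 / y\<close> and 1, with
    weights \<open>?s\<close> and \<open>1 - ?s\<close>.\<close>
  have "(1 - 1 / y) powr ?s * 1 powr (1 - ?s) \<le> ?s * (1 - 1 / y) + (1 - ?s) * 1"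
    using y decay_exp by (intro Youngs_inequality_0) auto
  then have bern: "(1 - 1 / y) powr ?s \<le> 1 - ?s / y"
    by (simp add: algebra_simps)
  have "1 / 2 * (?a / y) powr ?s = 1 / 2 * (?a / (?a + real c)) powr ?s * (1 - 1 / y) powr ?s"
  proof -
    have "?a + real c = y - 1"
      by (simp add: y_def)
    then have "1 - 1 / y = (?a + real c) / y"
      using y by (simp add: diff_divide_distrib)
    moreover have "?a + real c > 0"
      using a by simp
    ultimately have "?a / y = ?a / (?a + real c) * (1 - 1 / y)"
      by simp
    moreover have "(?a / (?a + real c) * (1 - 1 / y)) powr ?s = (?a / (?a + real c)) powr ?s * (1 - 1 / y) powr ?s"
      by (rule powr_mult)
    ultimately show ?thesis
      by simp
  qed
  also have "\<dots> \<le> decay ?s (Suc c) * (1 - ?s / y)"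
    using Suc.IH bern decay_nonneg by (intro mult_mono) auto
  also have "\<dots> = decay ?s (Suc (Suc c))"
    by (simp add: decay_def y_def)
  finally show ?case
    by (simp add: y_def)
qed

lemma decay_lower: "decay decay_exp c \<ge> 1 / 2 * ((real m + \<delta>) / (real m + \<delta> + real c)) powr decay_exp"
proof (cases c)
  case 0
  then show ?thesis
    using delta_gt by (simp add: decay_def)
next
  case (Suc b)
  have "((real m + \<delta>) / (real m + \<delta> + real c)) powr decay_exp \<le> ((real m + \<delta>) / (real m + \<delta> + real b)) powr decay_exp"
    using delta_gt decay_exp Suc by (intro powr_mono2 divide_left_mono) auto
  then show ?thesis
    using decay_lower_Suc[of b] Suc by simp
qed

text \<open>A draw of \<open>v\<close> multiplies \<open>decay\<close> by
  \<open>1 - s / weight\<close> and has probability \<open>weight / total\<close>, so the weight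
  cancels and the expected factor \<open>1 - s / total\<close> is deterministic.\<close>

lemma step_decay:
  assumes h: "h \<in> hists n"
  shows "step n (\<lambda>h. decay decay_exp (count_list h v)) h \<le>
    decay decay_exp (count_list h v) * (if v \<in> legal n then exp (- decay_exp / total n) else 1)"
proof -
  let ?d = "decay decay_exp (count_list h v)"
  have D: "decay decay_exp (Suc (count_list h v)) = ?d * (1 - decay_exp / weight h v)"
    by (simp add: decay_def weight_def)
  have "step n (\<lambda>h. decay decay_exp (count_list h v)) h =
      (\<Sum>u\<in>legal n. weight h u * (?d / total n) - (if u = v then decay_exp * ?d / total n else 0))"
    unfolding step_def
  proof (intro sum.cong refl)
    fix u
    show "weight h u / total n * decay decay_exp (count_list (h @ [u]) v) =
        weight h u * (?d / total n) - (if u = v then decay_exp * ?d / total n else 0)"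
      using weight_pos[of h v] by (auto simp: D right_diff_distrib diff_divide_distrib)
  qed
  also have "\<dots> = ?d * (if v \<in> legal n then 1 + - decay_exp / total n else 1)"
    unfolding sum_subtractf sum_distrib_right[symmetric] sum_weight[OF h] using total_pos[of n]
    by (simp add: algebra_simps)
  also have "\<dots> \<le> ?d * (if v \<in> legal n then exp (- decay_exp / total n) else 1)"
    using decay_nonneg exp_ge_add_one_self[of "- decay_exp / total n"] by (intro mult_left_mono) auto
  finally show ?thesis .
qed

lemma hist_exp_decay:
  assumes "v \<ge> 1" "k \<ge> v"
  shows "hist_exp (k * m) (\<lambda>h. decay decay_exp (count_list h v)) \<le>
    ((real k + 2) / (real v + 2)) powr (- decay_exp * rate)"
proof -
  have ind: "hist_exp n (\<lambda>h. decay decay_exp (count_list h v)) \<le>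
      exp (- decay_exp * gain n v)" for n
  proof (induction n)
    case (Suc n)
    let ?e = "if v \<in> legal n then exp (- decay_exp / total n) else 1"
    have "hist_exp (Suc n) (\<lambda>h. decay decay_exp (count_list h v)) \<le>
        hist_exp n (\<lambda>h. ?e * decay decay_exp (count_list h v))"
      unfolding hist_exp_Suc by (intro hist_exp_mono order.trans[OF step_decay]) (auto simp: mult.commute)
    also have "\<dots> \<le> ?e * exp (- decay_exp * gain n v)"
      unfolding hist_exp_cmult by (intro mult_left_mono Suc.IH) auto
    also have "\<dots> = exp (- decay_exp * gain (Suc n) v)"
    proof -
      have "{j. j < Suc n \<and> v \<in> legal j} = {j. j < n \<and> v \<in> legal j} \<union> (if v \<in> legal n then {n} else {})"
        by (auto simp: less_Suc_eq)
      then show ?thesis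
        by (simp add: gain_def exp_add[symmetric] algebra_simps)
    qed
    finally show ?case .
  qed (simp add: hist_exp_0 decay_def gain_def)
  \<comment> \<open>Only the blocks from \<open>v\<close> on are counted, in all of which
    \<open>v\<close> is a possible target.\<close>
  have "rate * (ln (real k + 2) - ln (real v + 2)) \<le> (\<Sum>j\<in>{v * m..<k * m}. 1 / total j)"
    by (rule sum_inverse_total_lower[OF assms(2)])
  also have "\<dots> \<le> gain (k * m) v"
    unfolding gain_def
  proof (rule sum_mono2)
    show "{v * m..<k * m} \<subseteq> {j. j < k * m \<and> v \<in> legal j}"
    proof
      fix j assume j: "j \<in> {v * m..<k * m}"
      then have "v \<le> j div m"
        using m_pos by (simp add: less_eq_div_iff_mult_less_eq)
      then show "j \<in> {j. j < k * m \<and> v \<in> legal j}"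
        using j assms(1) by (simp add: legal_def)
    qed
  qed (auto simp: less_imp_le[OF total_pos])
  finally have "- decay_exp * gain (k * m) v \<le>
      - decay_exp * (rate * (ln (real k + 2) - ln (real v + 2)))"
    using decay_exp(1) by simp
  also have "\<dots> = (- decay_exp * rate) * ln ((real k + 2) / (real v + 2))"
    by (simp add: ln_div)
  finally have "exp (- decay_exp * gain (k * m) v) \<le>
      exp ((- decay_exp * rate) * ln ((real k + 2) / (real v + 2)))"
    by simp
  also have "\<dots> = ((real k + 2) / (real v + 2)) powr (- decay_exp * rate)"
    by (simp add: powr_def)
  finally show ?thesis
    using ind[of "k * m"] by linarith
qed

text \<open>A small weight makes \<open>decay\<close> large, so the lower tail follows from Markov's
  inequality. The bound is uniform in \<open>k\<close>, but for each \<open>k\<close>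
  separately.\<close>

lemma prob_weight_small:
  assumes "v \<ge> 1" "\<eta> > 0"
  shows "\<exists>\<epsilon>>0. \<forall>k\<ge>v. prob {\<omega> \<in> space M. weight (hist (k * m) \<omega>) v < \<epsilon> * (real k + 2) powr rate} \<le> \<eta>"
proof -
  let ?a = "real m + \<delta>" and ?s = decay_exp
  have a: "?a > 0"
    using delta_gt by simp
  define L where "L = (real v + 2) powr (?s * rate)"
  have L: "L > 0"
    by (simp add: L_def)
  \<comment> \<open>Solved from the requirement that the final Markov bound equal \<eta>; the 2
    comes from the factor \<open>1 / 2\<close> in \<open>decay_lower\<close>.\<close>
  define \<epsilon> where "\<epsilon> = ?a * (\<eta> / (2 * L)) powr (1 / ?s)"
  have \<epsilon>: "\<epsilon> > 0" "(\<epsilon> / ?a) powr ?s = \<eta> / (2 * L)"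
    using a L assms(2) decay_exp by (simp_all add: \<epsilon>_def powr_powr)
  show ?thesis
  proof (intro exI[of _ \<epsilon>] conjI allI impI \<epsilon>)
    fix k assume k: "v \<le> k"
    define Y where "Y = \<epsilon> * (real k + 2) powr rate"
    have Y: "Y > 0"
      using \<epsilon> by (simp add: Y_def)
    define b where "b = 1 / 2 * (?a / Y) powr ?s"
    have b: "b > 0"
      using a Y by (simp add: b_def)
    have imp: "decay ?s (count_list h v) \<ge> b" if "weight h v < Y" for h
    proof -
      have "(?a / Y) powr ?s \<le> (?a / (?a + real (count_list h v))) powr ?s"
        using that a Y decay_exp by (intro powr_mono2 divide_left_mono mult_pos_pos) (auto simp: weight_def)
      then show ?thesis
        using decay_lower[of "count_list h v"] by (simp add: b_def)
    qed
    have "prob {\<omega> \<in> space M. weight (hist (k * m) \<omega>) v < Y} \<le>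
        prob {\<omega> \<in> space M. b \<le> decay ?s (count_list (hist (k * m) \<omega>) v)}"
      using imp by (intro finite_measure_mono) (auto intro: hist_pred_event)
    also have "\<dots> \<le> hist_exp (k * m) (\<lambda>h. decay ?s (count_list h v)) / b"
      by (intro hist_markov decay_nonneg b)
    also have "\<dots> \<le> ((real k + 2) / (real v + 2)) powr (- ?s * rate) / b"
      using b by (intro divide_right_mono hist_exp_decay assms k) auto
    also have "\<dots> = \<eta>"
    proof -
      have "Y / ?a = \<epsilon> / ?a * (real k + 2) powr rate"
        by (simp add: Y_def)
      then have "(Y / ?a) powr ?s = (\<epsilon> / ?a) powr ?s * ((real k + 2) powr rate) powr ?s"
        by (simp only: powr_mult)
      then have "(Y / ?a) powr ?s = (\<epsilon> / ?a) powr ?s * (real k + 2) powr (?s * rate)"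
        by (simp add: powr_powr mult.commute)
      moreover have "(?a / Y) powr ?s = 1 / (Y / ?a) powr ?s"
        using a Y by (simp add: powr_divide)
      ultimately have "b = 1 / 2 * (1 / (\<eta> / (2 * L) * (real k + 2) powr (?s * rate)))"
        by (simp add: b_def \<epsilon>(2))
      also have "\<dots> = L / (\<eta> * (real k + 2) powr (?s * rate))"
        by simp
      finally have b': "b = L / (\<eta> * (real k + 2) powr (?s * rate))" .
      have "((real k + 2) / (real v + 2)) powr (- ?s * rate) = L / (real k + 2) powr (?s * rate)"
        by (simp add: powr_divide powr_minus L_def field_simps)
      then show ?thesis
        unfolding b' using L assms(2) by (simp add: field_simps)
    qed
    finally show "prob {\<omega> \<in> space M. weight (hist (k * m) \<omega>) v < \<epsilon> * (real k + 2) powr rate} \<le> \<eta>"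
      by (simp add: Y_def)
  qed
qed

text \<open>The expected count is at most of order \<open>k powr rate\<close>, which is of smaller
  order than \<open>k\<close>. The added \<open>2 + m\<close> is that of \<open>card_near\<close>:
  at most half of the existing nodes will have to be avoided.\<close>

lemma prob_count_large:
  assumes "\<eta> > 0"
  shows "\<exists>K. \<forall>k\<ge>K. prob {\<omega> \<in> space M. \<not> real (2 + m + count_list (hist (k * m) \<omega>) v) \<le> (real k + 2) / 2} \<le> \<eta>"
proof -
  define C where "C = (real m + \<delta>) * exp corr"
  have "((\<lambda>k. C * (real k + 2) powr rate + (2 + real m)) \<in> o(\<lambda>k. real k + 2))"
  proof -
    have "(\<lambda>k. (real k + 2) powr rate) \<in> o(\<lambda>k. real k + 2)"
      using rate_less_1 by real_asymp
    moreover have "(\<lambda>k. 2 + real m) \<in> o(\<lambda>k. real k + 2)"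
      by real_asymp
    ultimately have "(\<lambda>k. C * (real k + 2) powr rate) \<in> o(\<lambda>k. real k + 2)" "(\<lambda>k. 2 + real m) \<in> o(\<lambda>k. real k + 2)"
      by auto
    then show ?thesis
      by (rule sum_in_smallo(1))
  qed
  then have "eventually (\<lambda>k. norm (C * (real k + 2) powr rate + (2 + real m)) \<le> \<eta> / 2 * norm (real k + 2)) sequentially"
    using assms by (intro landau_o.smallD) auto
  then obtain K where bound: "\<forall>k\<ge>K. norm (C * (real k + 2) powr rate + (2 + real m)) \<le> \<eta> / 2 * norm (real k + 2)"
    unfolding eventually_sequentially by blast
  have K: "C * (real k + 2) powr rate + (2 + real m) \<le> \<eta> / 2 * (real k + 2)" if "k \<ge> K" for k
  proof -
    have "norm (C * (real k + 2) powr rate + (2 + real m)) \<le> \<eta> / 2 * norm (real k + 2)"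
      using bound that by blast
    moreover have "norm (real k + 2) = real k + 2"
      by simp
    ultimately show ?thesis
      unfolding real_norm_def by (metis abs_ge_self order.trans)
  qed
  show ?thesis
  proof (intro exI[of _ K] allI impI)
    fix k assume k: "K \<le> k"
    have "prob {\<omega> \<in> space M. \<not> real (2 + m + count_list (hist (k * m) \<omega>) v) \<le> (real k + 2) / 2} \<le>
        prob {\<omega> \<in> space M. (real k + 2) / 2 \<le> weight (hist (k * m) \<omega>) v + (2 + real m)}"
      using delta_gt by (intro finite_measure_mono hist_pred_event) (auto simp: weight_def)
    also have "\<dots> \<le> hist_exp (k * m) (\<lambda>h. weight h v + (2 + real m)) / ((real k + 2) / 2)"
      using weight_pos by (intro hist_markov) (auto simp: add_nonneg_nonneg less_imp_le)
    also have "hist_exp (k * m) (\<lambda>h. weight h v + (2 + real m)) = hist_exp (k * m) (\<lambda>h. weight h v) + (2 + real m)"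
      using hist_exp_take[of 0 "k * m" "\<lambda>_. 2 + real m"] by (simp add: hist_exp_add hist_exp_0)
    also have "\<dots> / ((real k + 2) / 2) \<le> (\<eta> / 2 * (real k + 2)) / ((real k + 2) / 2)"
      using hist_exp_weight[of k v] K[OF k] by (intro divide_right_mono) (auto simp: C_def)
    also have "\<dots> = \<eta>"
      by (simp add: field_simps)
    finally show "prob {\<omega> \<in> space M. \<not> real (2 + m + count_list (hist (k * m) \<omega>) v) \<le> (real k + 2) / 2} \<le> \<eta>" .
  qed
qed

end

section \<open>Attachment to a fixed set of nodes\<close>

context preferential_attachment
begin

text \<open>Including the nodes 1 and 2 accounts for the edges sent by node 2, which are not in \<open>h\<close>.\<close>

definition near :: "nat list \<Rightarrow> nat \<Rightarrow> nat set" where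
  "near h v = {1, 2} \<union> {h ! i | i. i < length h \<and> node i = v} \<union> {node i | i. i < length h \<and> h ! i = v}"

text \<open>The first \<open>length vs\<close> edges of node \<open>k + 3\<close> go to the nodes \<open>vs\<close> in this order, and its
  other edges, up to the \<open>r\<close>-th, avoid the neighbours of \<open>v\<close>.\<close>

definition attaches :: "nat list \<Rightarrow> nat \<Rightarrow> nat \<Rightarrow> nat list \<Rightarrow> nat \<Rightarrow> bool" where
  "attaches vs v k h r \<longleftrightarrow> (\<forall>j<r. if j < length vs then h ! (k * m + j) = vs ! j
     else h ! (k * m + j) \<notin> near (take (k * m) h) v)"

definition sparse :: "nat \<Rightarrow> nat \<Rightarrow> nat list \<Rightarrow> bool" where
  "sparse v k h \<longleftrightarrow> real (2 + m + count_list h v) \<le> (real k + 2) / 2"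

definition denom :: "nat \<Rightarrow> real" where
  "denom k = (real k + 2) * (2 * real m + \<delta>)"

text \<open>At least half of the \<open>k + 2\<close> existing nodes are allowed, each of weight at
  least \<open>m + \<delta>\<close>, and the total is at most \<open>denom k\<close>.\<close>

definition avoid_prob :: real where
  "avoid_prob = (real m + \<delta>) / (2 * (2 * real m + \<delta>))"

text \<open>Evaluated at the history before the block, which makes it predictable: within the block
  the weights only grow and the total does not exceed \<open>denom k\<close>. It bounds the
  conditional success probability of slot \<open>j\<close> from below.\<close>

definition slot_prob :: "nat list \<Rightarrow> nat \<Rightarrow> nat \<Rightarrow> nat list \<Rightarrow> nat \<Rightarrow> real" where
  "slot_prob vs v k h j = of_bool (sparse v k h) *
     (if j < length vs then weight h (vs ! j) / denom k else avoid_prob)"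

lemma denom_pos: "denom k > 0"
  using delta_gt m_pos by (simp add: denom_def)

lemma avoid_prob: "0 < avoid_prob" "avoid_prob \<le> 1"
  using delta_gt m_pos by (auto simp: avoid_prob_def field_simps)

lemma slot_prob_nonneg: "slot_prob vs v k h j \<ge> 0"
  using weight_pos[of h "vs ! j"] denom_pos[of k] avoid_prob by (simp add: slot_prob_def less_imp_le)

lemma total_block_le: "r < m \<Longrightarrow> total (k * m + r) \<le> denom k"
  using total_le[of "k * m + r"] by (simp add: denom_def)

lemma card_near:
  shows "finite (near h v)" "card (near h v) \<le> 2 + m + count_list h v"
proof -
  let ?A = "{h ! i | i. i < length h \<and> node i = v}" and ?B = "{node i | i. i < length h \<and> h ! i = v}"
  have A: "?A = (!) h ` {i. i < length h \<and> node i = v}" and B: "?B = node ` {i. i < length h \<and> h ! i = v}"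
    by auto
  have fA: "finite ?A" and fB: "finite ?B"
    unfolding A B by auto
  then show "finite (near h v)"
    by (simp add: near_def)
  have "card ?A \<le> card {i. i < length h \<and> node i = v}"
    unfolding A by (intro card_image_le) auto
  also have "\<dots> \<le> card {i. node i = v}"
    using node_steps(1) by (intro card_mono) auto
  finally have cA: "card ?A \<le> m"
    using node_steps(2) le_trans by blast
  have cB: "card ?B \<le> count_list h v"
    unfolding B count_list_eq_card by (intro card_image_le) auto
  have "card (near h v) \<le> card ({1, 2} \<union> ?A) + card ?B"
    unfolding near_def by (rule card_Un_le)
  moreover have "card ({1, 2} \<union> ?A) \<le> card {1::nat, 2} + card ?A"
    by (rule card_Un_le)
  ultimately show "card (near h v) \<le> 2 + m + count_list h v"
    using cA cB by simp
qed

lemma weight_take: "weight (take k h) v \<le> weight h v"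
proof -
  have "count_list h v = count_list (take k h) v + count_list (drop k h) v"
    by (metis append_take_drop_id count_list_append)
  then show ?thesis
    by (simp add: weight_def)
qed

lemma slot_prob_le:
  assumes h: "h \<in> hists (k * m + r)" and r: "r < m" and vs: "\<And>u. u \<in> set vs \<Longrightarrow> 1 \<le> u \<and> u \<le> 2 + k"
  shows "slot_prob vs v k (take (k * m) h) r \<le> (\<Sum>u\<in>legal (k * m + r). weight h u / total (k * m + r) *
     of_bool (if r < length vs then u = vs ! r else u \<notin> near (take (k * m) h) v))"
    (is "_ \<le> (\<Sum>u\<in>_. ?f u)")
proof -
  let ?n = "k * m + r" and ?h = "take (k * m) h"
  have f_nonneg: "?f u \<ge> 0" for u
    using weight_pos[of h u] total_pos[of ?n] by (simp add: less_imp_le)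
  have legal: "legal ?n = {1..2 + k}"
    using r by (simp add: legal_def)
  show ?thesis
  proof (cases "sparse v k ?h")
    case False
    then show ?thesis
      using f_nonneg by (simp add: slot_prob_def sum_nonneg)
  next
    case sparse: True
    show ?thesis
    proof (cases "r < length vs")
      case True
      have "slot_prob vs v k ?h r = weight ?h (vs ! r) / denom k"
        using True sparse by (simp add: slot_prob_def)
      also have "\<dots> \<le> weight h (vs ! r) / total ?n"
        using weight_take total_block_le[OF r] total_pos weight_pos by (intro frac_le) (auto simp: less_imp_le)
      also have "\<dots> = ?f (vs ! r)"
        using True by simp
      also have "\<dots> \<le> (\<Sum>u\<in>legal ?n. ?f u)"
        using f_nonneg vs[of "vs ! r"] True legal by (intro member_le_sum) auto
      finally show ?thesis .
    next
      case False
      have "real (card (near ?h v)) \<le> (real k + 2) / 2"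
        using card_near(2)[of ?h v] sparse unfolding sparse_def by linarith
      moreover have "real (card (legal ?n)) - real (card (near ?h v)) \<le> real (card (legal ?n - near ?h v))"
        using diff_card_le_card_Diff[OF card_near(1), of "legal ?n" ?h v] by linarith
      ultimately have c: "(real k + 2) / 2 \<le> real (card (legal ?n - near ?h v))"
        by (simp add: legal)
      have "slot_prob vs v k ?h r = avoid_prob"
        using False sparse by (simp add: slot_prob_def)
      also have "\<dots> = (real k + 2) / 2 * ((real m + \<delta>) / denom k)"
        using delta_gt m_pos by (simp add: avoid_prob_def denom_def)
      also have "\<dots> \<le> real (card (legal ?n - near ?h v)) * ((real m + \<delta>) / denom k)"
        using c delta_gt denom_pos[of k] by (intro mult_right_mono) auto
      also have "\<dots> = (\<Sum>u\<in>legal ?n - near ?h v. (real m + \<delta>) / denom k)"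
        by simp
      also have "\<dots> \<le> (\<Sum>u\<in>legal ?n - near ?h v. ?f u)"
      proof (rule sum_mono)
        fix u assume u: "u \<in> legal ?n - near ?h v"
        have "(real m + \<delta>) / denom k \<le> weight h u / total ?n"
          using total_block_le[OF r] total_pos delta_gt by (intro frac_le) (auto simp: weight_def)
        then show "(real m + \<delta>) / denom k \<le> ?f u"
          using False u by simp
      qed
      also have "\<dots> \<le> (\<Sum>u\<in>legal ?n. ?f u)"
        using f_nonneg by (intro sum_mono2) auto
      finally show ?thesis .
    qed
  qed
qed

text \<open>A lower bound for a conditional probability in integrated form: \<phi> is an arbitrary
  nonnegative function of the past. In the induction \<phi> absorbs the factor of the last
  slot.\<close>

lemma attaches_prob_ge:
  assumes vs: "\<And>u. u \<in> set vs \<Longrightarrow> 1 \<le> u \<and> u \<le> 2 + k" and r: "r \<le> m" and \<phi>: "\<And>h. \<phi> h \<ge> 0"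
  shows "hist_exp (k * m) (\<lambda>h. \<phi> h * (\<Prod>j<r. slot_prob vs v k h j)) \<le>
    hist_exp (k * m + r) (\<lambda>h. \<phi> (take (k * m) h) * of_bool (attaches vs v k h r))"
  using r \<phi>
proof (induction r arbitrary: \<phi>)
  case 0
  have "hist_exp (k * m) (\<lambda>h. \<phi> h) = hist_exp (k * m) (\<lambda>h. \<phi> (take (k * m) h))"
    by (rule hist_exp_take[OF order.refl, symmetric])
  then show ?case
    by (simp add: attaches_def)
next
  case (Suc r)
  let ?n = "k * m + r" and ?t = "take (k * m)"
  have r: "r < m"
    using Suc.prems by simp
  have "hist_exp (k * m) (\<lambda>h. \<phi> h * (\<Prod>j<Suc r. slot_prob vs v k h j)) =
      hist_exp (k * m) (\<lambda>h. \<phi> h * slot_prob vs v k h r * (\<Prod>j<r. slot_prob vs v k h j))"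
    by (simp add: mult_ac)
  also have "\<dots> \<le> hist_exp ?n (\<lambda>h. \<phi> (?t h) * slot_prob vs v k (?t h) r * of_bool (attaches vs v k h r))"
    using Suc.prems r slot_prob_nonneg by (intro Suc.IH) auto
  also have "\<dots> \<le> hist_exp ?n (step ?n (\<lambda>h. \<phi> (?t h) * of_bool (attaches vs v k h (Suc r))))"
  proof (rule hist_exp_mono)
    fix h assume h: "h \<in> hists ?n"
    then have len: "length h = k * m + r"
      by (simp add: hists_def)
    have att: "attaches vs v k (h @ [u]) (Suc r) \<longleftrightarrow> attaches vs v k h r \<and>
        (if r < length vs then u = vs ! r else u \<notin> near (?t h) v)" for u
    proof -
      have "attaches vs v k (h @ [u]) r \<longleftrightarrow> attaches vs v k h r"
        unfolding attaches_def using len by (intro all_cong) (simp add: nth_append)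
      moreover have "attaches vs v k (h @ [u]) (Suc r) \<longleftrightarrow> attaches vs v k (h @ [u]) r \<and>
          (if r < length vs then (h @ [u]) ! (k * m + r) = vs ! r
           else (h @ [u]) ! (k * m + r) \<notin> near (take (k * m) (h @ [u])) v)"
        unfolding attaches_def All_less_Suc by (rule conj_commute)
      ultimately show ?thesis
        using len by (simp add: nth_append)
    qed
    have "\<phi> (?t h) * slot_prob vs v k (?t h) r * of_bool (attaches vs v k h r) \<le>
        \<phi> (?t h) * of_bool (attaches vs v k h r) * (\<Sum>u\<in>legal ?n. weight h u / total ?n *
          of_bool (if r < length vs then u = vs ! r else u \<notin> near (?t h) v))"
      using mult_left_mono[OF slot_prob_le[OF h r vs, of vs v], of "\<phi> (?t h) * of_bool (attaches vs v k h r)"] Suc.prems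
      by (simp add: mult_ac)
    also have "\<dots> = step ?n (\<lambda>h. \<phi> (?t h) * of_bool (attaches vs v k h (Suc r))) h"
      unfolding step_def sum_distrib_left att using len by (intro sum.cong refl) (simp add: of_bool_conj mult_ac)
    finally show "\<phi> (?t h) * slot_prob vs v k (?t h) r * of_bool (attaches vs v k h r) \<le>
        step ?n (\<lambda>h. \<phi> (?t h) * of_bool (attaches vs v k h (Suc r))) h" .
  qed
  also have "\<dots> = hist_exp (k * m + Suc r) (\<lambda>h. \<phi> (?t h) * of_bool (attaches vs v k h (Suc r)))"
    by (simp add: hist_exp_Suc)
  finally show ?case .
qed

definition block_prob :: "nat list \<Rightarrow> nat \<Rightarrow> nat \<Rightarrow> nat list \<Rightarrow> real" where
  "block_prob vs v k h = (\<Prod>j<m. slot_prob vs v k h j)"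

lemma block_prob_nonneg: "block_prob vs v k h \<ge> 0"
  by (simp add: block_prob_def prod_nonneg slot_prob_nonneg)

text \<open>Since \<open>(1 - p) * exp p \<le> 1\<close>, weighting the event of no success by the exponential of the
  accumulated conditional success probabilities gives a supermartingale.\<close>

lemma no_success_exp:
  assumes vs: "\<And>u. u \<in> set vs \<Longrightarrow> 1 \<le> u \<and> u \<le> 2 + K" and "K \<le> N"
  shows "hist_exp (N * m) (\<lambda>h. of_bool (\<forall>k\<in>{K..<N}. \<not> attaches vs v k (take (Suc k * m) h) m) *
    exp (\<Sum>k\<in>{K..<N}. block_prob vs v k (take (k * m) h))) \<le> 1"
  using assms(2)
proof (induction N rule: dec_induct)
  case base
  show ?case
    using hist_exp_take[of 0 "K * m" "\<lambda>_. 1"] by (simp add: hist_exp_0)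
next
  case (step N)
  define z where "z h = of_bool (\<forall>k\<in>{K..<N}. \<not> attaches vs v k (take (Suc k * m) h) m) *
    exp (\<Sum>k\<in>{K..<N}. block_prob vs v k (take (k * m) h))" for h
  define p where "p h = block_prob vs v N h" for h
  define \<phi> where "\<phi> h = z h * exp (p h)" for h
  have z_nonneg: "z h \<ge> 0" for h
    by (simp add: z_def)
  have \<phi>_nonneg: "\<phi> h \<ge> 0" for h
    by (simp add: \<phi>_def z_nonneg)
  have "hist_exp (Suc N * m) (\<lambda>h. of_bool (\<forall>k\<in>{K..<Suc N}. \<not> attaches vs v k (take (Suc k * m) h) m) *
      exp (\<Sum>k\<in>{K..<Suc N}. block_prob vs v k (take (k * m) h))) =
      hist_exp (N * m + m) (\<lambda>h. \<phi> (take (N * m) h) - \<phi> (take (N * m) h) * of_bool (attaches vs v N h m))"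
  proof -
    have eq: "of_bool (\<forall>k\<in>{K..<Suc N}. \<not> attaches vs v k (take (Suc k * m) h) m) *
        exp (\<Sum>k\<in>{K..<Suc N}. block_prob vs v k (take (k * m) h)) =
        \<phi> (take (N * m) h) - \<phi> (take (N * m) h) * of_bool (attaches vs v N h m)"
      if h: "h \<in> hists (N * m + m)" for h
    proof -
      have t1: "take (Suc k * m) (take (N * m) h) = take (Suc k * m) h"
        and t2: "take (k * m) (take (N * m) h) = take (k * m) h" if "k \<in> {K..<N}" for k
        using that mult_le_mono1[of "Suc k" N m] mult_le_mono1[of k N m] by (auto simp: min_absorb1)
      have t3: "take (Suc N * m) h = h"
        using h by (simp add: hists_def)
      have sum_eq: "(\<Sum>k\<in>{K..<N}. block_prob vs v k (take (k * m) (take (N * m) h))) =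
          (\<Sum>k\<in>{K..<N}. block_prob vs v k (take (k * m) h))"
        by (intro sum.cong refl) (simp only: t2)
      have fail_eq: "(\<forall>k\<in>{K..<N}. \<not> attaches vs v k (take (Suc k * m) (take (N * m) h)) m) \<longleftrightarrow>
          (\<forall>k\<in>{K..<N}. \<not> attaches vs v k (take (Suc k * m) h) m)"
        by (intro ball_cong refl) (simp only: t1)
      have "{K..<Suc N} = insert N {K..<N}"
        using step.hyps by auto
      then have "of_bool (\<forall>k\<in>{K..<Suc N}. \<not> attaches vs v k (take (Suc k * m) h) m) *
          exp (\<Sum>k\<in>{K..<Suc N}. block_prob vs v k (take (k * m) h)) =
          of_bool (\<not> attaches vs v N h m \<and> (\<forall>k\<in>{K..<N}. \<not> attaches vs v k (take (Suc k * m) h) m)) *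
          exp (block_prob vs v N (take (N * m) h) + (\<Sum>k\<in>{K..<N}. block_prob vs v k (take (k * m) h)))"
        using t3 by simp
      then show ?thesis
        unfolding \<phi>_def z_def p_def sum_eq fail_eq by (simp add: exp_add)
    qed
    have block: "Suc N * m = N * m + m"
      by simp
    show ?thesis
      unfolding block by (rule hist_exp_cong) (rule eq)
  qed
  also have "\<dots> = hist_exp (N * m) \<phi> - hist_exp (N * m + m) (\<lambda>h. \<phi> (take (N * m) h) * of_bool (attaches vs v N h m))"
    unfolding hist_exp_diff using hist_exp_take[of "N * m" "N * m + m" \<phi>] by simp
  also have "\<dots> \<le> hist_exp (N * m) \<phi> - hist_exp (N * m) (\<lambda>h. \<phi> h * p h)"
  proof -
    have "1 \<le> u \<and> u \<le> 2 + N" if "u \<in> set vs" for u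
      using vs[OF that] step.hyps by auto
    from attaches_prob_ge[OF this order.refl \<phi>_nonneg, where v = v] show ?thesis
      by (simp add: p_def block_prob_def)
  qed
  also have "\<dots> = hist_exp (N * m) (\<lambda>h. z h * ((1 - p h) * exp (p h)))"
    unfolding hist_exp_diff[symmetric] by (simp add: \<phi>_def algebra_simps)
  also have "\<dots> \<le> hist_exp (N * m) z"
  proof (rule hist_exp_mono)
    fix h
    have "(1 - p h) * exp (p h) \<le> exp (- p h) * exp (p h)"
      using exp_ge_add_one_self[of "- p h"] by (intro mult_right_mono) auto
    also have "\<dots> = 1"
      by (simp add: exp_add[symmetric])
    finally show "z h * ((1 - p h) * exp (p h)) \<le> z h"
      using mult_left_mono[of _ 1 "z h"] z_nonneg by fastforce
  qed
  also have "\<dots> \<le> 1"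
    using step.IH unfolding z_def .
  finally show ?case .
qed

text \<open>A quantitative conditional Borel-Cantelli lemma: where the accumulated probabilities
  reach \<open>b\<close>, the supermartingale of \<open>no_success_exp\<close> is at least
  \<open>exp b\<close> times the indicator of failure.\<close>

lemma prob_no_success:
  assumes vs: "\<And>u. u \<in> set vs \<Longrightarrow> 1 \<le> u \<and> u \<le> 2 + K" and "K \<le> N"
  shows "prob {\<omega> \<in> space M. \<forall>k\<in>{K..<N}. \<not> attaches vs v k (hist (Suc k * m) \<omega>) m} \<le>
    exp (- b) + prob {\<omega> \<in> space M. (\<Sum>k\<in>{K..<N}. block_prob vs v k (hist (k * m) \<omega>)) < b}"
proof -
  define S where "S h = (\<Sum>k\<in>{K..<N}. block_prob vs v k (take (k * m) h))" for h
  define fail where "fail h \<longleftrightarrow> (\<forall>k\<in>{K..<N}. \<not> attaches vs v k (take (Suc k * m) h) m)" for h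
  have t: "take (Suc k * m) (hist (N * m) \<omega>) = hist (Suc k * m) \<omega>"
    "take (k * m) (hist (N * m) \<omega>) = hist (k * m) \<omega>" if "k \<in> {K..<N}" for k \<omega>
    using that by (intro take_hist mult_le_mono1; simp)+
  have "{\<omega> \<in> space M. \<forall>k\<in>{K..<N}. \<not> attaches vs v k (hist (Suc k * m) \<omega>) m} =
      {\<omega> \<in> space M. fail (hist (N * m) \<omega>)}"
    unfolding fail_def using t by (auto simp del: mult_Suc)
  then have "prob {\<omega> \<in> space M. \<forall>k\<in>{K..<N}. \<not> attaches vs v k (hist (Suc k * m) \<omega>) m} =
      hist_exp (N * m) (\<lambda>h. of_bool (fail h))"
    by (simp only: prob_hist)
  also have "\<dots> \<le> hist_exp (N * m) (\<lambda>h. exp (- b) * (of_bool (fail h) * exp (S h)) + of_bool (S h < b))"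
  proof (rule hist_exp_mono)
    fix h
    have "S h \<ge> b \<Longrightarrow> 1 \<le> exp (- b) * exp (S h)"
      by (simp add: exp_add[symmetric])
    then show "of_bool (fail h) \<le> exp (- b) * (of_bool (fail h) * exp (S h)) + of_bool (S h < b)"
      by (cases "S h < b") auto
  qed
  also have "\<dots> = exp (- b) * hist_exp (N * m) (\<lambda>h. of_bool (fail h) * exp (S h)) + hist_exp (N * m) (\<lambda>h. of_bool (S h < b))"
    by (simp only: hist_exp_add hist_exp_cmult)
  also have "\<dots> \<le> exp (- b) * 1 + hist_exp (N * m) (\<lambda>h. of_bool (S h < b))"
    unfolding fail_def S_def by (intro add_right_mono mult_left_mono no_success_exp assms) auto
  also have "hist_exp (N * m) (\<lambda>h. of_bool (S h < b)) = prob {\<omega> \<in> space M. S (hist (N * m) \<omega>) < b}"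
    by (rule prob_hist[symmetric])
  also have "{\<omega> \<in> space M. S (hist (N * m) \<omega>) < b} =
      {\<omega> \<in> space M. (\<Sum>k\<in>{K..<N}. block_prob vs v k (hist (k * m) \<omega>)) < b}"
  proof -
    have "S (hist (N * m) \<omega>) = (\<Sum>k\<in>{K..<N}. block_prob vs v k (hist (k * m) \<omega>))" for \<omega>
      unfolding S_def by (intro sum.cong refl) (simp only: t(2))
    then show ?thesis
      by simp
  qed
  finally show ?thesis
    by simp
qed

end

section \<open>Infinitely many attachments to a fixed set\<close>

context preferential_attachment
begin

lemma hist_exp_sum: "hist_exp n (\<lambda>h. \<Sum>k\<in>A. f k h) = (\<Sum>k\<in>A. hist_exp n (f k))"
  unfolding hist_exp_def sum_distrib_left by (rule sum.swap)

definition thick :: "real \<Rightarrow> nat list \<Rightarrow> nat \<Rightarrow> nat \<Rightarrow> nat list \<Rightarrow> bool" where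
  "thick \<epsilon> vs v k h \<longleftrightarrow> sparse v k h \<and> (\<forall>u\<in>set vs. \<epsilon> * (real k + 2) powr rate \<le> weight h u)"

text \<open>A prescribed edge has probability at least of order \<open>k powr (rate - 1)\<close>,
  any other slot a constant one. By \<open>length vs * (1 - rate) \<le> 1\<close> the product is at
  least of order \<open>1 / k\<close>, whose sum diverges.\<close>

lemma block_prob_lower:
  assumes L: "length vs \<le> m" "real (length vs) * (1 - rate) \<le> 1" and \<epsilon>: "\<epsilon> > 0"
  shows "\<exists>c>0. \<forall>k h. thick \<epsilon> vs v k h \<longrightarrow> c / (real k + 2) \<le> block_prob vs v k h"
proof -
  let ?L = "length vs" and ?\<kappa> = "2 * real m + \<delta>"
  have \<kappa>: "?\<kappa> > 0"
    using m_pos delta_gt by simp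
  define c where "c = (\<epsilon> / ?\<kappa>) ^ ?L * avoid_prob ^ (m - ?L)"
  show ?thesis
  proof (intro exI[of _ c] conjI allI impI)
    show "c > 0"
      using \<epsilon> \<kappa> avoid_prob by (simp add: c_def)
    fix k h assume t: "thick \<epsilon> vs v k h"
    define b where "b = real k + 2"
    have b: "b \<ge> 2"
      by (simp add: b_def)
    define \<beta> where "\<beta> = \<epsilon> / ?\<kappa> * b powr (rate - 1)"
    have \<beta>: "\<beta> \<ge> 0"
      using \<epsilon> \<kappa> by (simp add: \<beta>_def)
    have "c / b = (\<epsilon> / ?\<kappa>) ^ ?L * b powr - 1 * avoid_prob ^ (m - ?L)"
      using b by (simp add: c_def powr_minus_divide)
    also have "\<dots> \<le> (\<epsilon> / ?\<kappa>) ^ ?L * b powr ((rate - 1) * real ?L) * avoid_prob ^ (m - ?L)"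
      using b L \<epsilon> \<kappa> avoid_prob by (intro mult_right_mono mult_left_mono powr_mono) (auto simp: algebra_simps)
    also have "b powr ((rate - 1) * real ?L) = (b powr (rate - 1)) ^ ?L"
      using b by (simp add: powr_powr[symmetric] powr_realpow)
    also have "(\<epsilon> / ?\<kappa>) ^ ?L * (b powr (rate - 1)) ^ ?L = \<beta> ^ ?L"
      by (simp only: \<beta>_def power_mult_distrib)
    also have "\<beta> ^ ?L * avoid_prob ^ (m - ?L) = (\<Prod>j<m. if j < ?L then \<beta> else avoid_prob)"
    proof -
      have "{..<m} \<inter> {j. j < ?L} = {..<?L}" "{..<m} \<inter> - {j. j < ?L} = {?L..<m}"
        using L by auto
      then show ?thesis
        by (simp add: prod.If_cases)
    qed
    also have "\<dots> \<le> block_prob vs v k h"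
      unfolding block_prob_def
    proof (rule prod_mono, intro conjI)
      fix j
      show "0 \<le> (if j < ?L then \<beta> else avoid_prob)"
        using \<beta> avoid_prob by simp
      have "\<beta> \<le> weight h (vs ! j) / denom k" if "j < ?L"
      proof -
        have "\<epsilon> * b powr rate \<le> weight h (vs ! j)"
          using t that by (auto simp: thick_def b_def)
        moreover have "b powr (rate - 1) = b powr rate / b"
          using b by (simp add: powr_diff)
        then have "\<beta> = \<epsilon> * b powr rate / denom k"
          by (simp add: \<beta>_def denom_def b_def)
        ultimately show ?thesis
          using denom_pos[of k] by (simp add: divide_right_mono)
      qed
      then show "(if j < ?L then \<beta> else avoid_prob) \<le> slot_prob vs v k h j"
        using t by (simp add: slot_prob_def thick_def)
    qed
    finally show "c / (real k + 2) \<le> block_prob vs v k h"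
      by (simp add: b_def)
  qed
qed

lemma prob_not_thick:
  assumes vs: "\<And>u. u \<in> set vs \<Longrightarrow> u \<ge> 1" and \<eta>: "\<eta> > 0"
  shows "\<exists>\<epsilon>>0. \<exists>K. \<forall>k\<ge>K. prob {\<omega> \<in> space M. \<not> thick \<epsilon> vs v k (hist (k * m) \<omega>)} \<le> \<eta>"
proof -
  define \<eta>' where "\<eta>' = \<eta> / (real (card (set vs)) + 1)"
  have \<eta>': "\<eta>' > 0"
    using \<eta> by (simp add: \<eta>'_def)
  let ?small = "\<lambda>\<epsilon> k u. {\<omega> \<in> space M. weight (hist (k * m) \<omega>) u < \<epsilon> * (real k + 2) powr rate}"
  have "\<forall>u\<in>set vs. \<exists>\<epsilon>>0. \<forall>k\<ge>u. prob (?small \<epsilon> k u) \<le> \<eta>'"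
    using prob_weight_small[OF _ \<eta>'] vs by blast
  from bchoice[OF this] obtain e where e: "\<And>u. u \<in> set vs \<Longrightarrow> e u > 0 \<and> (\<forall>k\<ge>u. prob (?small (e u) k u) \<le> \<eta>')"
    by blast
  obtain K where K: "\<And>k. k \<ge> K \<Longrightarrow> prob {\<omega> \<in> space M. \<not> sparse v k (hist (k * m) \<omega>)} \<le> \<eta>'"
    using prob_count_large[OF \<eta>', of v] unfolding sparse_def by blast
  define \<epsilon> where "\<epsilon> = Min (insert 1 (e ` set vs))"
  have \<epsilon>: "\<epsilon> > 0" "\<And>u. u \<in> set vs \<Longrightarrow> \<epsilon> \<le> e u"
    using e by (auto simp: \<epsilon>_def)
  show ?thesis
  \<comment> \<open>\<open>sum_list vs\<close> serves as an upper bound for all nodes in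
    \<open>vs\<close>.\<close>
  proof (intro exI[of _ \<epsilon>] conjI exI[of _ "K + sum_list vs"] allI impI \<epsilon>)
    fix k assume k: "K + sum_list vs \<le> k"
    let ?A = "{\<omega> \<in> space M. \<not> sparse v k (hist (k * m) \<omega>)}"
    have small: "prob (?small \<epsilon> k u) \<le> \<eta>'" if u: "u \<in> set vs" for u
    proof -
      have "u \<le> k"
        using member_le_sum_list[OF u] k by simp
      have "\<epsilon> * (real k + 2) powr rate \<le> e u * (real k + 2) powr rate"
        using \<epsilon>(2)[OF u] by (intro mult_right_mono) auto
      then have "?small \<epsilon> k u \<subseteq> ?small (e u) k u"
        by (auto intro: less_le_trans)
      then have "prob (?small \<epsilon> k u) \<le> prob (?small (e u) k u)"
        by (intro finite_measure_mono hist_pred_event)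
      then show ?thesis
        using e[OF u] \<open>u \<le> k\<close> by fastforce
    qed
    have "{\<omega> \<in> space M. \<not> thick \<epsilon> vs v k (hist (k * m) \<omega>)} \<subseteq> ?A \<union> (\<Union>u\<in>set vs. ?small \<epsilon> k u)"
      by (auto simp: thick_def not_le)
    then have "prob {\<omega> \<in> space M. \<not> thick \<epsilon> vs v k (hist (k * m) \<omega>)} \<le> prob (?A \<union> (\<Union>u\<in>set vs. ?small \<epsilon> k u))"
      by (intro finite_measure_mono sets.Un sets.finite_UN hist_pred_event) auto
    also have "\<dots> \<le> prob ?A + prob (\<Union>u\<in>set vs. ?small \<epsilon> k u)"
      by (intro measure_Un_le sets.finite_UN hist_pred_event) auto
    also have "prob (\<Union>u\<in>set vs. ?small \<epsilon> k u) \<le> (\<Sum>u\<in>set vs. prob (?small \<epsilon> k u))"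
      using hist_pred_event[of "\<lambda>h. weight h _ < _"] by (intro finite_measure_subadditive_finite) auto
    also have "\<dots> \<le> (\<Sum>u\<in>set vs. \<eta>')"
      by (intro sum_mono small)
    also have "prob ?A + (\<Sum>u\<in>set vs. \<eta>') \<le> \<eta>' + (\<Sum>u\<in>set vs. \<eta>')"
      using K[of k] k by simp
    also have "\<dots> = \<eta>' * (real (card (set vs)) + 1)"
      by (simp add: algebra_simps)
    also have "\<dots> = \<eta>"
      by (simp add: \<eta>'_def)
    finally show "prob {\<omega> \<in> space M. \<not> thick \<epsilon> vs v k (hist (k * m) \<omega>)} \<le> \<eta>"
      by simp
  qed
qed

lemma sum_inverse_unbounded: "\<exists>N\<ge>K. b \<le> (\<Sum>k\<in>{K..<N}. 1 / (real k + 2))"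
proof -
  have le: "ln (real N + 2) - ln (real K + 2) \<le> (\<Sum>k\<in>{K..<N}. 1 / (real k + 2))" if "N \<ge> K" for N
    using that
  proof (induction N rule: dec_induct)
    case (step N)
    then show ?case
      using ln_ratio_le[of "real N + 2"] by (simp add: algebra_simps)
  qed simp
  define N where "N = max K (nat \<lceil>exp (b + ln (real K + 2))\<rceil>)"
  have "exp (b + ln (real K + 2)) \<le> real N + 2"
    by (simp add: N_def) linarith
  then have "b + ln (real K + 2) \<le> ln (real N + 2)"
    by (simp add: ln_ge_iff)
  then show ?thesis
    using le[of N] by (intro exI[of _ N]) (auto simp: N_def)
qed

text \<open>\<open>thick\<close> is likely at every single time, but is not shown to hold from some
  time on. So the loss in the sum of the \<open>c / (k + 2)\<close> at times that are not thick is
  bounded in expectation, by \<eta> times the whole sum; by Markov's inequality at least half is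
  lost with probability at most \<open>2 * \<eta>\<close>.\<close>

lemma prob_never_attaches:
  assumes vs: "\<And>u. u \<in> set vs \<Longrightarrow> u \<ge> 1"
    and L: "length vs \<le> m" "real (length vs) * (1 - rate) \<le> 1"
  shows "prob {\<omega> \<in> space M. \<forall>k\<ge>K0. \<not> attaches vs v k (hist (Suc k * m) \<omega>) m} = 0"
proof -
  let ?P = "prob {\<omega> \<in> space M. \<forall>k\<ge>K0. \<not> attaches vs v k (hist (Suc k * m) \<omega>) m}"
  have "?P \<le> 0 + e" if "e > 0" for e
  proof -
    \<comment> \<open>One third is for \<open>exp (- b)\<close>, two thirds are for the loss of half
      of the sum.\<close>
    define \<eta> where "\<eta> = e / 3"
    have \<eta>: "\<eta> > 0"
      using that by (simp add: \<eta>_def)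
    obtain \<epsilon> K1 where \<epsilon>: "\<epsilon> > 0" and K1: "\<And>k. k \<ge> K1 \<Longrightarrow>
        prob {\<omega> \<in> space M. \<not> thick \<epsilon> vs v k (hist (k * m) \<omega>)} \<le> \<eta>"
      using prob_not_thick[OF vs \<eta>, where v = v] by blast
    obtain c where c: "c > 0" "\<And>k h. thick \<epsilon> vs v k h \<Longrightarrow> c / (real k + 2) \<le> block_prob vs v k h"
      using block_prob_lower[OF L \<epsilon>, where v = v] by blast
    define K where "K = K0 + K1 + sum_list vs"
    define b where "b = max 1 (- ln \<eta>)"
    have b: "b \<ge> 1" "exp (- b) \<le> \<eta>"
      using \<eta> exp_le_cancel_iff[of "- b" "ln \<eta>"] by (auto simp: b_def)
    \<comment> \<open>Twice the required amount: if less than half is lost, at least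
      \<open>b\<close> remains.\<close>
    obtain N where N: "N \<ge> K" "2 * b / c \<le> (\<Sum>k\<in>{K..<N}. 1 / (real k + 2))"
      using sum_inverse_unbounded by blast
    define a where "a k = c / (real k + 2)" for k :: nat
    define A where "A = (\<Sum>k\<in>{K..<N}. a k)"
    have a0: "a k \<ge> 0" for k
      using c by (simp add: a_def)
    have "A = c * (\<Sum>k\<in>{K..<N}. 1 / (real k + 2))"
      by (simp add: A_def a_def sum_distrib_left)
    then have A: "A \<ge> 2 * b"
      using N(2) c(1) by (simp add: field_simps)
    define B where "B h = (\<Sum>k\<in>{K..<N}. a k * of_bool (\<not> thick \<epsilon> vs v k (take (k * m) h)))" for h
    have "hist_exp (N * m) B = (\<Sum>k\<in>{K..<N}. a k * hist_exp (N * m) (\<lambda>h. of_bool (\<not> thick \<epsilon> vs v k (take (k * m) h))))"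
      unfolding B_def hist_exp_sum hist_exp_cmult ..
    also have "\<dots> \<le> (\<Sum>k\<in>{K..<N}. a k * \<eta>)"
    proof (intro sum_mono mult_left_mono a0)
      fix k assume k: "k \<in> {K..<N}"
      have "hist_exp (N * m) (\<lambda>h. of_bool (\<not> thick \<epsilon> vs v k (take (k * m) h))) =
          hist_exp (k * m) (\<lambda>h. of_bool (\<not> thick \<epsilon> vs v k h))"
        using k by (intro hist_exp_take) simp
      also have "\<dots> = prob {\<omega> \<in> space M. \<not> thick \<epsilon> vs v k (hist (k * m) \<omega>)}"
        by (rule prob_hist[symmetric])
      also have "\<dots> \<le> \<eta>"
        using k by (intro K1) (simp add: K_def)
      finally show "hist_exp (N * m) (\<lambda>h. of_bool (\<not> thick \<epsilon> vs v k (take (k * m) h))) \<le> \<eta>" .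
    qed
    also have "\<dots> = A * \<eta>"
      by (simp add: A_def sum_distrib_right)
    finally have EB: "hist_exp (N * m) B \<le> A * \<eta>" .
    have t: "take (k * m) (hist (N * m) \<omega>) = hist (k * m) \<omega>" if "k \<in> {K..<N}" for k \<omega>
      using that by (intro take_hist) simp
    have B_ge: "A / 2 \<le> B (hist (N * m) \<omega>)"
      if "(\<Sum>k\<in>{K..<N}. block_prob vs v k (hist (k * m) \<omega>)) < b" for \<omega>
    proof -
      have "A - B (hist (N * m) \<omega>) = (\<Sum>k\<in>{K..<N}. a k - a k * of_bool (\<not> thick \<epsilon> vs v k (hist (k * m) \<omega>)))"
      proof -
        have "B (hist (N * m) \<omega>) = (\<Sum>k\<in>{K..<N}. a k * of_bool (\<not> thick \<epsilon> vs v k (hist (k * m) \<omega>)))"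
          unfolding B_def by (intro sum.cong refl) (simp only: t)
        then show ?thesis
          by (simp only: A_def sum_subtractf)
      qed
      also have "\<dots> \<le> (\<Sum>k\<in>{K..<N}. block_prob vs v k (hist (k * m) \<omega>))"
        using c(2) block_prob_nonneg by (intro sum_mono) (auto simp: a_def)
      finally show ?thesis
        using that A by linarith
    qed
    let ?low = "prob {\<omega> \<in> space M. (\<Sum>k\<in>{K..<N}. block_prob vs v k (hist (k * m) \<omega>)) < b}"
    have "?low \<le>
        prob {\<omega> \<in> space M. A / 2 \<le> B (hist (N * m) \<omega>)}"
      using B_ge by (intro finite_measure_mono hist_pred_event) auto
    also have "\<dots> \<le> hist_exp (N * m) B / (A / 2)"
      using a0 A b by (intro hist_markov) (auto simp: B_def intro!: sum_nonneg)
    also have "\<dots> \<le> (A * \<eta>) / (A / 2)"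
      using EB A b by (intro divide_right_mono) auto
    also have "\<dots> = 2 * \<eta>"
      using A b by simp
    finally have P2: "?low \<le> 2 * \<eta>" .
    have vsK: "1 \<le> u \<and> u \<le> 2 + K" if "u \<in> set vs" for u
      using vs[OF that] member_le_sum_list[OF that] by (simp add: K_def)
    have ev: "{\<omega> \<in> space M. \<forall>k\<in>{K..<N}. \<not> attaches vs v k (hist (Suc k * m) \<omega>) m} \<in> events"
      using hist_pred_event by (intro sets.sets_Collect_finite_All) auto
    have "?P \<le> prob {\<omega> \<in> space M. \<forall>k\<in>{K..<N}. \<not> attaches vs v k (hist (Suc k * m) \<omega>) m}"
      using ev by (intro finite_measure_mono) (auto simp: K_def)
    also have "\<dots> \<le> exp (- b) + ?low"
      by (rule prob_no_success[OF vsK N(1)])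
    also have "\<dots> \<le> \<eta> + 2 * \<eta>"
      using b P2 by linarith
    finally show ?thesis
      by (simp add: \<eta>_def)
  qed
  then have "?P \<le> 0"
    by (rule field_le_epsilon)
  then show ?thesis
    using measure_nonneg[of M] by (simp add: antisym)
qed

text \<open>A neighbour of the new node outside \<open>vs\<close> comes from one of the slots after
  the first \<open>length vs\<close>, whose targets avoid \<open>near\<close>.\<close>

lemma attaches_adj:
  assumes \<omega>: "\<omega> \<in> space M" and att: "attaches vs v k (hist (Suc k * m) \<omega>) m" and len: "length vs \<le> m"
    and vs: "\<And>u. u \<in> set vs \<Longrightarrow> u \<le> 2 + k" and v: "v \<in> set vs"
  shows "(\<forall>u\<in>set vs. adj \<omega> (3 + k) u) \<and>
    (\<forall>u\<in>nbhd (adj \<omega>) {1..3 + k} (3 + k) - set vs. \<not> adj \<omega> u v)"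
proof (intro conjI ballI)
  have tgt: "hist (Suc k * m) \<omega> ! (k * m + j) = target (k * m + j) \<omega>" if "j < m" for j
    using that by (intro hist_nth) simp
  have tk: "take (k * m) (hist (Suc k * m) \<omega>) = hist (k * m) \<omega>"
    by (intro take_hist) simp
  have 1: "target (k * m + j) \<omega> = vs ! j" if "j < length vs" for j
    using att that len tgt[of j] unfolding attaches_def by (metis less_le_trans)
  have 2: "target (k * m + j) \<omega> \<notin> near (hist (k * m) \<omega>) v" if "j < m" "\<not> j < length vs" for j
    using att that tgt[of j] unfolding attaches_def tk by metis
  show "adj \<omega> (3 + k) u" if u: "u \<in> set vs" for u
  proof -
    obtain j where j: "j < length vs" "u = vs ! j"
      using u by (auto simp: in_set_conv_nth)
    then have "node (k * m + j) = 3 + k" "target (k * m + j) \<omega> = u"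
      using 1 len by (auto simp: node_block)
    then show ?thesis
      using adj_older[OF \<omega>, of u "3 + k"] vs[OF u] by auto
  qed
  fix u assume u: "u \<in> nbhd (adj \<omega>) {1..3 + k} (3 + k) - set vs"
  then have "u < 3 + k" "adj \<omega> (3 + k) u"
    by (auto simp: nbhd_def)
  then obtain i where i: "node i = 3 + k" "target i \<omega> = u"
    using adj_older[OF \<omega>, of u "3 + k"] by auto
  then have "i = k * m + i mod m"
    by (metis add_left_cancel div_mult_mod_eq node_def)
  moreover have "i mod m < m"
    using m_pos by simp
  moreover have "\<not> i mod m < length vs"
    using 1[of "i mod m"] i u calculation(1) by (metis DiffD2 nth_mem)
  ultimately have near: "u \<notin> near (hist (k * m) \<omega>) v"
    using 2[of "i mod m"] i(2) by metis
  \<comment> \<open>All edges among the nodes up to \<open>2 + k\<close> are sent before block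
    \<open>k\<close>, so \<open>near\<close> at that time contains every neighbour of
    \<open>v\<close> among them.\<close>
  have early: "i < k * m" if "node i \<le> 2 + k" for i
  proof -
    have "i div m < k"
      using that by (simp add: node_def)
    then show ?thesis
      using m_pos by (simp add: div_less_iff_less_mult)
  qed
  show "\<not> adj \<omega> u v"
  proof
    assume "adj \<omega> u v"
    then have adj: "adj \<omega> (max u v) (min u v)"
      using symp_adj[of \<omega>] by (auto simp: max_def min_def dest: sympD)
    have "u \<noteq> v"
      using u v by auto
    then have "min u v < max u v"
      by auto
    from adj_older[OF \<omega> this] adj consider "u \<in> {1, 2}"
      | i where "node i = max u v" "target i \<omega> = min u v"
      by (auto simp: max_def min_def split: if_splits)
    then have "u \<in> near (hist (k * m) \<omega>) v"
    proof cases
      case (2 i)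
      then have "i < k * m"
        using early[of i] vs[OF v] \<open>u < 3 + k\<close> by simp
      then show ?thesis
        using 2 unfolding near_def by (auto simp: hist_def max_def min_def intro!: exI[of _ i] split: if_splits)
    qed (auto simp: near_def)
    then show False
      using near by simp
  qed
qed

lemma AE_attachments:
  assumes V: "finite V" "V \<subseteq> {1..}" "card V \<le> m" "real (card V) * (1 - rate) \<le> 1" and v: "v \<in> V"
  shows "AE \<omega> in M. infinite {T. (\<forall>u\<in>V. adj \<omega> T u) \<and> (\<forall>u\<in>nbhd (adj \<omega>) {1..T} T - V. \<not> adj \<omega> u v)}"
proof -
  obtain vs where vs: "set vs = V" "length vs = card V"
    using finite_distinct_list[OF V(1)] distinct_card by metis
  let ?A = "\<lambda>K. {\<omega> \<in> space M. \<forall>k\<ge>K. \<not> attaches vs v k (hist (Suc k * m) \<omega>) m}"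
  have "AE \<omega> in M. \<not> (\<forall>k\<ge>K. \<not> attaches vs v k (hist (Suc k * m) \<omega>) m)" for K
  proof (rule AE_I[of _ _ "?A K"])
    show "?A K \<in> events"
    proof -
      have "{\<omega> \<in> space M. k \<ge> K \<longrightarrow> \<not> attaches vs v k (hist (Suc k * m) \<omega>) m} \<in> events" for k
        by (rule hist_pred_event[of "\<lambda>h. k \<ge> K \<longrightarrow> \<not> attaches vs v k h m" "Suc k * m"])
      then show ?thesis
        by (rule sets.sets_Collect_countable_All)
    qed
    have "prob (?A K) = 0"
      using V vs by (intro prob_never_attaches) auto
    then show "emeasure M (?A K) = 0"
      by (simp add: emeasure_eq_measure)
  qed auto
  then have "AE \<omega> in M. \<forall>K. \<not> (\<forall>k\<ge>K. \<not> attaches vs v k (hist (Suc k * m) \<omega>) m)"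
    by (intro AE_all_countable[THEN iffD2] allI)
  then show ?thesis
  proof (rule AE_mp, intro AE_I2 impI)
    fix \<omega> assume \<omega>: "\<omega> \<in> space M" and inf: "\<forall>K. \<not> (\<forall>k\<ge>K. \<not> attaches vs v k (hist (Suc k * m) \<omega>) m)"
    let ?I = "{T. (\<forall>u\<in>V. adj \<omega> T u) \<and> (\<forall>u\<in>nbhd (adj \<omega>) {1..T} T - V. \<not> adj \<omega> u v)}"
    show "infinite ?I"
      unfolding infinite_nat_iff_unbounded
    proof
      fix N
      obtain k where k: "k \<ge> N + sum_list vs" "attaches vs v k (hist (Suc k * m) \<omega>) m"
        using inf by blast
      have "u \<le> 2 + k" if "u \<in> set vs" for u
        using member_le_sum_list[OF that] k(1) by simp
      from attaches_adj[OF \<omega> k(2) _ this] have "3 + k \<in> ?I"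
        using V v vs by simp
      then show "\<exists>n>N. n \<in> ?I"
        using k(1) by (intro exI[of _ "3 + k"]) auto
    qed
  qed
qed

section \<open>The two cases for the Betti number\<close>

theorem AE_betti_infinite:
  assumes "q \<ge> 1" "2 * q \<le> m" "(2 * real q + 2) * (1 - rate) > 1" "2 * real q * (1 - rate) \<le> 1"
  shows "AE \<omega> in M. betti_number TYPE('f::field) (pa_clique_complex m (\<lambda>s \<beta>. E s \<beta> \<omega>)) q = \<infinity>"
proof -
  let ?I = "\<lambda>\<omega> V v. {T. (\<forall>u\<in>V. adj \<omega> T u) \<and> (\<forall>u\<in>nbhd (adj \<omega>) {1..T} T - V. \<not> adj \<omega> u v)}"
  \<comment> \<open>The sphere, and with it \<open>V\<close> and \<open>v\<close>, will depend on
    \<omega>, so the attachments are established almost surely for all of the countably many pairs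
    at once.\<close>
  define X where "X = {V :: nat set. finite V \<and> V \<subseteq> {1..} \<and> card V \<le> 2 * q} \<times> (UNIV :: nat set)"
  have "countable {V :: nat set. finite V \<and> V \<subseteq> {1..} \<and> card V \<le> 2 * q}"
    by (rule countable_subset[OF _ countable_Collect_finite]) auto
  then have "countable X"
    unfolding X_def by (rule countable_SIGMA) (rule countableI_type)
  have "AE \<omega> in M. \<forall>y\<in>X. snd y \<in> fst y \<longrightarrow> infinite (?I \<omega> (fst y) (snd y))"
  proof (rule AE_ball_countable'[OF _ \<open>countable X\<close>])
    fix y assume y: "y \<in> X"
    show "AE \<omega> in M. snd y \<in> fst y \<longrightarrow> infinite (?I \<omega> (fst y) (snd y))"
    proof (cases "snd y \<in> fst y")
      case True
      have c: "card (fst y) \<le> 2 * q"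
        using y by (auto simp: X_def)
      then have "real (card (fst y)) \<le> 2 * real q"
        by linarith
      then have "real (card (fst y)) * (1 - rate) \<le> 2 * real q * (1 - rate)"
        using rate_less_1 by (intro mult_right_mono) auto
      then have "AE \<omega> in M. infinite (?I \<omega> (fst y) (snd y))"
        using y True assms c by (intro AE_attachments) (auto simp: X_def)
      then show ?thesis
        by (rule AE_mp) auto
    qed simp
  qed
  \<comment> \<open>The degree \<open>q + 1\<close> is at least 2 even for \<open>q = 1\<close>;
    acyclic links in this degree keep the classes alive.\<close>
  moreover have "AE \<omega> in M. \<exists>T0. \<forall>T>T0. no_homology TYPE('f) (adj \<omega>) (nbhd (adj \<omega>) {1..T} T) (Suc q)"
    using assms by (intro AE_links_no_homology) (auto simp: algebra_simps)
  ultimately show ?thesis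
  proof (elim AE_mp, intro AE_I2 impI)
    fix \<omega> assume \<omega>: "\<omega> \<in> space M"
      and nh: "\<exists>T0. \<forall>T>T0. no_homology TYPE('f) (adj \<omega>) (nbhd (adj \<omega>) {1..T} T) (Suc q)"
      and inf: "\<forall>y\<in>X. snd y \<in> fst y \<longrightarrow> infinite (?I \<omega> (fst y) (snd y))"
    have inf: "infinite (?I \<omega> V v)" if "finite V" "V \<subseteq> {1..}" "card V \<le> 2 * q" "v \<in> V" for V v
      using inf[rule_format, of "(V, v)"] that by (simp add: X_def)
    have att: "infinite {T. \<forall>u\<in>V. adj \<omega> T u}" if "finite V" "V \<subseteq> {1..}" "v \<in> V" "card V \<le> 2 * q" for V v
      using inf[OF that(1,2,4,3)] by (rule infinite_super[rotated]) auto
    have "\<exists>V (z :: nat set \<Rightarrow>\<^sub>0 'f) \<sigma>. sphere (adj \<omega>) q V z \<sigma>"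
      by (rule spheres_exist[OF symp_adj card_older_neighbours[OF \<omega>] _ order.refl]) (rule att)
    then obtain V \<sigma> and z :: "nat set \<Rightarrow>\<^sub>0 'f" where sph: "sphere (adj \<omega>) q V z \<sigma>"
      by blast
    then have \<sigma>: "\<sigma> \<in> cliques (adj \<omega>) V q"
      by (auto simp: sphere_def chains_def)
    then have "\<sigma> \<noteq> {}"
      using assms(1) by (auto simp: cliques_def)
    then obtain v where v: "v \<in> \<sigma>"
      by auto
    have V: "finite V" "V \<subseteq> {1..}" "card V \<le> 2 * q" "v \<in> V"
      using sph \<sigma> v by (auto simp: sphere_def cliques_def)
    obtain T0 where T0: "\<And>T. T > T0 \<Longrightarrow> no_homology TYPE('f) (adj \<omega>) (nbhd (adj \<omega>) {1..T} T) (Suc q)"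
      using nh by blast
    show "betti_number TYPE('f) (pa_clique_complex m (\<lambda>s \<beta>. E s \<beta> \<omega>)) q = \<infinity>"
      unfolding pa_clique_complex_def
      by (rule betti_infiniteI[of q T0 _ V z \<sigma> v])
        (use assms(1) T0 sph v inf[OF V] in \<open>auto simp: adj_def\<close>)
  qed
qed

theorem AE_betti_finite:
  assumes "q \<ge> 2" "2 * real q * (1 - rate) > 1"
  shows "AE \<omega> in M. betti_number TYPE('f::field) (pa_clique_complex m (\<lambda>s \<beta>. E s \<beta> \<omega>)) q < \<infinity>"
proof -
  have "AE \<omega> in M. \<exists>T0. \<forall>T>T0. no_homology TYPE('f) (adj \<omega>) (nbhd (adj \<omega>) {1..T} T) q"
    using assms by (rule AE_links_no_homology)
  then show ?thesis
  proof (rule AE_mp, intro AE_I2 impI)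
    fix \<omega> assume "\<exists>T0. \<forall>T>T0. no_homology TYPE('f) (adj \<omega>) (nbhd (adj \<omega>) {1..T} T) q"
    then obtain T0 where T0: "\<And>T. T > T0 \<Longrightarrow> no_homology TYPE('f) (adj \<omega>) (nbhd (adj \<omega>) {1..T} T) q"
      by blast
    show "betti_number TYPE('f) (pa_clique_complex m (\<lambda>s \<beta>. E s \<beta> \<omega>)) q < \<infinity>"
      unfolding pa_clique_complex_def using assms(1) T0
      by (intro betti_finiteI[of q T0]) (auto simp: adj_def)
  qed
qed

end

theorem mainTheorem3:
  fixes M :: "'w measure" and E :: "nat \<Rightarrow> nat \<Rightarrow> 'w \<Rightarrow> nat"
    and q m :: nat and \<delta> x :: real
  defines "x \<equiv> pa_exponent \<delta> m"
  assumes "q \<ge> 1" and "m \<ge> 2 * q" and "\<delta> > - real m"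
    and "preferential_attachment M m \<delta> E"
    and "x > 1 / (2 * real q + 2)"
  shows "(x \<le> 1 / (2 * real q) \<longrightarrow>
            (AE \<omega> in M. betti_number TYPE('f::field)
               (pa_clique_complex m (\<lambda>s \<beta>. E s \<beta> \<omega>)) q = \<infinity>))
       \<and> (x > 1 / (2 * real q) \<and> q \<ge> 2 \<longrightarrow>
            (AE \<omega> in M. betti_number TYPE('f)
               (pa_clique_complex m (\<lambda>s \<beta>. E s \<beta> \<omega>)) q < \<infinity>))"
proof -
  interpret preferential_attachment M m \<delta> E
    by fact
  have x: "x = 1 - rate"
    unfolding x_def by (rule pa_exponent_eq)
  have 1: "(2 * real q + 2) * (1 - rate) > 1"
    using assms(6) unfolding x by (simp add: divide_less_eq mult.commute)
  show ?thesis
  proof (intro conjI impI)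
    assume "x \<le> 1 / (2 * real q)"
    then have "2 * real q * (1 - rate) \<le> 1"
      using assms(2) unfolding x by (simp add: pos_le_divide_eq mult.commute)
    with 1 show "AE \<omega> in M. betti_number TYPE('f) (pa_clique_complex m (\<lambda>s \<beta>. E s \<beta> \<omega>)) q = \<infinity>"
      using assms(2,3) by (intro AE_betti_infinite) auto
  next
    assume "x > 1 / (2 * real q) \<and> q \<ge> 2"
    then have "q \<ge> 2" "2 * real q * (1 - rate) > 1"
      unfolding x by (auto simp: divide_less_eq mult.commute)
    then show "AE \<omega> in M. betti_number TYPE('f) (pa_clique_complex m (\<lambda>s \<beta>. E s \<beta> \<omega>)) q < \<infinity>"
      by (rule AE_betti_finite)
  qed
qed

end
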